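(* Let $\{X_{i,k}:i\ge0,k\ge1\}$ be independent real random variables with mean zero, variance one and $\sup_{i,k}\mathbb E|X_{i,k}|^l<\infty$ for each $l\ge3$. For $n\ge1$ and $t\ge0$ let $S^{(n)}_i(t)=\sum_{k=1}^{[nt]}X_{i,k}$, let $\lambda_{1,n}(t),\dots,\lambda_{n,n}(t)$ be the eigenvalues of the symmetric circulant matrix $n^{-1}((S^{(n)}_{L^1(i,j)}(t)))_{1\le i,j\le n}$ with $L^1(i,j)=n/2-|n/2-|i-j||$, labelled by Fourier frequency, let $U_n$ be uniformly distributed on $\{1,\dots,n\}$ and independent of $\{\lambda_{r,n}(t):1\le r\le n,\ t\ge0\}$, and set $$Y_n(t)=\lambda_{U_n,n}(t)=\sum_{r=1}^n\lambda_{r,n}(t)\,\mathbb I(U_n=r),\qquad t\ge0.$$ Then, as $n\to\infty$, the process $\{Y_n(t)\}_{t\ge0}$ converges weakly to a standard Brownian motion $\{W(t)\}_{t\ge0}$.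
   Context: $[x]$ is the greatest integer $\le x$. Labelling by Fourier frequency means $$\lambda_{r,n}(t)=\frac1n\sum_{j=0}^{n-1}S^{(n)}_{\min(j,n-j)}(t)\cos\Big(\frac{2\pi rj}{n}\Big),\qquad r=1,\dots,n,$$ which for odd $n$ equals $\frac1n S_0^{(n)}(t)+\frac2n\sum_{j=1}^{[n/2]}S^{(n)}_j(t)\cos(2\pi rj/n)$. Weak convergence of processes is in the Skorokhod space $D[0,\infty)$. *)

theory Defs
  imports "HOL-Probability.Probability" "Jordan_Normal_Form.Char_Poly"
begin

section \<open>The Skorokhod space \<open>D[0,\<infinity>)\<close>\<close>

text \<open>A path is a function on \<open>[0,\<infinity>)\<close>, represented by an extensional function on \<open>{0..}\<close> so that
  equality of paths is equality of functions.\<close>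

definition cadlag_space :: "(real \<Rightarrow> real) set" where
  "cadlag_space = {x \<in> extensional {0..}.
     (\<forall>t\<ge>0. continuous (at_right t) x) \<and> (\<forall>t>0. \<exists>l. (x \<longlongrightarrow> l) (at_left t))}"

definition time_changes :: "real \<Rightarrow> (real \<Rightarrow> real) set" where
  "time_changes T = {l. strict_mono_on {0..T} l \<and> continuous_on {0..T} l \<and> l ` {0..T} = {0..T}}"

text \<open>Skorokhod's \<open>J\<^sub>1\<close> distance on \<open>[0,T]\<close>:
  the infimum over time changes \<open>l\<close> of \<open>\<parallel>l - id\<parallel> \<squnion> \<parallel>x - y \<circ> l\<parallel>\<close>, with sup norms over \<open>[0,T]\<close>.\<close>

definition skorokhod_dist_on :: "real \<Rightarrow> (real \<Rightarrow> real) \<Rightarrow> (real \<Rightarrow> real) \<Rightarrow> ennreal" where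
  "skorokhod_dist_on T x y = (INF l\<in>time_changes T.
     max (SUP t\<in>{0..T}. ennreal \<bar>l t - t\<bar>) (SUP t\<in>{0..T}. ennreal \<bar>x t - y (l t)\<bar>))"

text \<open>The path is multiplied by a function that is \<open>1\<close> on \<open>[0,m-1]\<close>, linear on \<open>[m-1,m]\<close>
  and \<open>0\<close> after \<open>m\<close>, so that a jump at the time \<open>m\<close> plays no special role.\<close>

definition taper :: "nat \<Rightarrow> (real \<Rightarrow> real) \<Rightarrow> real \<Rightarrow> real" where
  "taper m x t = max 0 (min 1 (real m - t)) * x t"

text \<open>Billingsley's metric
  \<open>d\<^sub>\<infinity>(x,y) = \<Sum>\<^bsub>m\<ge>1\<^esub> 2\<^sup>-\<^sup>m (1 \<sqinter> d\<^sub>m(x\<^sup>m,y\<^sup>m))\<close> for the Skorokhod topology on \<open>D[0,\<infinity>)\<close>.\<close>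

definition skorokhod_dist :: "(real \<Rightarrow> real) \<Rightarrow> (real \<Rightarrow> real) \<Rightarrow> real" where
  "skorokhod_dist x y = (\<Sum>m. (1/2) ^ Suc m *
     enn2real (min 1 (skorokhod_dist_on (real (Suc m)) (taper (Suc m) x) (taper (Suc m) y))))"

abbreviation skorokhod_topology :: "(real \<Rightarrow> real) topology" where
  "skorokhod_topology \<equiv> Metric_space.mtopology cadlag_space skorokhod_dist"

lemma time_changes_id: "(\<lambda>t. t) \<in> time_changes T"
  by (auto simp: time_changes_def strict_mono_on_def)

lemma time_changes_inv:
  assumes "l \<in> time_changes T"
  shows "inv_into {0..T} l \<in> time_changes T"
proof -
  have sm: "strict_mono_on {0..T} l" and c: "continuous_on {0..T} l" and im: "l ` {0..T} = {0..T}"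
    using assms by (auto simp: time_changes_def)
  have inj: "inj_on l {0..T}" using sm by (rule strict_mono_on_imp_inj_on)
  have "continuous_on (l ` {0..T}) (inv_into {0..T} l)"
    by (rule continuous_on_inv[OF c]) (auto simp: inj)
  moreover have "strict_mono_on {0..T} (inv_into {0..T} l)"
  proof (rule strict_mono_onI)
    fix r s assume rs: "r \<in> {0..T}" "s \<in> {0..T}" "r < s"
    let ?g = "inv_into {0..T} l"
    have g: "?g r \<in> {0..T}" "?g s \<in> {0..T}" "l (?g r) = r" "l (?g s) = s"
      using rs im by (metis inv_into_into f_inv_into_f)+
    show "?g r < ?g s"
    proof (rule ccontr)
      assume "\<not> ?g r < ?g s"
      then have "l (?g s) \<le> l (?g r)"
        by (intro mono_onD[OF strict_mono_on_imp_mono_on[OF sm]] g) simp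
      then show False using g rs by simp
    qed
  qed
  moreover have "inv_into {0..T} l ` {0..T} = {0..T}"
    using inv_into_image_cancel[OF inj, of "{0..T}"] im by simp
  ultimately show ?thesis using im by (simp add: time_changes_def)
qed

lemma time_changes_comp:
  assumes "l \<in> time_changes T" "k \<in> time_changes T"
  shows "(\<lambda>t. k (l t)) \<in> time_changes T"
proof -
  have l: "strict_mono_on {0..T} l" "continuous_on {0..T} l" "l ` {0..T} = {0..T}"
    and k: "strict_mono_on {0..T} k" "continuous_on {0..T} k" "k ` {0..T} = {0..T}"
    using assms by (auto simp: time_changes_def)
  have "strict_mono_on {0..T} (\<lambda>t. k (l t))"
  proof (rule strict_mono_onI)
    fix r s assume rs: "r \<in> {0..T}" "s \<in> {0..T}" "r < s"
    then have "l r \<in> {0..T}" "l s \<in> {0..T}" using l(3) by blast+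
    then show "k (l r) < k (l s)" using rs l(1) k(1) by (meson strict_mono_onD)
  qed
  moreover have "continuous_on {0..T} (\<lambda>t. k (l t))"
    using continuous_on_compose2[OF k(2) l(2)] l(3) by blast
  moreover have "(\<lambda>t. k (l t)) ` {0..T} = {0..T}"
    using l(3) k(3) by (metis image_image)
  ultimately show ?thesis by (simp add: time_changes_def)
qed

lemma time_changes_mem: "l \<in> time_changes T \<Longrightarrow> t \<in> {0..T} \<Longrightarrow> l t \<in> {0..T}"
  by (auto simp: time_changes_def)

lemma skorokhod_dist_on_commute_le: "skorokhod_dist_on T y x \<le> skorokhod_dist_on T x y"
  unfolding skorokhod_dist_on_def
proof (rule INF_mono)
  fix l assume l: "l \<in> time_changes T"
  let ?g = "inv_into {0..T} l"
  have inj: "inj_on l {0..T}" and im: "l ` {0..T} = {0..T}"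
    using l by (auto simp: time_changes_def intro: strict_mono_on_imp_inj_on)
  have g: "?g t \<in> {0..T}" "l (?g t) = t" if "t \<in> {0..T}" for t
    using that im by (metis inv_into_into, metis f_inv_into_f)
  have "(SUP t\<in>{0..T}. ennreal \<bar>?g t - t\<bar>) \<le> (SUP t\<in>{0..T}. ennreal \<bar>l t - t\<bar>)"
  proof (rule SUP_mono)
    fix t assume "t \<in> {0..T}"
    then show "\<exists>s\<in>{0..T}. ennreal \<bar>?g t - t\<bar> \<le> ennreal \<bar>l s - s\<bar>"
      using g by (intro bexI[of _ "?g t"]) (auto simp: abs_minus_commute)
  qed
  moreover have "(SUP t\<in>{0..T}. ennreal \<bar>y t - x (?g t)\<bar>) \<le> (SUP t\<in>{0..T}. ennreal \<bar>x t - y (l t)\<bar>)"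
  proof (rule SUP_mono)
    fix t assume "t \<in> {0..T}"
    then show "\<exists>s\<in>{0..T}. ennreal \<bar>y t - x (?g t)\<bar> \<le> ennreal \<bar>x s - y (l s)\<bar>"
      using g by (intro bexI[of _ "?g t"]) (auto simp: abs_minus_commute)
  qed
  ultimately show "\<exists>n\<in>time_changes T.
      max (SUP t\<in>{0..T}. ennreal \<bar>n t - t\<bar>) (SUP t\<in>{0..T}. ennreal \<bar>y t - x (n t)\<bar>)
      \<le> max (SUP t\<in>{0..T}. ennreal \<bar>l t - t\<bar>) (SUP t\<in>{0..T}. ennreal \<bar>x t - y (l t)\<bar>)"
    using time_changes_inv[OF l] by (intro bexI[of _ ?g] max.mono) auto
qed

lemma skorokhod_dist_on_commute: "skorokhod_dist_on T x y = skorokhod_dist_on T y x"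
  by (intro antisym skorokhod_dist_on_commute_le)

lemma skorokhod_dist_on_triangle:
  "skorokhod_dist_on T x z \<le> skorokhod_dist_on T x y + skorokhod_dist_on T y z"
proof -
  define a where "a l = max (SUP t\<in>{0..T}. ennreal \<bar>l t - t\<bar>) (SUP t\<in>{0..T}. ennreal \<bar>x t - y (l t)\<bar>)" for l
  define b where "b l = max (SUP t\<in>{0..T}. ennreal \<bar>l t - t\<bar>) (SUP t\<in>{0..T}. ennreal \<bar>y t - z (l t)\<bar>)" for l
  have main: "skorokhod_dist_on T x z \<le> a l + b k"
    if l: "l \<in> time_changes T" and k: "k \<in> time_changes T" for l k
  proof -
    have la: "ennreal \<bar>l t - t\<bar> \<le> a l" "ennreal \<bar>x t - y (l t)\<bar> \<le> a l" if "t \<in> {0..T}" for t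
      unfolding a_def using that
      by - (intro max.coboundedI1 SUP_upper, assumption, intro max.coboundedI2 SUP_upper, assumption)
    have kb: "ennreal \<bar>k t - t\<bar> \<le> b k" "ennreal \<bar>y t - z (k t)\<bar> \<le> b k" if "t \<in> {0..T}" for t
      unfolding b_def using that
      by - (intro max.coboundedI1 SUP_upper, assumption, intro max.coboundedI2 SUP_upper, assumption)
    have add: "ennreal \<bar>p - r\<bar> \<le> ennreal \<bar>p - q\<bar> + ennreal \<bar>q - r\<bar>" for p q r :: real
      by (auto simp flip: ennreal_plus intro!: ennreal_leI)
    have "skorokhod_dist_on T x z \<le> max (SUP t\<in>{0..T}. ennreal \<bar>k (l t) - t\<bar>)
        (SUP t\<in>{0..T}. ennreal \<bar>x t - z (k (l t))\<bar>)"
      unfolding skorokhod_dist_on_def by (rule INF_lower) (rule time_changes_comp[OF l k])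
    also have "\<dots> \<le> a l + b k"
    proof (intro max.boundedI SUP_least)
      fix t assume t: "t \<in> {0..T}"
      note lt = time_changes_mem[OF l t]
      show "ennreal \<bar>k (l t) - t\<bar> \<le> a l + b k"
        using add[of "k (l t)" t "l t"] add_mono[OF la(1)[OF t] kb(1)[OF lt]]
        by (simp add: add.commute)
      show "ennreal \<bar>x t - z (k (l t))\<bar> \<le> a l + b k"
        using add[of "x t" "z (k (l t))" "y (l t)"] add_mono[OF la(2)[OF t] kb(2)[OF lt]]
        by simp
    qed
    finally show ?thesis .
  qed
  have "skorokhod_dist_on T x z \<le> (INF l\<in>time_changes T. a l) + (INF k\<in>time_changes T. b k)"
    (is "_ \<le> ?a + ?b")
  proof (rule ennreal_le_epsilon)
    fix e :: real assume fin: "?a + ?b < top_class.top" and e: "0 < e"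
    have "v < v + ennreal (e / 2)" if "v < top_class.top" for v
      using that e ennreal_add_left_cancel_less[of v 0 "ennreal (e / 2)"]
      by (auto simp: less_top[symmetric])
    moreover have "?a < top_class.top" "?b < top_class.top"
      using fin unfolding ennreal_add_less_top by blast+
    ultimately have "?a < ?a + ennreal (e / 2)" "?b < ?b + ennreal (e / 2)"
      by blast+
    then obtain l k where l: "l \<in> time_changes T" "a l < ?a + ennreal (e / 2)"
      and k: "k \<in> time_changes T" "b k < ?b + ennreal (e / 2)"
      unfolding INF_less_iff by blast
    have "skorokhod_dist_on T x z \<le> (?a + ennreal (e / 2)) + (?b + ennreal (e / 2))"
      using main[OF l(1) k(1)] add_mono[OF less_imp_le[OF l(2)] less_imp_le[OF k(2)]]
      by (rule order_trans)
    also have "\<dots> = ?a + ?b + (ennreal (e / 2) + ennreal (e / 2))" by (simp add: ac_simps)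
    also have "ennreal (e / 2) + ennreal (e / 2) = ennreal e"
      using e by (simp flip: ennreal_plus)
    finally show "skorokhod_dist_on T x z \<le> ?a + ?b + ennreal e" .
  qed
  then show ?thesis by (simp add: skorokhod_dist_on_def a_def b_def)
qed

lemma skorokhod_dist_on_self: "skorokhod_dist_on T x x = 0"
proof -
  have "skorokhod_dist_on T x x \<le> max (SUP t\<in>{0..T}. ennreal \<bar>t - t\<bar>) (SUP t\<in>{0..T}. ennreal \<bar>x t - x t\<bar>)"
    unfolding skorokhod_dist_on_def by (rule INF_lower) (rule time_changes_id)
  then show ?thesis by (auto simp: SUP_constant bot_ennreal split: if_splits)
qed

lemma enn2real_min_1_le: "enn2real (min 1 a) \<le> 1"
  by (metis enn2real_1 enn2real_mono ennreal_one_less_top min.cobounded1)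

lemma summable_skorokhod_dist: "summable (\<lambda>m. (1/2::real) ^ Suc m * enn2real (min 1 (f m)))"
proof (rule summable_comparison_test')
  show "summable (\<lambda>m. (1/2::real) ^ Suc m)" by (subst summable_Suc_iff) simp
  show "norm ((1/2::real) ^ Suc m * enn2real (min 1 (f m))) \<le> (1/2) ^ Suc m" for m
    using enn2real_min_1_le[of "f m"] mult_left_mono[of "enn2real (min 1 (f m))" 1 "(1/2) ^ Suc m"]
    by simp
qed

lemma cadlag_right:
  assumes "x \<in> cadlag_space" "t \<ge> 0" "e > 0"
  shows "\<exists>d>0. \<forall>s. t \<le> s \<and> s < t + d \<longrightarrow> \<bar>x s - x t\<bar> < e"
proof -
  have "continuous (at_right t) x" using assms by (simp add: cadlag_space_def)
  then have "(x \<longlongrightarrow> x t) (at_right t)" by (simp add: continuous_within)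
  then have "eventually (\<lambda>s. dist (x s) (x t) < e) (at_right t)"
    using assms(3) by (rule tendstoD)
  then obtain b where "b > t" and b: "\<And>s. t < s \<Longrightarrow> s < b \<Longrightarrow> \<bar>x s - x t\<bar> < e"
    unfolding eventually_at_right_field dist_real_def by blast
  have "\<bar>x s - x t\<bar> < e" if "t \<le> s" "s < t + (b - t)" for s
    using b[of s] that assms(3) by (cases "s = t") auto
  then show ?thesis using \<open>b > t\<close> by (intro exI[of _ "b - t"]) auto
qed

lemma skorokhod_dist_on_zero_imp_eq:
  assumes x: "x \<in> cadlag_space" and y: "y \<in> cadlag_space" and t: "t \<ge> 0" and m: "t + 2 \<le> real m"
    and zero: "skorokhod_dist_on (real m) (taper m x) (taper m y) = 0"
  shows "x t = y t"
proof -
  have "\<bar>x t - y t\<bar> \<le> 3 * e" if e: "e > 0" for e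
  proof -
    obtain d1 where d1: "d1 > 0" "\<And>s. t \<le> s \<Longrightarrow> s < t + d1 \<Longrightarrow> \<bar>x s - x t\<bar> < e"
      using cadlag_right[OF x t e] by blast
    obtain d2 where d2: "d2 > 0" "\<And>s. t \<le> s \<Longrightarrow> s < t + d2 \<Longrightarrow> \<bar>y s - y t\<bar> < e"
      using cadlag_right[OF y t e] by blast
    define d where "d = min 1 (min d1 d2)"
    define s where "s = t + d / 2"
    define c where "c = min e (d / 2)"
    have d: "0 < d" "d \<le> 1" "d \<le> d1" "d \<le> d2" using d1 d2 by (auto simp: d_def)
    have c: "0 < c" "c \<le> e" "c \<le> d / 2" using e d by (auto simp: c_def)
    have "skorokhod_dist_on (real m) (taper m x) (taper m y) < ennreal c"
      using c zero by simp
    then obtain l where l: "l \<in> time_changes (real m)"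
      and lt: "(SUP t\<in>{0..real m}. ennreal \<bar>l t - t\<bar>) < ennreal c"
        "(SUP t\<in>{0..real m}. ennreal \<bar>taper m x t - taper m y (l t)\<bar>) < ennreal c"
      unfolding skorokhod_dist_on_def by (auto simp: INF_less_iff)
    have s: "s \<in> {0..real m}" using t m d by (auto simp: s_def)
    have "ennreal \<bar>l s - s\<bar> < ennreal c"
      using SUP_upper[OF s, of "\<lambda>t. ennreal \<bar>l t - t\<bar>"] lt(1) by (rule order_le_less_trans)
    then have ls: "\<bar>l s - s\<bar> < c" by (simp add: ennreal_less_iff)
    have "ennreal \<bar>taper m x s - taper m y (l s)\<bar> < ennreal c"
      using SUP_upper[OF s, of "\<lambda>t. ennreal \<bar>taper m x t - taper m y (l t)\<bar>"] lt(2)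
      by (rule order_le_less_trans)
    then have xy: "\<bar>taper m x s - taper m y (l s)\<bar> < c" by (simp add: ennreal_less_iff)
    have bounds: "t \<le> l s" "l s < t + d" "t \<le> s" "s < t + d"
      using ls c d unfolding s_def by (auto simp: abs_less_iff)
    then have "l s \<le> real m - 1" "s \<le> real m - 1" using d m by linarith+
    then have "taper m x s = x s" "taper m y (l s) = y (l s)" by (auto simp: taper_def)
    then have "\<bar>x s - y (l s)\<bar> < e" using xy c by linarith
    moreover have "\<bar>x s - x t\<bar> < e" "\<bar>y (l s) - y t\<bar> < e"
      using d1(2)[of s] d2(2)[of "l s"] bounds d by auto
    ultimately show ?thesis by linarith
  qed
  from this[of "\<bar>x t - y t\<bar> / 6"] show ?thesis by (cases "x t = y t") auto
qed

lemma Metric_space_skorokhod: "Metric_space cadlag_space skorokhod_dist"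
proof
  fix x y :: "real \<Rightarrow> real"
  show "0 \<le> skorokhod_dist x y"
    unfolding skorokhod_dist_def by (rule suminf_nonneg[OF summable_skorokhod_dist]) simp
  show "skorokhod_dist x y = skorokhod_dist y x"
    unfolding skorokhod_dist_def by (simp add: skorokhod_dist_on_commute)
next
  fix x y :: "real \<Rightarrow> real"
  assume x: "x \<in> cadlag_space" and y: "y \<in> cadlag_space"
  show "skorokhod_dist x y = 0 \<longleftrightarrow> x = y"
  proof
    assume "skorokhod_dist x y = 0"
    then have "\<forall>m. (1/2) ^ Suc m * enn2real
        (min 1 (skorokhod_dist_on (real (Suc m)) (taper (Suc m) x) (taper (Suc m) y))) = 0"
      unfolding skorokhod_dist_def by (subst (asm) suminf_eq_zero_iff[OF summable_skorokhod_dist]) auto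
    then have z: "skorokhod_dist_on (real (Suc m)) (taper (Suc m) x) (taper (Suc m) y) = 0" for m
      by (auto simp: enn2real_eq_0_iff min_def top_unique split: if_splits)
    show "x = y"
    proof (rule extensionalityI)
      show "x \<in> extensional {0..}" "y \<in> extensional {0..}" using x y by (auto simp: cadlag_space_def)
      fix t :: real assume t: "t \<in> {0..}"
      obtain m where "t + 2 \<le> real m" using real_arch_simple by blast
      then show "x t = y t"
        using skorokhod_dist_on_zero_imp_eq[OF x y, of t "Suc m"] z t by simp
    qed
  next
    assume "x = y"
    then show "skorokhod_dist x y = 0" by (simp add: skorokhod_dist_def skorokhod_dist_on_self)
  qed
next
  fix x y z :: "real \<Rightarrow> real"
  let ?d = "\<lambda>x y m. skorokhod_dist_on (real (Suc m)) (taper (Suc m) x) (taper (Suc m) y)"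
  have le: "enn2real (min 1 (?d x z m)) \<le> enn2real (min 1 (?d x y m)) + enn2real (min 1 (?d y z m))" for m
  proof -
    have fin: "min 1 a < (\<infinity>::ennreal)" for a
      using order_le_less_trans[OF min.cobounded1 ennreal_one_less_top] by simp
    have "min 1 c \<le> min 1 a + min 1 b" if "c \<le> a + b" for a b c :: ennreal
    proof (cases "a \<le> 1 \<and> b \<le> 1")
      case True
      then show ?thesis using that by (simp add: min.absorb2 min.coboundedI2)
    next
      case False
      then have "1 \<le> min 1 a + min 1 b" by (auto simp: min.absorb1 add_increasing add_increasing2)
      then show ?thesis by (rule min.coboundedI1)
    qed
    then have "min 1 (?d x z m) \<le> min 1 (?d x y m) + min 1 (?d y z m)"
      using skorokhod_dist_on_triangle by blast
    then have "enn2real (min 1 (?d x z m)) \<le> enn2real (min 1 (?d x y m) + min 1 (?d y z m))"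
      by (rule enn2real_mono) (use fin in \<open>simp add: ennreal_add_less_top\<close>)
    also have "\<dots> = enn2real (min 1 (?d x y m)) + enn2real (min 1 (?d y z m))"
      using fin by (intro enn2real_plus) auto
    finally show ?thesis .
  qed
  have "skorokhod_dist x z \<le> (\<Sum>m. (1/2) ^ Suc m * enn2real (min 1 (?d x y m))
      + (1/2) ^ Suc m * enn2real (min 1 (?d y z m)))"
    unfolding skorokhod_dist_def
    by (intro suminf_le summable_add summable_skorokhod_dist)
      (use le in \<open>simp flip: distrib_left add: mult_left_mono\<close>)
  also have "\<dots> = skorokhod_dist x y + skorokhod_dist y z"
    unfolding skorokhod_dist_def by (intro suminf_add[symmetric] summable_skorokhod_dist)
  finally show "skorokhod_dist x z \<le> skorokhod_dist x y + skorokhod_dist y z" .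
qed

section \<open>Weak convergence and Brownian motion\<close>

definition borel_of :: "'p topology \<Rightarrow> 'p measure" where
  "borel_of T = sigma (topspace T) {A. openin T A}"

text \<open>Weak convergence of the laws of the random elements \<open>Y n\<close> to the law of \<open>W\<close>.
  Measurability is part of the notion: without it the expectations are not meaningful.\<close>

definition converges_weakly ::
  "'p topology \<Rightarrow> 'a measure \<Rightarrow> (nat \<Rightarrow> 'a \<Rightarrow> 'p) \<Rightarrow> 'b measure \<Rightarrow> ('b \<Rightarrow> 'p) \<Rightarrow> bool" where
  "converges_weakly T M Y N W \<longleftrightarrow>
     (\<forall>n. Y n \<in> measurable M (borel_of T)) \<and> W \<in> measurable N (borel_of T) \<and>
     (\<forall>f. continuous_map T euclideanreal f \<and> bounded (f ` topspace T) \<longrightarrow>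
       (\<lambda>n. \<integral>\<omega>. f (Y n \<omega>) \<partial>M) \<longlonglongrightarrow> (\<integral>\<omega>. f (W \<omega>) \<partial>N))"

definition standard_brownian_motion :: "'b measure \<Rightarrow> (real \<Rightarrow> 'b \<Rightarrow> real) \<Rightarrow> bool" where
  "standard_brownian_motion N W \<longleftrightarrow>
     prob_space N \<and>
     (\<forall>t\<ge>0. W t \<in> borel_measurable N) \<and>
     (\<forall>\<omega>\<in>space N. W 0 \<omega> = 0 \<and> continuous_on {0..} (\<lambda>t. W t \<omega>)) \<and>
     (\<forall>(m::nat) t. 0 \<le> t 0 \<and> mono_on {..m} t \<longrightarrow>
       prob_space.indep_vars N (\<lambda>_. borel) (\<lambda>i \<omega>. W (t (Suc i)) \<omega> - W (t i) \<omega>) {..<m}) \<and>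
     (\<forall>s t. 0 \<le> s \<and> s < t \<longrightarrow>
       distributed N lborel (\<lambda>\<omega>. W t \<omega> - W s \<omega>) (normal_density 0 (sqrt (t - s))))"

section \<open>The symmetric circulant matrix\<close>

text \<open>The link function takes integer values, so the floor in the matrix below is exact.  Matrix
  indices start at \<open>0\<close> here, which does not matter because only \<open>\<bar>i - j\<bar>\<close> enters.\<close>

definition link :: "nat \<Rightarrow> nat \<Rightarrow> nat \<Rightarrow> real" where
  "link n i j = real n / 2 - \<bar>real n / 2 - \<bar>real i - real j\<bar>\<bar>"

definition sym_circulant :: "nat \<Rightarrow> (nat \<Rightarrow> real) \<Rightarrow> real mat" where
  "sym_circulant n s = Matrix.mat n n (\<lambda>(i, j). s (nat \<lfloor>link n i j\<rfloor>))"

definition fourier_eigenvalue :: "nat \<Rightarrow> (nat \<Rightarrow> real) \<Rightarrow> nat \<Rightarrow> real" where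
  "fourier_eigenvalue n s r =
     (1 / real n) * (\<Sum>j<n. s (min j (n - j)) * cos (2 * pi * real r * real j / real n))"

lemma link_eq_min:
  assumes "i < n" "j < n" "i \<le> j"
  shows "nat \<lfloor>link n i j\<rfloor> = min (j - i) (n - (j - i))"
proof -
  have "link n i j = real (min (j - i) (n - (j - i)))"
    using assms by (auto simp: link_def min_def of_nat_diff abs_if field_simps)
  then show ?thesis by simp
qed

lemma link_commute: "link n i j = link n j i"
  by (simp add: link_def abs_minus_commute)

lemma fourier_eigenvalue_0_n: "fourier_eigenvalue n s n = fourier_eigenvalue n s 0"
proof -
  have "cos (2 * pi * real n * real j / real n) = 1" if "j < n" for j
    using that cos_int_2pin[of "int j"] by (simp add: field_simps)
  then show ?thesis by (simp add: fourier_eigenvalue_def)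
qed

text \<open>The numbers in the Fourier labelling are the eigenvalues of the scaled symmetric circulant
  matrix, with multiplicities.\<close>

lemma char_poly_sym_circulant:
  assumes n: "n \<ge> 1"
  shows "char_poly ((1 / real n) \<cdot>\<^sub>m sym_circulant n s) = (\<Prod>r = 1..n. [:- fourier_eigenvalue n s r, 1:])"
proof -
  define c where "c d = s (min d (n - d))" for d
  define W where "W m = exp (2 * of_real pi * \<i> * of_nat m / of_nat n)" for m
  define ev where "ev r = complex_of_real (fourier_eigenvalue n s r)" for r
  define A where "A = map_mat complex_of_real ((1 / real n) \<cdot>\<^sub>m sym_circulant n s)"
  define D where "D = Matrix.mat n n (\<lambda>(j, r). if j = r then ev r else 0)"
  define P where "P = Matrix.mat n n (\<lambda>(j, r). W (j * r))"
  define Q where "Q = Matrix.mat n n (\<lambda>(r, k). cnj (W (k * r)) / of_nat n)"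
  have n0: "(of_nat n :: complex) \<noteq> 0" using n by simp
  have W_cis: "W m = cis (2 * pi * real m / real n)" for m
    by (simp add: W_def cis_conv_exp mult_ac)
  have W_add: "W (a + b) = W a * W b" for a b
    by (simp add: W_cis cis_mult add_divide_distrib distrib_left)
  have W_pow: "W (a * b) = W a ^ b" for a b
    unfolding W_cis Complex.DeMoivre by (rule arg_cong[of _ _ cis]) (simp add: mult_ac)
  have W_n: "W n = 1" using n by (simp add: W_cis)
  have W_mod: "W ((a mod n) * r) = W (a * r)" for a r
  proof -
    have "W a = W (a mod n + n * (a div n))" by simp
    also have "\<dots> = W (a mod n)" unfolding W_add W_pow[of n] W_n by simp
    finally show ?thesis by (simp add: W_pow)
  qed
  have W_unit: "W a * cnj (W a) = 1" for a
    by (simp add: W_cis cis_cnj cis_mult)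
  have c_sym: "c (n - d) = c d" if "d \<le> n" for d
    using that by (simp add: c_def min.commute)
  have entry: "sym_circulant n s $$ (j, (j + d) mod n) = c d" if j: "j < n" and d: "d < n" for j d
  proof -
    define k where "k = (j + d) mod n"
    have k: "k < n" using n by (simp add: k_def)
    have "s (nat \<lfloor>link n j k\<rfloor>) = c d"
    proof (cases "j + d < n")
      case True
      then have "k = j + d" by (simp add: k_def)
      then show ?thesis using link_eq_min[OF j k] by (simp add: c_def)
    next
      case False
      then have "(j + d) mod n = j + d - n" using j d by (simp add: le_mod_geq)
      then have "k \<le> j" "j - k = n - d" using j d False by (auto simp: k_def)
      then show ?thesis using link_eq_min[OF k j] c_sym[of d] d
        by (simp add: link_commute[of n j] c_def)
    qed
    then show ?thesis using j k by (simp add: sym_circulant_def k_def)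
  qed
  have bij: "bij_betw (\<lambda>d. (j + d) mod n) {..<n} {..<n}" for j
  proof -
    have inj: "inj_on (\<lambda>d. (j + d) mod n) {..<n}"
    proof (rule inj_onI)
      fix a b assume ab: "a \<in> {..<n}" "b \<in> {..<n}" "(j + a) mod n = (j + b) mod n"
      then have "(int j + int a) mod int n = (int j + int b) mod int n"
        by (metis of_nat_add of_nat_mod)
      then have "int n dvd int a - int b" by (simp add: mod_eq_dvd_iff)
      moreover have "\<bar>int a - int b\<bar> < int n" using ab by auto
      ultimately show "a = b" using dvd_imp_le_int[of "int a - int b" "int n"] by fastforce
    qed
    moreover have "(\<lambda>d. (j + d) mod n) ` {..<n} \<subseteq> {..<n}" using n by auto
    ultimately show ?thesis by (simp add: bij_betw_def endo_inj_surj)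
  qed
  have fourier: "(\<Sum>d<n. complex_of_real (c d) * W (d * r)) = of_nat n * ev r" for r
  proof -
    have "(\<Sum>d<n. c d * sin (2 * pi * real (d * r) / real n))
        = (\<Sum>d\<in>{1..<n}. c d * sin (2 * pi * real (d * r) / real n))"
      by (rule sum.mono_neutral_right) (auto simp: not_le)
    also have "\<dots> = (\<Sum>d\<in>{1..<n}. c (n - d) * sin (2 * pi * real ((n - d) * r) / real n))"
      by (rule sum.reindex_bij_witness[of _ "\<lambda>d. n - d" "\<lambda>d. n - d"]) auto
    also have "\<dots> = (\<Sum>d\<in>{1..<n}. - (c d * sin (2 * pi * real (d * r) / real n)))"
    proof (rule sum.cong[OF refl])
      fix d assume d: "d \<in> {1..<n}"
      have "2 * pi * real ((n - d) * r) / real n = 2 * pi * real r - 2 * pi * real (d * r) / real n"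
        using d by (simp add: of_nat_diff field_simps)
      then have "sin (2 * pi * real ((n - d) * r) / real n) = - sin (2 * pi * real (d * r) / real n)"
        using sin_int_2pin[of "int r"] cos_int_2pin[of "int r"] by (simp add: sin_diff)
      then show "c (n - d) * sin (2 * pi * real ((n - d) * r) / real n)
          = - (c d * sin (2 * pi * real (d * r) / real n))"
        using c_sym[of d] d by simp
    qed
    also have "\<dots> = - (\<Sum>d<n. c d * sin (2 * pi * real (d * r) / real n))"
      unfolding sum_negf by (rule arg_cong[where f = uminus], rule sum.mono_neutral_left) (auto simp: not_le)
    finally have "(\<Sum>d<n. c d * sin (2 * pi * real (d * r) / real n)) = 0" by simp
    moreover have "(\<Sum>d<n. c d * cos (2 * pi * real (d * r) / real n)) = real n * fourier_eigenvalue n s r"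
      using n by (simp add: fourier_eigenvalue_def c_def mult_ac)
    ultimately show ?thesis
      by (simp add: complex_eq_iff ev_def W_cis)
  qed
  have carr: "A \<in> carrier_mat n n" "D \<in> carrier_mat n n" "P \<in> carrier_mat n n" "Q \<in> carrier_mat n n"
    by (auto simp: A_def D_def P_def Q_def sym_circulant_def)
  have AP: "A * P = P * D"
  proof (rule eq_matI)
    show "dim_row (A * P) = dim_row (P * D)" "dim_col (A * P) = dim_col (P * D)" using carr by auto
    fix j r assume "j < dim_row (P * D)" "r < dim_col (P * D)"
    then have j: "j < n" and r: "r < n" using carr by auto
    have "(A * P) $$ (j, r) = (\<Sum>k<n. A $$ (j, k) * P $$ (k, r))"
      using carr j r by (simp add: scalar_prod_def atLeast0LessThan)
    also have "\<dots> = (\<Sum>k<n. of_real (sym_circulant n s $$ (j, k)) / of_nat n * W (k * r))"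
      using j r by (intro sum.cong) (auto simp: A_def P_def sym_circulant_def)
    also have "\<dots> = (\<Sum>d<n. of_real (sym_circulant n s $$ (j, (j + d) mod n)) / of_nat n * W ((j + d) mod n * r))"
      by (rule sum.reindex_bij_betw[OF bij, symmetric])
    also have "\<dots> = (\<Sum>d<n. W (j * r) / of_nat n * (complex_of_real (c d) * W (d * r)))"
      using j by (intro sum.cong) (auto simp: entry W_mod distrib_right W_add)
    also have "\<dots> = W (j * r) * ev r"
      unfolding sum_distrib_left[symmetric] fourier using n0 by simp
    also have "\<dots> = (\<Sum>k<n. P $$ (j, k) * D $$ (k, r))"
    proof -
      have "(\<Sum>k<n. P $$ (j, k) * D $$ (k, r)) = (\<Sum>k<n. if k = r then W (j * r) * ev r else 0)"
        using j r by (intro sum.cong) (auto simp: P_def D_def)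
      then show ?thesis using r by simp
    qed
    also have "\<dots> = (P * D) $$ (j, r)"
      using carr j r by (simp add: scalar_prod_def atLeast0LessThan)
    finally show "(A * P) $$ (j, r) = (P * D) $$ (j, r)" .
  qed
  have PQ: "P * Q = 1\<^sub>m n"
  proof (rule eq_matI)
    show "dim_row (P * Q) = dim_row (1\<^sub>m n)" "dim_col (P * Q) = dim_col (1\<^sub>m n)" using carr by auto
    fix j k assume "j < dim_row (1\<^sub>m n :: complex mat)" "k < dim_col (1\<^sub>m n :: complex mat)"
    then have j: "j < n" and k: "k < n" by auto
    define z where "z = W j * cnj (W k)"
    have "(P * Q) $$ (j, k) = (\<Sum>r<n. P $$ (j, r) * Q $$ (r, k))"
      using carr j k by (simp add: scalar_prod_def atLeast0LessThan)
    also have "\<dots> = (\<Sum>r<n. z ^ r) / of_nat n"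
      using j k by (simp add: P_def Q_def sum_divide_distrib z_def W_pow power_mult_distrib)
    also have "\<dots> = (if j = k then 1 else 0)"
    proof (cases "j = k")
      case True
      then have "z = 1" by (simp add: z_def W_unit)
      then show ?thesis using True n0 by simp
    next
      case False
      have "z \<noteq> 1"
      proof
        assume "z = 1"
        then have "W j = W k" using W_unit[of k] unfolding z_def
          by (metis mult.assoc mult.commute mult_1)
        then have "j mod n = k mod n"
          using complex_root_unity_eq[of n j k] n by (simp add: W_def)
        then show False using False j k by simp
      qed
      moreover have "z ^ n = 1"
        unfolding z_def power_mult_distrib
        by (simp flip: complex_cnj_power W_pow) (metis W_n W_pow complex_cnj_one mult.commute mult_1 power_one)
      ultimately show ?thesis using False by (simp add: geometric_sum)
    qed
    finally show "(P * Q) $$ (j, k) = 1\<^sub>m n $$ (j, k)" using j k by simp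
  qed
  have QP: "Q * P = 1\<^sub>m n" by (rule mat_mult_left_right_inverse[OF carr(3,4) PQ])
  have "A = A * (P * Q)" using carr by (simp add: PQ)
  also have "\<dots> = P * D * Q" using carr AP by (metis assoc_mult_mat)
  finally have "similar_mat A D" using carr PQ QP by (intro similar_matI[of A D P Q n]) auto
  then have "char_poly A = char_poly D" by (rule char_poly_similar)
  also have "\<dots> = (\<Prod>a\<leftarrow>diag_mat D. [:- a, 1:])"
    by (rule char_poly_upper_triangular[OF carr(2)]) (auto simp: D_def)
  also have "\<dots> = (\<Prod>r<n. [:- ev r, 1:])"
  proof -
    have "diag_mat D = map ev [0..<n]" by (auto simp: diag_mat_def D_def)
    then show ?thesis by (simp add: prod.list_conv_set_nth atLeast0LessThan)
  qed
  also have "\<dots> = (\<Prod>r = 1..n. [:- ev r, 1:])"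
  proof -
    have "(\<Prod>r<n. [:- ev r, 1:]) = [:- ev 0, 1:] * (\<Prod>r\<in>{1..<n}. [:- ev r, 1:])"
      using n by (simp add: lessThan_atLeast0 prod.atLeast_Suc_lessThan)
    moreover have "(\<Prod>r = 1..n. [:- ev r, 1:]) = [:- ev n, 1:] * (\<Prod>r\<in>{1..<n}. [:- ev r, 1:])"
      using n by (simp add: prod.last_plus)
    ultimately show ?thesis by (simp add: ev_def fourier_eigenvalue_0_n)
  qed
  finally have D_poly: "char_poly A = (\<Prod>r = 1..n. [:- ev r, 1:])" .
  interpret ph: map_poly_comm_ring_hom complex_of_real ..
  have "map_poly complex_of_real (char_poly ((1 / real n) \<cdot>\<^sub>m sym_circulant n s))
      = map_poly complex_of_real (\<Prod>r = 1..n. [:- fourier_eigenvalue n s r, 1:])"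
    using D_poly unfolding A_def ev_def
    by (subst of_real_hom.char_poly_hom[symmetric, of _ n])
      (auto simp: sym_circulant_def ph.hom_prod)
  then show ?thesis
    by (metis (no_types, lifting) injD inj_onI of_real_eq_iff poly_eqI coeff_map_poly of_real_0)
qed

text \<open>\<open>S\<^sub>i\<^sup>(\<^sup>n\<^sup>)(t)\<close>, as a function of the sample point\<close>

definition partial_sum :: "(nat \<Rightarrow> nat \<Rightarrow> 'a \<Rightarrow> real) \<Rightarrow> nat \<Rightarrow> nat \<Rightarrow> real \<Rightarrow> 'a \<Rightarrow> real" where
  "partial_sum X n i t \<omega> = (\<Sum>k = 1..nat \<lfloor>real n * t\<rfloor>. X i k \<omega>)"

end

(* With the Fourier labelling, lambda_{r,n}(t) is the value after [nt] steps of a random walk whose steps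
   are independent, being linear combinations of the disjoint families {X_{i,k} : i >= 0} for fixed k.
   The squared coefficients of such a combination sum to 1/n + O(1/n^2) unless r = n or r = n/2, by the
   vanishing of the sum of cos(4 pi r j/n) over j, and the fourth moments of the steps are O(1/n^2).  By
   Donsker's theorem for triangular arrays lambda_{r_n,n} converges weakly to W for every choice of
   frequencies r_n that avoids the two exceptional ones; choosing the worst r_n makes this uniform in r.
   Since U_n is independent of the eigenvalues, E f(Y_n) is the average of E f(lambda_{r,n}) over r, and
   the exceptional frequencies have total weight at most 2/n.

   Weak convergence is tested on bounded functions that are Lipschitz for the Skorokhod metric.  For these
   Donsker's theorem reduces to the convergence of the increments over a grid (characteristic functions,
   and Skorohod's representation in each coordinate) and to a bound for the oscillation between grid
   points (a maximal inequality with fourth moments). *)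

theory Submission
  imports Defs
begin

text \<open>Tightness is replaced by an explicit error bound: a Lipschitz function changes by at
  most its constant times the distance from a path to its sample on the grid of mesh
  \<open>1 / m\<close>, and locally uniform closeness controls that distance. The limit in
  \<open>n\<close> is taken with \<open>m\<close> fixed, and \<open>m\<close> is chosen large
  beforehand. Fourth moments enter because about \<open>T * m\<close> grid cells have to be
  controlled up to time \<open>T\<close>. Second moments bound the probability of an oscillation in
  one cell only by order \<open>1 / m\<close>, which does not sum to something small; fourth moments
  give order \<open>1 / m^2\<close>, hence a total of order \<open>T / m\<close>. At the exceptional
  frequencies every cosine is 1 or -1, and the rescaled variance tends to 2 instead of 1. Those
  walks have a different limit and can only be discarded by their weight. The independence of
  \<open>U n\<close> is given for the eigenvalues at fixed times, while a test function reads a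
  whole path. The paths are constant between multiples of \<open>1 / n\<close>, so they are
  measurable functions of countably many of these values.\<close>

section \<open>Lipschitz envelopes and weak convergence in a metric space\<close>

text \<open>An infimal convolution: for \<open>k \<ge> 0\<close> and \<open>f\<close> bounded below
  it is the greatest \<open>k\<close>-Lipschitz minorant of \<open>f\<close> on \<open>D\<close>. It
  approximates a continuous test function from below by Lipschitz ones, with no uniform continuity
  of \<open>f\<close>.\<close>

definition lipschitz_envelope ::
    "'p set \<Rightarrow> ('p \<Rightarrow> 'p \<Rightarrow> real) \<Rightarrow> ('p \<Rightarrow> real) \<Rightarrow> real \<Rightarrow> 'p \<Rightarrow> real" where
  "lipschitz_envelope D d f k x = (INF y\<in>D. f y + k * d x y)"

context Metric_space
begin

lemma lipschitz_envelope_bdd_below: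
  assumes "\<And>y. y \<in> M \<Longrightarrow> - B \<le> f y" "0 \<le> k"
  shows "bdd_below ((\<lambda>y. f y + k * d x y) ` M)"
  using assms by (intro bdd_belowI2[of _ "- B"]) (metis add_increasing2 mult_nonneg_nonneg nonneg)

lemma lipschitz_envelope_le:
  assumes "\<And>y. y \<in> M \<Longrightarrow> - B \<le> f y" "0 \<le> k" "x \<in> M"
  shows "lipschitz_envelope M d f k x \<le> f x"
  unfolding lipschitz_envelope_def
  using lipschitz_envelope_bdd_below[OF assms(1,2)] assms(3)
  by (intro cINF_lower2[where x=x]) auto

lemma lipschitz_envelope_ge:
  assumes "\<And>y. y \<in> M \<Longrightarrow> c \<le> f y + k * d x y" "x \<in> M"
  shows "c \<le> lipschitz_envelope M d f k x"
  unfolding lipschitz_envelope_def using assms by (intro cINF_greatest) auto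

lemma lipschitz_envelope_bounds:
  assumes "\<And>y. y \<in> M \<Longrightarrow> \<bar>f y\<bar> \<le> B" "0 \<le> k" "x \<in> M"
  shows "\<bar>lipschitz_envelope M d f k x\<bar> \<le> B"
proof -
  have "- B \<le> f y" if "y \<in> M" for y using assms(1)[OF that] by simp
  then have "lipschitz_envelope M d f k x \<le> f x"
    using assms by (intro lipschitz_envelope_le[of B]) auto
  moreover have "- B \<le> lipschitz_envelope M d f k x"
  proof (rule lipschitz_envelope_ge[OF _ assms(3)])
    fix y assume "y \<in> M"
    then have "- B \<le> f y" "0 \<le> k * d x y" using assms(1)[of y] assms(2) by auto
    then show "- B \<le> f y + k * d x y" by simp
  qed
  ultimately show ?thesis using assms(1)[OF assms(3)] by simp
qed

lemma lipschitz_envelope_lipschitz: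
  assumes "\<And>y. y \<in> M \<Longrightarrow> - B \<le> f y" "0 \<le> k" "x \<in> M" "x' \<in> M"
  shows "\<bar>lipschitz_envelope M d f k x - lipschitz_envelope M d f k x'\<bar> \<le> k * d x x'"
proof -
  have "lipschitz_envelope M d f k x - k * d x x' \<le> lipschitz_envelope M d f k x'"
    if "x \<in> M" "x' \<in> M" for x x'
  proof (rule lipschitz_envelope_ge[OF _ that(2)])
    fix y assume y: "y \<in> M"
    have "lipschitz_envelope M d f k x \<le> f y + k * d x y"
      unfolding lipschitz_envelope_def
      by (rule cINF_lower[OF lipschitz_envelope_bdd_below[OF assms(1,2)] y])
    also have "k * d x y \<le> k * (d x x' + d x' y)"
      using assms(2) y that by (intro mult_left_mono triangle)
    finally show "lipschitz_envelope M d f k x - k * d x x' \<le> f y + k * d x' y"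
      by (simp add: distrib_left)
  qed
  from this[OF assms(3,4)] this[OF assms(4,3)] show ?thesis
    by (simp add: abs_le_iff commute)
qed

text \<open>Close to \<open>x\<close>, lower semicontinuity keeps \<open>f y\<close> above
  \<open>f x - e\<close>. At distance at least \<open>r\<close>, the penalty \<open>k * r\<close>
  exceeds \<open>f x + B\<close> for large \<open>k\<close>, which outweighs any drop of
  \<open>f\<close> down to \<open>- B\<close>.\<close>

lemma lipschitz_envelope_tendsto:
  assumes f: "\<And>y. y \<in> M \<Longrightarrow> - B \<le> f y" and x: "x \<in> M"
    and lsc: "\<And>e. e > 0 \<Longrightarrow> \<exists>r>0. \<forall>y\<in>M. d x y < r \<longrightarrow> f x - e \<le> f y"
  shows "(\<lambda>k. lipschitz_envelope M d f (real k) x) \<longlonglongrightarrow> f x"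
proof (rule order_tendstoI)
  fix a assume "f x < a"
  then show "\<forall>\<^sub>F k in sequentially. lipschitz_envelope M d f (real k) x < a"
    using lipschitz_envelope_le[OF f _ x] by (intro always_eventually) (meson le_less_trans of_nat_0_le_iff)
next
  fix a assume a: "a < f x"
  define e where "e = (f x - a) / 2"
  have e: "e > 0" using a by (simp add: e_def)
  obtain r where r: "r > 0" "\<And>y. y \<in> M \<Longrightarrow> d x y < r \<Longrightarrow> f x - e \<le> f y" using lsc[OF e] by blast
  obtain K :: nat where K: "(f x + B) / r \<le> real K" using real_arch_simple by blast
  show "\<forall>\<^sub>F k in sequentially. a < lipschitz_envelope M d f (real k) x"
    unfolding eventually_sequentially
  proof (intro exI[of _ K] allI impI)
    fix k assume "K \<le> k"
    have "f x - e \<le> lipschitz_envelope M d f (real k) x"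
    proof (rule lipschitz_envelope_ge[OF _ x])
      fix y assume y: "y \<in> M"
      show "f x - e \<le> f y + real k * d x y"
      proof (cases "d x y < r")
        case True
        then show ?thesis using r(2)[OF y True] by (simp add: add_increasing2)
      next
        case False
        have "f x + B \<le> real k * r"
          using order_trans[OF K, of "real k"] \<open>K \<le> k\<close> r(1) by (simp add: divide_le_eq)
        also have "\<dots> \<le> real k * d x y" using False by (intro mult_left_mono) auto
        finally show ?thesis using f[OF y] e by linarith
      qed
    qed
    then show "a < lipschitz_envelope M d f (real k) x" using a by (simp add: e_def field_simps)
  qed
qed

lemma lipschitz_imp_continuous_map:
  assumes "\<And>x x'. x \<in> M \<Longrightarrow> x' \<in> M \<Longrightarrow> \<bar>g x - g x'\<bar> \<le> k * d x x'"
  shows "continuous_map mtopology euclideanreal g"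
proof -
  have "\<exists>\<delta>>0. \<forall>x. x \<in> M \<and> d a x < \<delta> \<longrightarrow> dist (g a) (g x) < e" if "a \<in> M" "e > 0" for a e
  \<comment> \<open>The constant \<open>k\<close> may be zero or negative;
    \<open>\<bar>k\<bar> + 1\<close> is a positive Lipschitz constant in every case.\<close>
  proof (intro exI[of _ "e / (\<bar>k\<bar> + 1)"] conjI allI impI)
    show "0 < e / (\<bar>k\<bar> + 1)" using that by simp
    fix x assume x: "x \<in> M \<and> d a x < e / (\<bar>k\<bar> + 1)"
    have "dist (g a) (g x) \<le> k * d a x" using assms x that by (simp add: dist_real_def)
    also have "\<dots> \<le> (\<bar>k\<bar> + 1) * d a x" by (intro mult_right_mono) auto
    also have "\<dots> < e" using x by (simp add: field_simps)
    finally show "dist (g a) (g x) < e" .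
  qed
  then show ?thesis
    using metric_continuous_map[OF Met_TC.Metric_space_axioms, of g] by simp
qed

end

section \<open>Borel sets of a topology and measurability of limits\<close>

lemma space_borel_of [simp]: "space (borel_of T) = topspace T"
  by (simp add: borel_of_def space_measure_of_conv)

lemma sets_borel_of: "sets (borel_of T) = sigma_sets (topspace T) {A. openin T A}"
  unfolding borel_of_def by (rule sets_measure_of) (auto dest: openin_subset)

lemma measurable_borel_ofI:
  assumes "\<And>x. x \<in> space P \<Longrightarrow> f x \<in> topspace T"
    and "\<And>U. openin T U \<Longrightarrow> f -` U \<inter> space P \<in> sets P"
  shows "f \<in> measurable P (borel_of T)"
  unfolding borel_of_def using assms by (intro measurable_measure_of) (auto dest: openin_subset)

lemma continuous_map_measurable_borel_of:
  assumes "continuous_map T euclideanreal f"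
  shows "f \<in> borel_measurable (borel_of T)"
proof (rule borel_measurableI)
  fix S :: "real set" assume "open S"
  then have "openin T {x \<in> topspace T. f x \<in> S}"
    using assms by (simp add: continuous_map_def)
  moreover have "f -` S \<inter> space (borel_of T) = {x \<in> topspace T. f x \<in> S}"
    by auto
  ultimately show "f -` S \<inter> space (borel_of T) \<in> sets (borel_of T)"
    by (simp add: sets_borel_of)
qed

text \<open>The Lipschitz envelope of the indicator of an open set is positive exactly on that set.\<close>

lemma (in Metric_space) measurable_borel_of_limit:
  assumes Z: "\<And>n. Z n \<in> measurable P (borel_of mtopology)" and Y: "\<And>\<omega>. \<omega> \<in> space P \<Longrightarrow> Y \<omega> \<in> M"
    and lim: "\<And>\<omega>. \<omega> \<in> space P \<Longrightarrow> (\<lambda>n. d (Z n \<omega>) (Y \<omega>)) \<longlonglongrightarrow> 0"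
  shows "Y \<in> measurable P (borel_of mtopology)"
proof (rule measurable_borel_ofI)
  show "Y \<omega> \<in> topspace mtopology" if "\<omega> \<in> space P" for \<omega> using Y[OF that] by simp
  fix U assume U: "openin mtopology U"
  define h where "h = lipschitz_envelope M d (indicator U) 1"
  have ge0: "- 0 \<le> (indicator U y :: real)" if "y \<in> M" for y by (auto simp: indicator_def)
  have lip: "\<bar>h x - h x'\<bar> \<le> 1 * d x x'" if "x \<in> M" "x' \<in> M" for x x'
    unfolding h_def using that by (intro lipschitz_envelope_lipschitz[of 0]) auto
  have ZM: "Z n \<omega> \<in> M" if "\<omega> \<in> space P" for n \<omega> using measurable_space[OF Z that] by simp
  have "h \<in> borel_measurable (borel_of mtopology)"
    using lipschitz_imp_continuous_map[OF lip] by (rule continuous_map_measurable_borel_of)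
  then have "(\<lambda>\<omega>. h (Z n \<omega>)) \<in> borel_measurable P" for n by (rule measurable_compose[OF Z])
  then have "(\<lambda>\<omega>. h (Y \<omega>)) \<in> borel_measurable P"
  proof (rule borel_measurable_LIMSEQ_real[rotated])
    fix \<omega> assume w: "\<omega> \<in> space P"
    show "(\<lambda>n. h (Z n \<omega>)) \<longlonglongrightarrow> h (Y \<omega>)"
      by (rule metric_tendsto_imp_tendsto[OF lim[OF w]])
        (use lip[OF ZM[OF w] Y[OF w]] in \<open>auto simp: dist_real_def\<close>)
  qed
  moreover have "0 < h x \<longleftrightarrow> x \<in> U" if x: "x \<in> M" for x
  proof
    assume "0 < h x"
    moreover have "h x \<le> indicator U x"
      unfolding h_def by (rule lipschitz_envelope_le[OF ge0 _ x]) auto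
    ultimately show "x \<in> U" by (cases "x \<in> U") auto
  next
    assume "x \<in> U"
    then obtain r where r: "r > 0" "mball x r \<subseteq> U" using U by (auto simp: openin_mtopology)
    \<comment> \<open>The infimum splits at the ball of radius \<open>r\<close>: inside it the
      indicator is 1, outside it the distance is at least \<open>r\<close>.\<close>
    have "min 1 r \<le> h x"
      unfolding h_def
    proof (rule lipschitz_envelope_ge[OF _ x])
      fix y assume "y \<in> M"
      then show "min 1 r \<le> indicator U y + 1 * d x y"
        using r x nonneg[of x y] by (cases "d x y < r") (auto simp: indicator_def min_def subset_iff add_increasing2)
    qed
    then show "0 < h x" using r by auto
  qed
  then have "Y -` U \<inter> space P = {\<omega> \<in> space P. 0 < h (Y \<omega>)}" using Y by auto
  ultimately show "Y -` U \<inter> space P \<in> sets P" by simp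
qed

text \<open>Only a lower bound for the expectations needs work, since the upper one follows by
  passing to \<open>- f\<close>. The Lipschitz envelopes of \<open>f\<close> increase to
  \<open>f\<close>, so by dominated convergence one of them already has expectation above
  \<open>a\<close> under the law of \<open>W\<close>. Its expectations converge by hypothesis, and
  they lie below those of \<open>f\<close>.\<close>

theorem (in Metric_space) converges_weakly_lipschitzI:
  assumes P: "prob_space P" and Q: "prob_space Q"
    and Y: "\<And>n. Y n \<in> measurable P (borel_of mtopology)"
    and W: "W \<in> measurable Q (borel_of mtopology)"
    and lip: "\<And>g B k. (\<And>x. x \<in> M \<Longrightarrow> \<bar>g x\<bar> \<le> B) \<Longrightarrow> 0 \<le> k \<Longrightarrow>
        (\<And>x x'. x \<in> M \<Longrightarrow> x' \<in> M \<Longrightarrow> \<bar>g x - g x'\<bar> \<le> k * d x x') \<Longrightarrow>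
        (\<lambda>n. \<integral>\<omega>. g (Y n \<omega>) \<partial>P) \<longlonglongrightarrow> (\<integral>\<omega>. g (W \<omega>) \<partial>Q)"
  shows "converges_weakly mtopology P Y Q W"
proof -
  interpret P: prob_space P by fact
  interpret Q: prob_space Q by fact
  have YM: "Y n \<omega> \<in> M" if "\<omega> \<in> space P" for n \<omega> using measurable_space[OF Y that] by simp
  have WM: "W \<omega> \<in> M" if "\<omega> \<in> space Q" for \<omega> using measurable_space[OF W that] by simp
  have lower: "\<forall>\<^sub>F n in sequentially. a < (\<integral>\<omega>. f (Y n \<omega>) \<partial>P)"
    if f: "continuous_map mtopology euclideanreal f" and B: "\<And>x. x \<in> M \<Longrightarrow> \<bar>f x\<bar> \<le> B"
      and a: "a < (\<integral>\<omega>. f (W \<omega>) \<partial>Q)" for f a B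
  proof -
    have lb: "- B \<le> f x" if "x \<in> M" for x using B[OF that] by simp
    have [measurable]: "f \<in> borel_measurable (borel_of mtopology)"
      using f by (rule continuous_map_measurable_borel_of)
    let ?g = "\<lambda>k. lipschitz_envelope M d f (real k)"
    have gB: "\<bar>?g k x\<bar> \<le> B" if "x \<in> M" for k x
      using that B by (intro lipschitz_envelope_bounds) auto
    have gl: "\<bar>?g k x - ?g k x'\<bar> \<le> real k * d x x'" if "x \<in> M" "x' \<in> M" for k x x'
      using that lb by (intro lipschitz_envelope_lipschitz) auto
    have gm [measurable]: "?g k \<in> borel_measurable (borel_of mtopology)" for k
      using lipschitz_imp_continuous_map[OF gl] by (rule continuous_map_measurable_borel_of)
    have lim: "(\<lambda>k. ?g k x) \<longlonglongrightarrow> f x" if x: "x \<in> M" for x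
    proof (rule lipschitz_envelope_tendsto[OF lb x])
      fix e :: real assume e: "e > 0"
      have "openin mtopology {y \<in> M. f y \<in> {f x - e<..}}"
        using openin_continuous_map_preimage[OF f, of "{f x - e<..}"] by simp
      moreover have "x \<in> {y \<in> M. f y \<in> {f x - e<..}}" using x e by simp
      ultimately obtain r where "r > 0" "mball x r \<subseteq> {y \<in> M. f y \<in> {f x - e<..}}"
        unfolding openin_mtopology by blast
      then show "\<exists>r>0. \<forall>y\<in>M. d x y < r \<longrightarrow> f x - e \<le> f y"
        using x by (intro exI[of _ r]) (auto simp: subset_iff less_imp_le)
    qed
    have "(\<lambda>k. \<integral>\<omega>. ?g k (W \<omega>) \<partial>Q) \<longlonglongrightarrow> (\<integral>\<omega>. f (W \<omega>) \<partial>Q)"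
    proof (rule integral_dominated_convergence[where w="\<lambda>_. B"])
      note [measurable] = W
      show "(\<lambda>\<omega>. f (W \<omega>)) \<in> borel_measurable Q" "(\<lambda>\<omega>. ?g k (W \<omega>)) \<in> borel_measurable Q" for k
        by measurable
      show "AE \<omega> in Q. (\<lambda>k. ?g k (W \<omega>)) \<longlonglongrightarrow> f (W \<omega>)" using lim[OF WM] by (rule AE_I2)
      show "AE \<omega> in Q. norm (?g k (W \<omega>)) \<le> B" for k using gB[OF WM] by (intro AE_I2) simp
    qed simp
    then have "\<forall>\<^sub>F k in sequentially. a < (\<integral>\<omega>. ?g k (W \<omega>) \<partial>Q)" using a by (rule order_tendstoD)
    then obtain k where k: "a < (\<integral>\<omega>. ?g k (W \<omega>) \<partial>Q)" by (auto simp: eventually_sequentially)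
    have "(\<lambda>n. \<integral>\<omega>. ?g k (Y n \<omega>) \<partial>P) \<longlonglongrightarrow> (\<integral>\<omega>. ?g k (W \<omega>) \<partial>Q)"
      by (rule lip[of "?g k" B "real k"]) (use gB gl in auto)
    then have "\<forall>\<^sub>F n in sequentially. a < (\<integral>\<omega>. ?g k (Y n \<omega>) \<partial>P)" using k by (rule order_tendstoD)
    then show ?thesis
    proof eventually_elim
      case (elim n)
      note [measurable] = Y[of n]
      have "(\<integral>\<omega>. ?g k (Y n \<omega>) \<partial>P) \<le> (\<integral>\<omega>. f (Y n \<omega>) \<partial>P)"
      proof (rule integral_mono)
        show "integrable P (\<lambda>\<omega>. ?g k (Y n \<omega>))" "integrable P (\<lambda>\<omega>. f (Y n \<omega>))"
          using gB[OF YM] B[OF YM] by (auto intro!: P.integrable_const_bound[of _ B])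
        show "?g k (Y n \<omega>) \<le> f (Y n \<omega>)" if "\<omega> \<in> space P" for \<omega>
          using lb YM[OF that] by (intro lipschitz_envelope_le) auto
      qed
      then show ?case using elim by simp
    qed
  qed
  have "(\<lambda>n. \<integral>\<omega>. f (Y n \<omega>) \<partial>P) \<longlonglongrightarrow> (\<integral>\<omega>. f (W \<omega>) \<partial>Q)"
    if f: "continuous_map mtopology euclideanreal f" and b: "bounded (f ` M)" for f
  proof (rule order_tendstoI)
    obtain B where B: "\<And>x. x \<in> M \<Longrightarrow> \<bar>f x\<bar> \<le> B" using b by (auto simp: bounded_iff)
    show "\<forall>\<^sub>F n in sequentially. a < (\<integral>\<omega>. f (Y n \<omega>) \<partial>P)" if "a < (\<integral>\<omega>. f (W \<omega>) \<partial>Q)" for a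
      using lower[OF f B that] .
    show "\<forall>\<^sub>F n in sequentially. (\<integral>\<omega>. f (Y n \<omega>) \<partial>P) < a" if "(\<integral>\<omega>. f (W \<omega>) \<partial>Q) < a" for a
      using lower[of "\<lambda>x. - f x" B "- a"] continuous_map_minus[OF f] B that by simp
  qed
  then show ?thesis using Y W by (simp add: converges_weakly_def)
qed

section \<open>Paths in the Skorokhod space\<close>

interpretation skorokhod: Metric_space cadlag_space skorokhod_dist
  by (rule Metric_space_skorokhod)

text \<open>The identity is the only time change used for upper bounds. This loses nothing in the
  limit, because the limiting paths are continuous.\<close>

lemma skorokhod_dist_on_le_sup:
  assumes "\<And>t. t \<in> {0..T} \<Longrightarrow> \<bar>x t - y t\<bar> \<le> e"
  shows "skorokhod_dist_on T x y \<le> ennreal e"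
proof -
  have "skorokhod_dist_on T x y
      \<le> max (SUP t\<in>{0..T}. ennreal \<bar>t - t\<bar>) (SUP t\<in>{0..T}. ennreal \<bar>x t - y t\<bar>)"
    unfolding skorokhod_dist_on_def by (rule INF_lower) (rule time_changes_id)
  also have "\<dots> \<le> ennreal e"
    using assms by (intro max.boundedI SUP_least) (auto intro: ennreal_leI)
  finally show ?thesis .
qed

text \<open>The summand with index \<open>m\<close> compares the paths on \<open>[0, Suc m]\<close>.
  For \<open>m < T\<close> this interval lies in \<open>[0, T]\<close>, and tapering does not
  increase differences; the remaining weights form a geometric tail of total mass
  \<open>(1/2) ^ T\<close>.\<close>

lemma skorokhod_dist_le:
  assumes e: "0 \<le> e" and close: "\<And>t. t \<in> {0..real T} \<Longrightarrow> \<bar>x t - y t\<bar> \<le> e"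
  shows "skorokhod_dist x y \<le> e + (1/2) ^ T"
proof -
  let ?a = "\<lambda>m. (1/2::real) ^ Suc m *
     enn2real (min 1 (skorokhod_dist_on (real (Suc m)) (taper (Suc m) x) (taper (Suc m) y)))"
  let ?b = "\<lambda>m. (1/2::real) ^ Suc m * e + (if m < T then 0 else (1/2) ^ Suc m)"
  have a: "?a m \<le> ?b m" for m
  proof (cases "m < T")
    case True
    have "skorokhod_dist_on (real (Suc m)) (taper (Suc m) x) (taper (Suc m) y) \<le> ennreal e"
    proof (rule skorokhod_dist_on_le_sup)
      fix t assume t: "t \<in> {0..real (Suc m)}"
      have "\<bar>taper (Suc m) x t - taper (Suc m) y t\<bar> = max 0 (min 1 (real (Suc m) - t)) * \<bar>x t - y t\<bar>"
        unfolding taper_def by (simp flip: right_diff_distrib add: abs_mult)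
      also have "\<dots> \<le> 1 * e"
        using t True by (intro mult_mono close) auto
      finally show "\<bar>taper (Suc m) x t - taper (Suc m) y t\<bar> \<le> e" by simp
    qed
    then have "enn2real (min 1 (skorokhod_dist_on (real (Suc m)) (taper (Suc m) x) (taper (Suc m) y))) \<le> e"
      using e by (intro enn2real_leI) (auto simp: min.coboundedI2)
    then show ?thesis using True by simp
  next
    case False
    have "?a m \<le> (1/2) ^ Suc m * 1" by (intro mult_left_mono enn2real_min_1_le) simp
    then show ?thesis using False e by (simp add: add_increasing)
  qed
  have geo: "(\<lambda>m. (1/2::real) ^ Suc m) sums 1"
    using sums_mult[OF geometric_sums[of "1/2::real"], of "1/2"] by simp
  have "(\<lambda>m. if m < T then 0 else (1/2::real) ^ Suc m) sums (1/2) ^ T"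
  proof -
    have "(\<lambda>m. (1/2) ^ T * (1/2::real) ^ Suc m) sums ((1/2) ^ T * 1)" by (rule sums_mult[OF geo])
    then have "(\<lambda>m. if m + T < T then 0 else (1/2::real) ^ Suc (m + T)) sums (1/2) ^ T"
      by (simp add: power_add mult_ac)
    then show ?thesis
      using sums_iff_shift[of "\<lambda>m. if m < T then 0 else (1/2::real) ^ Suc m" T "(1/2) ^ T"] by simp
  qed
  from sums_add[OF sums_mult2[OF geo, of e] this]
  have b: "?b sums (e + (1/2) ^ T)" by simp
  show ?thesis
    unfolding skorokhod_dist_def
    using suminf_le[OF a summable_skorokhod_dist sums_summable[OF b]] sums_unique[OF b] by simp
qed

section \<open>Step paths, their measurability, and sampling on a grid\<close>

definition step_path :: "nat \<Rightarrow> (nat \<Rightarrow> real) \<Rightarrow> real \<Rightarrow> real" where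
  "step_path m y = (\<lambda>t\<in>{0..}. y (nat \<lfloor>real m * t\<rfloor>))"

lemma step_path_eq: "0 \<le> t \<Longrightarrow> step_path m y t = y (nat \<lfloor>real m * t\<rfloor>)"
  by (simp add: step_path_def)

lemma step_path_cadlag:
  assumes m: "0 < m"
  shows "step_path m y \<in> cadlag_space"
  unfolding cadlag_space_def
proof (intro CollectI conjI allI impI)
  show "step_path m y \<in> extensional {0..}" by (simp add: step_path_def)
next
  fix t :: real assume t: "0 \<le> t"
  have "real m * t < of_int \<lfloor>real m * t\<rfloor> + 1" by linarith
  then have "t < (of_int \<lfloor>real m * t\<rfloor> + 1) / real m" using m by (simp add: less_divide_eq mult.commute)
  then have "eventually (\<lambda>s. t < s \<and> s < (of_int \<lfloor>real m * t\<rfloor> + 1) / real m) (at_right t)"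
    unfolding eventually_at_right_field by blast
  then have "eventually (\<lambda>s. step_path m y s = step_path m y t) (at_right t)"
  proof eventually_elim
    case (elim s)
    have "real m * t \<le> real m * s" using elim by (intro mult_left_mono) auto
    moreover have "real m * s < of_int \<lfloor>real m * t\<rfloor> + 1" using elim m by (simp add: field_simps)
    ultimately have "\<lfloor>real m * s\<rfloor> = \<lfloor>real m * t\<rfloor>" by linarith
    then show ?case using t elim by (simp add: step_path_eq)
  qed
  then show "continuous (at_right t) (step_path m y)"
    unfolding continuous_within by (rule tendsto_eventually)
next
  fix t :: real assume t: "0 < t"
  \<comment> \<open>\<open>j\<close> is the largest integer strictly below \<open>m * t\<close>.
    When \<open>m * t\<close> is an integer, the floor would give the value at \<open>t\<close>
    instead of the left limit.\<close>
  define j where "j = \<lceil>real m * t\<rceil> - 1"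
  have j: "of_int j < real m * t" "real m * t \<le> of_int j + 1" "0 \<le> j"
    using t m unfolding j_def by (auto simp: ceiling_less_iff, linarith+)
  have "of_int j / real m < t" using j m by (simp add: field_simps)
  then have "eventually (\<lambda>s. of_int j / real m < s \<and> s < t) (at_left t)"
    unfolding eventually_at_left_field by blast
  then have "eventually (\<lambda>s. step_path m y s = y (nat j)) (at_left t)"
  proof eventually_elim
    case (elim s)
    have "real m * s < real m * t" using elim m by simp
    moreover have "of_int j < real m * s" using elim m by (simp add: field_simps)
    ultimately have "\<lfloor>real m * s\<rfloor> = j" using j by linarith
    moreover have "0 \<le> s" using elim j(3) m by (smt (verit) divide_nonneg_nonneg of_int_0_le_iff of_nat_0_le_iff)
    ultimately show ?case by (simp add: step_path_eq)
  qed
  then show "\<exists>l. (step_path m y \<longlongrightarrow> l) (at_left t)" using tendsto_eventually by blast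
qed

lemma continuous_path_cadlag:
  assumes "continuous_on {0..} w"
  shows "(\<lambda>t\<in>{0..}. w t) \<in> cadlag_space"
  unfolding cadlag_space_def
proof (intro CollectI conjI allI impI)
  let ?w = "\<lambda>t\<in>{0..}. w t"
  have c: "(?w \<longlongrightarrow> ?w t) (at t within {0..})" if "0 \<le> t" for t
  proof -
    have "continuous_on {0..} ?w" using assms by (rule continuous_on_eq) simp
    then show ?thesis using that unfolding continuous_on_def by blast
  qed
  show "?w \<in> extensional {0..}" by simp
  show "continuous (at_right t) ?w" if "0 \<le> t" for t
    unfolding continuous_within by (rule tendsto_within_subset[OF c[OF that]]) (use that in force)
  show "\<exists>l. (?w \<longlongrightarrow> l) (at_left t)" if t: "0 < t" for t
  proof -
    have "t \<in> interior {0..}" using t by (simp add: interior_real_atLeast)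
    then have "(?w \<longlongrightarrow> ?w t) (at t)" using c[of t] t by (metis at_within_interior less_imp_le)
    then have "(?w \<longlongrightarrow> ?w t) (at_left t)" by (rule tendsto_within_subset) simp
    then show ?thesis by blast
  qed
qed

text \<open>On \<open>[0, T]\<close> the path depends only on the coordinates up to
  \<open>m * T\<close>, and what happens later costs at most \<open>(1/2) ^ T\<close>. So a
  neighbourhood in the product topology, which restricts finitely many coordinates,
  suffices.\<close>

lemma continuous_map_step_path:
  assumes m: "0 < m"
  shows "continuous_map euclidean skorokhod_topology (step_path m)"
  unfolding skorokhod.continuous_map_to_metric
proof (intro ballI allI impI)
  fix y :: "nat \<Rightarrow> real" and e :: real assume e: "0 < e"
  obtain T where T: "(1/2::real) ^ T < e / 2" using real_arch_pow_inv[of "e / 2" "1/2"] e by auto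
  define V where "V = (\<Inter>k\<in>{..m * T}. {z :: nat \<Rightarrow> real. \<bar>z k - y k\<bar> < e / 4})"
  have "open {z :: nat \<Rightarrow> real. \<bar>z k - y k\<bar> < e / 4}" for k
    by (intro open_Collect_less continuous_intros) simp
  then have "open V" unfolding V_def by (intro open_INT) auto
  moreover have "y \<in> V" using e by (simp add: V_def)
  moreover have "step_path m z \<in> skorokhod.mball (step_path m y) e" if z: "z \<in> V" for z
  proof -
    have "skorokhod_dist (step_path m y) (step_path m z) \<le> e / 4 + (1/2) ^ T"
    proof (rule skorokhod_dist_le)
      fix t assume t: "t \<in> {0..real T}"
      have "real m * t \<le> real (m * T)" using t by (simp add: mult_left_mono)
      then have "nat \<lfloor>real m * t\<rfloor> \<le> m * T" by linarith
      then have "\<bar>z (nat \<lfloor>real m * t\<rfloor>) - y (nat \<lfloor>real m * t\<rfloor>)\<bar> < e / 4"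
        using z unfolding V_def by blast
      then show "\<bar>step_path m y t - step_path m z t\<bar> \<le> e / 4" using t by (simp add: step_path_eq abs_minus_commute)
    qed (use e in simp)
    then show ?thesis using T e m by (simp add: step_path_cadlag)
  qed
  ultimately show "\<exists>U. openin euclidean U \<and> y \<in> U \<and>
      (\<forall>z\<in>U. step_path m z \<in> skorokhod.mball (step_path m y) e)"
    by (intro exI[of _ V] conjI ballI) (simp_all only: open_openin)
qed

text \<open>Borel sets of the Skorokhod topology pull back along a continuous map to Borel sets of
  the sequence space, and there measurability can be checked coordinate by coordinate. No
  description of the Skorokhod Borel sets by evaluations enters.\<close>

lemma measurable_step_path:
  assumes "0 < m" "\<And>k. Z k \<in> borel_measurable P"
  shows "(\<lambda>\<omega>. step_path m (\<lambda>k. Z k \<omega>)) \<in> measurable P (borel_of skorokhod_topology)"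
proof (rule measurable_borel_ofI)
  show "step_path m (\<lambda>k. Z k \<omega>) \<in> topspace skorokhod_topology" for \<omega>
    using assms by (simp add: step_path_cadlag)
  fix U assume "openin skorokhod_topology U"
  then have "openin euclidean {y \<in> topspace euclidean. step_path m y \<in> U}"
    by (rule openin_continuous_map_preimage[OF continuous_map_step_path[OF assms(1)]])
  then have "open (step_path m -` U)" by (simp add: vimage_def)
  moreover have "(\<lambda>\<omega> k. Z k \<omega>) \<in> borel_measurable P"
    using assms(2) by (rule measurable_coordinatewise_then_product)
  ultimately have "(\<lambda>\<omega> k. Z k \<omega>) -` (step_path m -` U) \<inter> space P \<in> sets P"
    by (metis borel_open measurable_sets)
  then show "(\<lambda>\<omega>. step_path m (\<lambda>k. Z k \<omega>)) -` U \<inter> space P \<in> sets P"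
    by (simp add: vimage_def)
qed

text \<open>The cap \<open>m * m\<close> freezes the sampled path from time \<open>m\<close> on. A
  functional of it is then a function of finitely many increments, and for \<open>T \<le> m\<close>
  the interval \<open>[0, T]\<close> is unaffected.\<close>

definition sample_path :: "nat \<Rightarrow> (real \<Rightarrow> real) \<Rightarrow> real \<Rightarrow> real" where
  "sample_path m x = step_path m (\<lambda>k. x (real (min k (m * m)) / real m))"

lemma skorokhod_dist_sample_path:
  assumes "0 \<le> e" "T \<le> m"
    and close: "\<And>t. t \<in> {0..real T} \<Longrightarrow> \<bar>x (real (nat \<lfloor>real m * t\<rfloor>) / real m) - x t\<bar> \<le> e"
  shows "skorokhod_dist (sample_path m x) x \<le> e + (1/2) ^ T"
proof (rule skorokhod_dist_le[OF assms(1)])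
  fix t assume t: "t \<in> {0..real T}"
  have "real m * t \<le> real (m * m)" using t assms(2) by (simp add: mult_left_mono)
  then have "nat \<lfloor>real m * t\<rfloor> \<le> m * m" by linarith
  then show "\<bar>sample_path m x t - x t\<bar> \<le> e"
    using close[OF t] t by (simp add: sample_path_def step_path_eq min_absorb1)
qed

text \<open>Uniform continuity on \<open>[0, T]\<close> controls the sampling error there as soon as
  the mesh \<open>1 / m\<close> is below the modulus. Applied to each Brownian path, this yields
  both measurability of the path map and convergence of expectations.\<close>

lemma sample_path_tendsto:
  assumes w: "continuous_on {0..} w"
  shows "(\<lambda>m. skorokhod_dist (sample_path m (\<lambda>t\<in>{0..}. w t)) (\<lambda>t\<in>{0..}. w t)) \<longlonglongrightarrow> 0"
proof (rule tendsto_0_le[where K = 1], rule LIMSEQ_I)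
  fix r :: real assume r: "0 < r"
  obtain T where T: "(1/2::real) ^ T < r / 2" using real_arch_pow_inv[of "r / 2" "1/2"] r by auto
  let ?w = "\<lambda>t\<in>{0..}. w t"
  have "uniformly_continuous_on {0..real T} w"
    by (intro compact_uniformly_continuous continuous_on_subset[OF w]) auto
  then obtain \<delta> where \<delta>: "0 < \<delta>" "\<And>s t. s \<in> {0..real T} \<Longrightarrow> t \<in> {0..real T} \<Longrightarrow> dist s t < \<delta> \<Longrightarrow> dist (w s) (w t) < r / 2"
    unfolding uniformly_continuous_on_def using r by (metis half_gt_zero)
  obtain K :: nat where K: "1 / \<delta> < real K" using reals_Archimedean2 by blast
  show "\<exists>no. \<forall>m\<ge>no. norm (skorokhod_dist (sample_path m ?w) ?w - 0) < r"
  proof (intro exI[of _ "max K (Suc T)"] allI impI)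
    fix m assume m: "max K (Suc T) \<le> m"
    then have m0: "0 < real m" by simp
    have "1 / \<delta> < real m" using K m by linarith
    then have md: "1 / real m < \<delta>" using \<delta>(1) m0 by (simp add: field_simps)
    have "skorokhod_dist (sample_path m ?w) ?w \<le> r / 2 + (1/2) ^ T"
    proof (rule skorokhod_dist_sample_path)
      fix t assume t: "t \<in> {0..real T}"
      let ?s = "real (nat \<lfloor>real m * t\<rfloor>) / real m"
      have "real (nat \<lfloor>real m * t\<rfloor>) = of_int \<lfloor>real m * t\<rfloor>" using t by simp
      then have "real (nat \<lfloor>real m * t\<rfloor>) \<le> real m * t" "real m * t < real (nat \<lfloor>real m * t\<rfloor>) + 1"
        by linarith+
      then have "?s \<le> t" "t < ?s + 1 / real m"
        using m0 by (simp_all add: divide_le_eq less_divide_eq mult.commute flip: add_divide_distrib)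
      moreover have "0 \<le> ?s" by simp
      ultimately have "dist (w ?s) (w t) < r / 2"
        using t md by (intro \<delta>(2)) (auto simp: dist_real_def)
      then show "\<bar>?w ?s - ?w t\<bar> \<le> r / 2" using t by (simp add: dist_real_def)
    qed (use r m in auto)
    then show "norm (skorokhod_dist (sample_path m ?w) ?w - 0) < r"
      using T by (simp add: skorokhod.nonneg)
  qed
qed simp

section \<open>Sums of independent random variables with finite fourth moments\<close>

context prob_space
begin

lemma integrable_power_of_fourth:
  fixes Z :: "'a \<Rightarrow> real"
  assumes [measurable]: "Z \<in> borel_measurable M" and Z: "integrable M (\<lambda>\<omega>. Z \<omega> ^ 4)" and k: "k \<le> 4"
  shows "integrable M (\<lambda>\<omega>. Z \<omega> ^ k)"
proof -
  have "\<bar>x\<bar> ^ k \<le> 1 + x ^ 4" for x :: real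
  proof (cases "\<bar>x\<bar> \<le> 1")
    case True
    then show ?thesis using power_le_one[OF abs_ge_zero True, of k] zero_le_power[OF abs_ge_zero[of x], of 4]
      by (simp add: add_increasing2)
  next
    case False
    then have "\<bar>x\<bar> ^ k \<le> \<bar>x\<bar> ^ 4" using k by (intro power_increasing) auto
    then show ?thesis by simp
  qed
  then have le: "\<bar>Z \<omega> ^ k\<bar> \<le> norm (1 + Z \<omega> ^ 4)" for \<omega>
    by (metis abs_ge_self order_trans power_abs real_norm_def)
  have i: "integrable M (\<lambda>\<omega>. 1 + Z \<omega> ^ 4)" using Z by simp
  show "integrable M (\<lambda>\<omega>. Z \<omega> ^ k)"
    by (rule Bochner_Integration.integrable_bound[OF i]) (use le in auto)
qed

lemma indep_var_power_expectation:
  fixes X S :: "'a \<Rightarrow> real"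
  assumes "indep_var borel X borel S" "integrable M (\<lambda>\<omega>. X \<omega> ^ a)" "integrable M (\<lambda>\<omega>. S \<omega> ^ b)"
  shows "integrable M (\<lambda>\<omega>. X \<omega> ^ a * S \<omega> ^ b)"
    "expectation (\<lambda>\<omega>. X \<omega> ^ a * S \<omega> ^ b) = expectation (\<lambda>\<omega>. X \<omega> ^ a) * expectation (\<lambda>\<omega>. S \<omega> ^ b)"
proof -
  have i: "indep_var borel (\<lambda>\<omega>. X \<omega> ^ a) borel (\<lambda>\<omega>. S \<omega> ^ b)"
    using indep_var_compose[OF assms(1), of "\<lambda>x. x ^ a" borel "\<lambda>x. x ^ b" borel] by (simp add: comp_def)
  show "integrable M (\<lambda>\<omega>. X \<omega> ^ a * S \<omega> ^ b)" by (rule indep_var_integrable[OF i assms(2,3)])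
  show "expectation (\<lambda>\<omega>. X \<omega> ^ a * S \<omega> ^ b) = expectation (\<lambda>\<omega>. X \<omega> ^ a) * expectation (\<lambda>\<omega>. S \<omega> ^ b)"
    by (rule indep_var_lebesgue_integral[OF i assms(2,3)])
qed

text \<open>One summand \<open>X\<close> is split off from the independent rest \<open>S\<close>. In
  the expansion of the fourth power the terms with a first power vanish in expectation, since
  \<open>X\<close> and \<open>S\<close> are centred. What remains is the cross term
  \<open>6 * E X^2 * E S^2\<close>, and \<open>6 a b + 3 b^2 \<le> 3 (a + b)^2\<close> absorbs it;
  this is the origin of the factor 3.\<close>

proposition indep_sum_moments:
  fixes Z :: "'i \<Rightarrow> 'a \<Rightarrow> real"
  assumes "finite I" "indep_vars (\<lambda>_. borel) Z I"
    and "\<And>i. i \<in> I \<Longrightarrow> expectation (Z i) = 0" "\<And>i. i \<in> I \<Longrightarrow> integrable M (\<lambda>\<omega>. Z i \<omega> ^ 4)"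
  shows "integrable M (\<lambda>\<omega>. (\<Sum>i\<in>I. Z i \<omega>) ^ 4)" (is "?int I")
    and "expectation (\<lambda>\<omega>. \<Sum>i\<in>I. Z i \<omega>) = 0" (is "?mean I")
    and "expectation (\<lambda>\<omega>. (\<Sum>i\<in>I. Z i \<omega>)\<^sup>2) = (\<Sum>i\<in>I. expectation (\<lambda>\<omega>. (Z i \<omega>)\<^sup>2))" (is "?var I")
    and "expectation (\<lambda>\<omega>. (\<Sum>i\<in>I. Z i \<omega>) ^ 4)
      \<le> 3 * (\<Sum>i\<in>I. expectation (\<lambda>\<omega>. (Z i \<omega>)\<^sup>2))\<^sup>2 + (\<Sum>i\<in>I. expectation (\<lambda>\<omega>. Z i \<omega> ^ 4))" (is "?fourth I")
proof -
  have "?int I \<and> ?mean I \<and> ?var I \<and> ?fourth I"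
    using assms
  proof (induction I rule: finite_induct)
    case empty
    then show ?case by simp
  next
    case (insert i F)
    define X where "X = Z i"
    define S where "S = (\<lambda>\<omega>. \<Sum>i\<in>F. Z i \<omega>)"
    have indepF: "indep_vars (\<lambda>_. borel) Z F"
      using insert.prems(1) by (rule indep_vars_subset) auto
    have IH: "?int F \<and> ?mean F \<and> ?var F \<and> ?fourth F"
      using insert.prems by (intro insert.IH indepF) auto
    have ind: "indep_var borel X borel S"
      unfolding X_def S_def using insert.hyps insert.prems(1) by (rule indep_vars_sum)
    have [measurable]: "X \<in> borel_measurable M" "S \<in> borel_measurable M"
      using ind by (auto dest: indep_var_rv1 indep_var_rv2)
    have X4: "integrable M (\<lambda>\<omega>. X \<omega> ^ 4)" and S4: "integrable M (\<lambda>\<omega>. S \<omega> ^ 4)"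
      using insert.prems IH by (auto simp: X_def S_def)
    have iX: "integrable M (\<lambda>\<omega>. X \<omega> ^ k)" and iS: "integrable M (\<lambda>\<omega>. S \<omega> ^ k)" if "k \<le> 4" for k
      using that X4 S4 by (auto intro: integrable_power_of_fourth)
    note iXS = indep_var_power_expectation(1)[OF ind iX iS]
    note eXS = indep_var_power_expectation(2)[OF ind iX iS]
    have EX: "expectation (\<lambda>\<omega>. X \<omega> ^ 1) = 0" and ES: "expectation (\<lambda>\<omega>. S \<omega> ^ 1) = 0"
      using insert.prems IH by (auto simp: X_def S_def)
    have sum: "(\<Sum>i\<in>insert i F. Z i \<omega>) = X \<omega> + S \<omega>" for \<omega>
      using insert.hyps by (simp add: X_def S_def)
    \<comment> \<open>Every cross term is written as a product of two powers, including
      \<open>^ 1\<close>, so that \<open>iXS\<close> and \<open>eXS\<close> apply to all of them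
      uniformly.\<close>
    have four: "(X \<omega> + S \<omega>) ^ 4 = X \<omega> ^ 4 + (4 * (X \<omega> ^ 3 * S \<omega> ^ 1) + (6 * (X \<omega> ^ 2 * S \<omega> ^ 2)
        + (4 * (X \<omega> ^ 1 * S \<omega> ^ 3) + S \<omega> ^ 4)))" for \<omega>
      by (simp add: power4_eq_xxxx power3_eq_cube power2_eq_square algebra_simps)
    have two: "(X \<omega> + S \<omega>)\<^sup>2 = X \<omega> ^ 2 + (2 * (X \<omega> ^ 1 * S \<omega> ^ 1) + S \<omega> ^ 2)" for \<omega>
      by (simp add: power2_eq_square algebra_simps)
    have int: "?int (insert i F)"
      unfolding sum four
      by (intro Bochner_Integration.integrable_add integrable_mult_right iXS X4 S4) auto
    have mean: "?mean (insert i F)"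
      unfolding sum using EX ES iX[of 1] iS[of 1] by simp
    have var: "?var (insert i F)"
    proof -
      have "expectation (\<lambda>\<omega>. (X \<omega> + S \<omega>)\<^sup>2)
          = expectation (\<lambda>\<omega>. X \<omega> ^ 2) + (2 * expectation (\<lambda>\<omega>. X \<omega> ^ 1 * S \<omega> ^ 1) + expectation (\<lambda>\<omega>. S \<omega> ^ 2))"
        unfolding two
        by (subst Bochner_Integration.integral_add;
            (intro Bochner_Integration.integrable_add integrable_mult_right iXS iX iS; simp)?)+
          (simp add: Bochner_Integration.integral_add)
      then show ?thesis
        unfolding sum using eXS[of 1 1] EX IH insert.hyps by (simp add: X_def S_def)
    qed
    have "expectation (\<lambda>\<omega>. (X \<omega> + S \<omega>) ^ 4)
        = expectation (\<lambda>\<omega>. X \<omega> ^ 4) + (4 * expectation (\<lambda>\<omega>. X \<omega> ^ 3 * S \<omega> ^ 1)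
          + (6 * expectation (\<lambda>\<omega>. X \<omega> ^ 2 * S \<omega> ^ 2)
          + (4 * expectation (\<lambda>\<omega>. X \<omega> ^ 1 * S \<omega> ^ 3) + expectation (\<lambda>\<omega>. S \<omega> ^ 4))))"
      unfolding four
      using iXS[of 3 1] iXS[of 2 2] iXS[of 1 3] X4 S4 by simp
    also have "\<dots> = expectation (\<lambda>\<omega>. X \<omega> ^ 4)
        + 6 * (expectation (\<lambda>\<omega>. X \<omega> ^ 2) * expectation (\<lambda>\<omega>. S \<omega> ^ 2)) + expectation (\<lambda>\<omega>. S \<omega> ^ 4)"
      using eXS[of 3 1] eXS[of 2 2] eXS[of 1 3] EX ES by simp
    also have "\<dots> \<le> 3 * (expectation (\<lambda>\<omega>. X \<omega> ^ 2) + expectation (\<lambda>\<omega>. S \<omega> ^ 2))\<^sup>2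
        + (expectation (\<lambda>\<omega>. X \<omega> ^ 4) + (\<Sum>i\<in>F. expectation (\<lambda>\<omega>. Z i \<omega> ^ 4)))"
    proof -
      have "expectation (\<lambda>\<omega>. S \<omega> ^ 4) \<le> 3 * (expectation (\<lambda>\<omega>. S \<omega> ^ 2))\<^sup>2 + (\<Sum>i\<in>F. expectation (\<lambda>\<omega>. Z i \<omega> ^ 4))"
        using IH by (simp add: S_def)
      moreover have "6 * (a * b) + 3 * b\<^sup>2 \<le> 3 * (a + b)\<^sup>2" for a b :: real
        by (simp add: power2_eq_square algebra_simps)
      note this[of "expectation (\<lambda>\<omega>. X \<omega> ^ 2)" "expectation (\<lambda>\<omega>. S \<omega> ^ 2)"]
      ultimately show ?thesis by linarith
    qed
    finally have "?fourth (insert i F)"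
      unfolding sum using IH insert.hyps by (simp add: X_def S_def)
    with int mean var show ?case by blast
  qed
  then show "?int I" "?mean I" "?var I" "?fourth I" by auto
qed

text \<open>On the event \<open>A j\<close> that the partial sums first leave \<open>(-c, c)\<close> at the time \<open>j\<close>, convexity
  gives \<open>S\<^sub>N\<^sup>4 \<ge> S\<^sub>j\<^sup>4 + 4 S\<^sub>j\<^sup>3 (S\<^sub>N - S\<^sub>j)\<close>, and the last term has expectation zero by
  independence.\<close>

proposition fourth_moment_maximal_inequality:
  fixes Z :: "nat \<Rightarrow> 'a \<Rightarrow> real"
  assumes indep: "indep_vars (\<lambda>_. borel) Z {..<N}"
    and mean: "\<And>i. i < N \<Longrightarrow> expectation (Z i) = 0"
    and int4: "\<And>i. i < N \<Longrightarrow> integrable M (\<lambda>\<omega>. Z i \<omega> ^ 4)"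
    and c: "0 < c"
  shows "c ^ 4 * prob {\<omega> \<in> space M. \<exists>j\<le>N. c \<le> \<bar>\<Sum>i<j. Z i \<omega>\<bar>} \<le> expectation (\<lambda>\<omega>. (\<Sum>i<N. Z i \<omega>) ^ 4)"
proof -
  define S where "S j \<omega> = (\<Sum>i<j. Z i \<omega>)" for j \<omega>
  define A where "A j = {\<omega> \<in> space M. (\<forall>i<j. \<not> c \<le> \<bar>S i \<omega>\<bar>) \<and> c \<le> \<bar>S j \<omega>\<bar>}" for j
  have rv [measurable]: "Z i \<in> borel_measurable M" if "i < N" for i
    using indep that by (auto simp: indep_vars_def)
  have Sm [measurable]: "S j \<in> borel_measurable M" if "j \<le> N" for j
    unfolding S_def using that by (intro borel_measurable_sum rv) auto
  have Am [measurable]: "A j \<in> sets M" if "j \<le> N" for j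
  proof -
    have "A j = {\<omega> \<in> space M. c \<le> \<bar>S j \<omega>\<bar>} - (\<Union>i\<in>{..<j}. {\<omega> \<in> space M. c \<le> \<bar>S i \<omega>\<bar>})"
      by (auto simp: A_def)
    also have "\<dots> \<in> sets M"
    proof (intro sets.Diff sets.finite_UN)
      have "{\<omega> \<in> space M. c \<le> \<bar>S i \<omega>\<bar>} \<in> sets M" if "i \<le> N" for i
        using Sm[OF that] by measurable
      then show "{\<omega> \<in> space M. c \<le> \<bar>S j \<omega>\<bar>} \<in> sets M" "\<And>i. i \<in> {..<j} \<Longrightarrow> {\<omega> \<in> space M. c \<le> \<bar>S i \<omega>\<bar>} \<in> sets M"
        using \<open>j \<le> N\<close> by auto
    qed simp
    finally show ?thesis .
  qed
  have disj: "disjoint_family_on A {..N}"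
    unfolding disjoint_family_on_def A_def
    by (auto simp: set_eq_iff) (metis linorder_neqE_nat)
  have union: "{\<omega> \<in> space M. \<exists>j\<le>N. c \<le> \<bar>\<Sum>i<j. Z i \<omega>\<bar>} = (\<Union>j\<in>{..N}. A j)"
  proof (intro equalityI subsetI)
    fix \<omega> assume "\<omega> \<in> {\<omega> \<in> space M. \<exists>j\<le>N. c \<le> \<bar>\<Sum>i<j. Z i \<omega>\<bar>}"
    then have w: "\<omega> \<in> space M" and ex: "\<exists>j. j \<le> N \<and> c \<le> \<bar>S j \<omega>\<bar>" by (auto simp: S_def)
    define j where "j = (LEAST j. j \<le> N \<and> c \<le> \<bar>S j \<omega>\<bar>)"
    have j: "j \<le> N \<and> c \<le> \<bar>S j \<omega>\<bar>" unfolding j_def using ex by (rule LeastI_ex)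
    moreover have "\<not> c \<le> \<bar>S i \<omega>\<bar>" if "i < j" for i
      using not_less_Least[of i "\<lambda>j. j \<le> N \<and> c \<le> \<bar>S j \<omega>\<bar>"] that j unfolding j_def by auto
    ultimately show "\<omega> \<in> (\<Union>j\<in>{..N}. A j)" using w by (auto simp: A_def)
  qed (auto simp: A_def S_def)
  have sub: "indep_vars (\<lambda>_. borel) Z {..<j}" if "j \<le> N" for j
    using indep by (rule indep_vars_subset) (use that in auto)
  have S4: "integrable M (\<lambda>\<omega>. S j \<omega> ^ 4)" if "j \<le> N" for j
    unfolding S_def using that by (intro indep_sum_moments(1) sub) (auto intro: mean int4)
  have step: "c ^ 4 * prob (A j) \<le> expectation (\<lambda>\<omega>. indicator (A j) \<omega> * S N \<omega> ^ 4)" if j: "j \<le> N" for j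
  proof -
    define R where "R \<omega> = (\<Sum>i\<in>{j..<N}. Z i \<omega>)" for \<omega>
    have SR: "S N \<omega> = S j \<omega> + R \<omega>" for \<omega>
      unfolding S_def R_def using j by (metis atLeast0LessThan le0 sum.atLeastLessThan_concat)
    \<comment> \<open>\<open>g\<close> expresses the indicator of \<open>A j\<close> times the cube
      of \<open>S j\<close> as a function of the first \<open>j\<close> steps alone. That makes it
      independent of \<open>R\<close>, which involves only the later steps.\<close>
    define g where "g f = (if (\<forall>i<j. \<not> c \<le> \<bar>\<Sum>k<i. f k\<bar>) \<and> c \<le> \<bar>\<Sum>k<j. f k\<bar> then (\<Sum>k<j. f k) ^ 3 else 0)"
      for f :: "nat \<Rightarrow> real"
    have partial [measurable]: "(\<lambda>f. \<Sum>k<i. f k :: real) \<in> borel_measurable (PiM {..<j} (\<lambda>_. borel))" if "i \<le> j" for i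
    proof (rule borel_measurable_sum)
      show "(\<lambda>f. f k :: real) \<in> borel_measurable (PiM {..<j} (\<lambda>_. borel))" if "k \<in> {..<i}" for k
        using that \<open>i \<le> j\<close> by (intro measurable_component_singleton) auto
    qed
    have gm: "g \<in> borel_measurable (PiM {..<j} (\<lambda>_. borel))"
    proof -
      have "Measurable.pred (PiM {..<j} (\<lambda>_. borel)) (\<lambda>f. c \<le> \<bar>\<Sum>k<i. f k\<bar>)" if "i \<le> j" for i
        using partial[OF that] by measurable
      then have "Measurable.pred (PiM {..<j} (\<lambda>_. borel)) (\<lambda>f. (\<forall>i\<in>{..<j}. \<not> c \<le> \<bar>\<Sum>k<i. f k\<bar>) \<and> c \<le> \<bar>\<Sum>k<j. f k\<bar>)"
        by (intro pred_intros_logic pred_intros_finite) auto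
      then show ?thesis
        unfolding g_def using partial[of j]
        by (intro measurable_If borel_measurable_power) (auto simp: Ball_def)
    qed
    have "indep_var (PiM {..<j} (\<lambda>_. borel)) (\<lambda>\<omega>. \<lambda>i\<in>{..<j}. Z i \<omega>) (PiM {j..<N} (\<lambda>_. borel)) (\<lambda>\<omega>. \<lambda>i\<in>{j..<N}. Z i \<omega>)"
      using indep by (rule indep_var_restrict) (use j in auto)
    from indep_var_compose[OF this gm, of "\<lambda>f. \<Sum>i\<in>{j..<N}. f i" borel]
    have ind: "indep_var borel (\<lambda>\<omega>. g (\<lambda>i\<in>{..<j}. Z i \<omega>)) borel R"
      by (simp add: comp_def R_def[abs_def])
    have geq: "g (\<lambda>i\<in>{..<j}. Z i \<omega>) = indicator (A j) \<omega> * S j \<omega> ^ 3" if "\<omega> \<in> space M" for \<omega>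
    proof -
      have "(\<Sum>k<i. (\<lambda>i\<in>{..<j}. Z i \<omega>) k) = S i \<omega>" if "i \<le> j" for i
        unfolding S_def using that by (intro sum.cong) auto
      then show ?thesis using that by (auto simp: g_def A_def)
    qed
    have i3: "integrable M (\<lambda>\<omega>. g (\<lambda>i\<in>{..<j}. Z i \<omega>))"
    proof -
      have "integrable M (\<lambda>\<omega>. indicator (A j) \<omega> * S j \<omega> ^ 3)"
        using j by (intro integrable_real_mult_indicator[of "A j" M "\<lambda>\<omega>. S j \<omega> ^ 3", simplified mult.commute]
            integrable_power_of_fourth[OF Sm S4]) auto
      then show ?thesis using geq by (simp cong: Bochner_Integration.integrable_cong)
    qed
    have iR: "integrable M R" and eR: "expectation R = 0"
    proof -
      have *: "indep_vars (\<lambda>_. borel) Z {j..<N}" using indep by (rule indep_vars_subset) auto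
      have m: "R \<in> borel_measurable M" unfolding R_def by (intro borel_measurable_sum rv) auto
      have "integrable M (\<lambda>\<omega>. R \<omega> ^ 4)" unfolding R_def using mean int4 by (intro indep_sum_moments(1) *) auto
      from integrable_power_of_fourth[OF m this, of 1] show "integrable M R" by simp
      show "expectation R = 0" unfolding R_def using mean int4 by (intro indep_sum_moments(2) *) auto
    qed
    have cross: "integrable M (\<lambda>\<omega>. g (\<lambda>i\<in>{..<j}. Z i \<omega>) * R \<omega>)"
      "expectation (\<lambda>\<omega>. g (\<lambda>i\<in>{..<j}. Z i \<omega>) * R \<omega>) = 0"
      using indep_var_integrable[OF ind i3 iR] indep_var_lebesgue_integral[OF ind i3 iR] eR by auto
    have iA: "integrable M (\<lambda>\<omega>. indicator (A j) \<omega> * S N \<omega> ^ 4)"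
      using integrable_real_mult_indicator[OF Am[OF j] S4[of N]] by (simp add: mult.commute)
    have "c ^ 4 * prob (A j) = expectation (\<lambda>\<omega>. c ^ 4 * indicator (A j) \<omega> + 4 * (g (\<lambda>i\<in>{..<j}. Z i \<omega>) * R \<omega>))"
      using cross Am[OF j] by (simp add: less_top[symmetric])
    also have "\<dots> \<le> expectation (\<lambda>\<omega>. indicator (A j) \<omega> * S N \<omega> ^ 4)"
    proof (rule integral_mono[OF _ iA])
      show "integrable M (\<lambda>\<omega>. c ^ 4 * indicator (A j) \<omega> + 4 * (g (\<lambda>i\<in>{..<j}. Z i \<omega>) * R \<omega>))"
        using cross Am[OF j] by (simp add: less_top[symmetric])
      fix \<omega> assume w: "\<omega> \<in> space M"
      show "c ^ 4 * indicator (A j) \<omega> + 4 * (g (\<lambda>i\<in>{..<j}. Z i \<omega>) * R \<omega>) \<le> indicator (A j) \<omega> * S N \<omega> ^ 4"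
      proof (cases "\<omega> \<in> A j")
        case True
        have "c ^ 4 \<le> \<bar>S j \<omega>\<bar> ^ 4" using True c by (intro power_mono) (auto simp: A_def)
        moreover have "s ^ 4 + 4 * (s ^ 3 * r) \<le> (s + r) ^ 4" for s r :: real
        proof -
          \<comment> \<open>The gap between the fourth power and its tangent, exhibited as a square
            times a sum of squares.\<close>
          have "(s + r) ^ 4 - (s ^ 4 + 4 * (s ^ 3 * r)) = r\<^sup>2 * ((2 * s + r)\<^sup>2 + 2 * s\<^sup>2)"
            by (simp add: power4_eq_xxxx power3_eq_cube power2_eq_square algebra_simps)
          also have "\<dots> \<ge> 0" by simp
          finally show ?thesis by simp
        qed
        ultimately show ?thesis using True geq[OF w] by (simp add: SR mult.assoc) (metis add_right_mono order_trans power_even_abs_numeral even_numeral)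
      next
        case False
        then show ?thesis using geq[OF w] by simp
      qed
    qed
    finally show ?thesis .
  qed
  have "c ^ 4 * prob {\<omega> \<in> space M. \<exists>j\<le>N. c \<le> \<bar>\<Sum>i<j. Z i \<omega>\<bar>} = (\<Sum>j\<le>N. c ^ 4 * prob (A j))"
    unfolding union using disj Am
    by (subst finite_measure_finite_Union) (auto simp: sum_distrib_left)
  also have "\<dots> \<le> (\<Sum>j\<le>N. expectation (\<lambda>\<omega>. indicator (A j) \<omega> * S N \<omega> ^ 4))"
    using step by (intro sum_mono) auto
  also have "\<dots> = expectation (\<lambda>\<omega>. \<Sum>j\<le>N. indicator (A j) \<omega> * S N \<omega> ^ 4)"
    using integrable_real_mult_indicator[OF Am S4[of N]]
    by (intro Bochner_Integration.integral_sum[symmetric]) (simp add: mult.commute)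
  also have "\<dots> \<le> expectation (\<lambda>\<omega>. S N \<omega> ^ 4)"
  proof (rule integral_mono)
    show "integrable M (\<lambda>\<omega>. \<Sum>j\<le>N. indicator (A j) \<omega> * S N \<omega> ^ 4)"
      using integrable_real_mult_indicator[OF Am S4[of N]]
      by (intro Bochner_Integration.integrable_sum) (simp add: mult.commute)
    show "integrable M (\<lambda>\<omega>. S N \<omega> ^ 4)" using S4 by simp
    fix \<omega>
    have "(\<Sum>j\<le>N. indicator (A j) \<omega>) = (indicator (\<Union>j\<in>{..N}. A j) \<omega> :: real)"
      using disj by (intro indicator_UN_disjoint[symmetric]) auto
    then have "(\<Sum>j\<le>N. indicator (A j) \<omega>) \<le> (1::real)" by (simp add: indicator_def)
    then have "(\<Sum>j\<le>N. indicator (A j) \<omega>) * S N \<omega> ^ 4 \<le> 1 * S N \<omega> ^ 4"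
      by (intro mult_right_mono) auto
    then show "(\<Sum>j\<le>N. indicator (A j) \<omega> * S N \<omega> ^ 4) \<le> S N \<omega> ^ 4"
      by (simp add: sum_distrib_right)
  qed
  finally show ?thesis by (simp add: S_def)
qed

end

section \<open>A central limit theorem for triangular arrays\<close>

lemma exp_minus_quadratic_bound:
  fixes u :: real
  assumes "0 \<le> u"
  shows "\<bar>(1 - u) - exp (- u)\<bar> \<le> u\<^sup>2 / 2"
proof -
  have "1 - 0 + 0\<^sup>2 / 2 - exp (- 0) \<le> 1 - u + u\<^sup>2 / 2 - exp (- u)"
  proof (rule DERIV_nonneg_imp_nondecreasing[OF assms])
    fix x :: real assume "0 \<le> x"
    have "((\<lambda>x. 1 - x + x\<^sup>2 / 2 - exp (- x)) has_real_derivative (- 1 + x + exp (- x))) (at x)"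
      by (auto intro!: derivative_eq_intros)
    moreover have "0 \<le> - 1 + x + exp (- x)" using exp_ge_add_one_self[of "- x"] by simp
    ultimately show "\<exists>y. ((\<lambda>x. 1 - x + x\<^sup>2 / 2 - exp (- x)) has_real_derivative y) (at x) \<and> 0 \<le> y" by blast
  qed
  moreover have "1 - u \<le> exp (- u)" using exp_ge_add_one_self[of "- u"] by simp
  ultimately show ?thesis by simp
qed

text \<open>The arithmetic-geometric mean inequality for \<open>a * x^2\<close> and
  \<open>x^4 / a\<close>. It trades the third absolute moment for the second and fourth ones, with a
  weight \<open>a\<close> that is still free.\<close>

lemma abs_cube_le:
  fixes x a :: real
  assumes "0 < a"
  shows "\<bar>x\<bar> ^ 3 \<le> (a * x\<^sup>2 + x ^ 4 / a) / 2"
proof -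
  have "(a * x\<^sup>2 + x ^ 4 / a) - 2 * \<bar>x\<bar> ^ 3 = \<bar>x\<bar>\<^sup>2 * (a - \<bar>x\<bar>)\<^sup>2 / a"
  proof -
    have "x ^ 4 = \<bar>x\<bar> ^ 4" "x\<^sup>2 = \<bar>x\<bar>\<^sup>2" by simp_all
    then show ?thesis
      using assms by (simp add: field_simps power4_eq_xxxx power3_eq_cube power2_eq_square del: abs_mult_self_eq)
  qed
  also have "\<dots> \<ge> 0" using assms by simp
  finally show ?thesis by simp
qed

text \<open>Two products of factors from the unit disc differ by at most the sum of the differences
  of their factors. Each factor is compared with \<open>exp (- u)\<close>, where
  \<open>u = t^2 * v / 2\<close>, by way of \<open>1 - u\<close>. The Taylor remainder gives
  \<open>t^2 / 6\<close> times half of \<open>\<bar>t\<bar>\<close>, hence the 12; the error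
  \<open>u^2 / 2\<close> gives the 8.\<close>

lemma (in prob_space) char_sum_normal_approx:
  fixes Z :: "'i \<Rightarrow> 'a \<Rightarrow> real"
  assumes indep: "indep_vars (\<lambda>_. borel) Z I"
    and mean: "\<And>i. i \<in> I \<Longrightarrow> expectation (Z i) = 0"
    and int: "\<And>i k. i \<in> I \<Longrightarrow> k \<le> 4 \<Longrightarrow> integrable M (\<lambda>\<omega>. Z i \<omega> ^ k)"
    and var: "\<And>i. i \<in> I \<Longrightarrow> expectation (\<lambda>\<omega>. (Z i \<omega>)\<^sup>2) = v"
    and fourth: "\<And>i. i \<in> I \<Longrightarrow> expectation (\<lambda>\<omega>. Z i \<omega> ^ 4) \<le> q"
    and v: "0 \<le> v" and a: "0 < a"
  shows "cmod (char (distr M borel (\<lambda>\<omega>. \<Sum>i\<in>I. Z i \<omega>)) t - of_real (exp (- (t\<^sup>2 * (real (card I) * v) / 2))))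
    \<le> real (card I) * (\<bar>t\<bar> ^ 3 / 12 * (a * v + q / a) + t ^ 4 * v\<^sup>2 / 8)" (is "_ \<le> _ * ?b")
proof -
  have rv [measurable]: "Z i \<in> borel_measurable M" if "i \<in> I" for i
    using indep that by (auto simp: indep_vars_def)
  define u where "u = t\<^sup>2 * v / 2"
  have u: "0 \<le> u" using v by (simp add: u_def)
  have step: "cmod (char (distr M borel (Z i)) t - of_real (exp (- u))) \<le> ?b" if i: "i \<in> I" for i
  proof -
    have i1: "integrable M (Z i)" and i2: "integrable M (\<lambda>\<omega>. (Z i \<omega>)\<^sup>2)" and i4: "integrable M (\<lambda>\<omega>. Z i \<omega> ^ 4)"
      using int[OF i, of 1] int[OF i, of 2] int[OF i, of 4] by auto
    have i3: "integrable M (\<lambda>\<omega>. (a * (Z i \<omega>)\<^sup>2 + Z i \<omega> ^ 4 / a) / 2)" using i2 i4 by simp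
    have "cmod (char (distr M borel (Z i)) t - (1 - t\<^sup>2 * v / 2))
        \<le> t\<^sup>2 / 6 * expectation (\<lambda>\<omega>. min (6 * (Z i \<omega>)\<^sup>2) (\<bar>t\<bar> * \<bar>Z i \<omega>\<bar> ^ 3))"
      by (rule char_approx3'[OF rv[OF i] i1 i2 mean[OF i] _ refl]) (use mean[OF i] var[OF i] in simp)
    also have "\<dots> \<le> t\<^sup>2 / 6 * expectation (\<lambda>\<omega>. \<bar>t\<bar> * ((a * (Z i \<omega>)\<^sup>2 + Z i \<omega> ^ 4 / a) / 2))"
    proof (intro mult_left_mono integral_mono)
      show "integrable M (\<lambda>\<omega>. \<bar>t\<bar> * ((a * (Z i \<omega>)\<^sup>2 + Z i \<omega> ^ 4 / a) / 2))" by (rule integrable_mult_right[OF i3])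
      have le: "\<bar>t\<bar> * \<bar>x\<bar> ^ 3 \<le> \<bar>t\<bar> * ((a * x\<^sup>2 + x ^ 4 / a) / 2)" for x
        by (intro mult_left_mono abs_cube_le a) simp
      then show "min (6 * (Z i \<omega>)\<^sup>2) (\<bar>t\<bar> * \<bar>Z i \<omega>\<bar> ^ 3) \<le> \<bar>t\<bar> * ((a * (Z i \<omega>)\<^sup>2 + Z i \<omega> ^ 4 / a) / 2)" for \<omega>
        by (rule min.coboundedI2)
      show "integrable M (\<lambda>\<omega>. min (6 * (Z i \<omega>)\<^sup>2) (\<bar>t\<bar> * \<bar>Z i \<omega>\<bar> ^ 3))"
        by (rule Bochner_Integration.integrable_bound[OF integrable_mult_right[OF i2, of 6]])
          (use i in \<open>auto simp: min_def\<close>)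
    qed simp
    also have "\<dots> = t\<^sup>2 / 6 * (\<bar>t\<bar> * ((a * v + expectation (\<lambda>\<omega>. Z i \<omega> ^ 4) / a) / 2))"
      using i2 i4 var[OF i] by simp
    also have "\<dots> \<le> t\<^sup>2 / 6 * (\<bar>t\<bar> * ((a * v + q / a) / 2))"
      using fourth[OF i] a by (intro mult_left_mono divide_right_mono add_left_mono) auto
    also have "\<dots> = \<bar>t\<bar> ^ 3 / 12 * (a * v + q / a)"
      by (simp add: power3_eq_cube power2_eq_square)
    finally have "cmod (char (distr M borel (Z i)) t - (1 - t\<^sup>2 * v / 2)) \<le> \<bar>t\<bar> ^ 3 / 12 * (a * v + q / a)" .
    moreover have "cmod (complex_of_real (1 - u) - of_real (exp (- u))) \<le> t ^ 4 * v\<^sup>2 / 8"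
    proof -
      have "cmod (complex_of_real (1 - u) - of_real (exp (- u))) = \<bar>(1 - u) - exp (- u)\<bar>"
        by (metis norm_of_real of_real_diff)
      also have "\<dots> \<le> u\<^sup>2 / 2" by (rule exp_minus_quadratic_bound[OF u])
      also have "\<dots> = t ^ 4 * v\<^sup>2 / 8" by (simp add: u_def power2_eq_square power4_eq_xxxx)
      finally show ?thesis .
    qed
    moreover have "char (distr M borel (Z i)) t - of_real (exp (- u))
        = (char (distr M borel (Z i)) t - (1 - t\<^sup>2 * v / 2)) + (complex_of_real (1 - u) - of_real (exp (- u)))"
      by (simp add: u_def)
    ultimately show ?thesis by (metis norm_triangle_le add_mono)
  qed
  have "complex_of_real (exp (- (t\<^sup>2 * (real (card I) * v) / 2))) = (\<Prod>i\<in>I. of_real (exp (- u)))"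
    by (simp add: u_def mult_ac flip: of_real_power exp_of_nat_mult)
  then have "cmod (char (distr M borel (\<lambda>\<omega>. \<Sum>i\<in>I. Z i \<omega>)) t - of_real (exp (- (t\<^sup>2 * (real (card I) * v) / 2))))
      = cmod ((\<Prod>i\<in>I. char (distr M borel (Z i)) t) - (\<Prod>i\<in>I. of_real (exp (- u))))"
    by (simp only: char_distr_sum[OF indep])
  also have "\<dots> \<le> (\<Sum>i\<in>I. cmod (char (distr M borel (Z i)) t - of_real (exp (- u))))"
    by (rule norm_prod_diff)
      (use u in \<open>auto intro!: real_distribution.cmod_char_le_1 real_distribution_distr rv simp: norm_of_real\<close>)
  also have "\<dots> \<le> real (card I) * ?b"
    using sum_bounded_above[of I "\<lambda>i. cmod (char (distr M borel (Z i)) t - of_real (exp (- u)))" ?b] step by simp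
  finally show ?thesis .
qed

lemma real_distribution_normal: "0 < \<sigma> \<Longrightarrow> real_distribution (density lborel (normal_density \<mu> \<sigma>))"
  using prob_space_normal_density by (auto simp: real_distribution_def real_distribution_axioms_def)

lemma char_centered_normal:
  assumes \<sigma>: "0 < \<sigma>"
  shows "char (density lborel (normal_density 0 \<sigma>)) t = of_real (exp (- (t\<^sup>2 * \<sigma>\<^sup>2) / 2))"
proof -
  interpret std: real_distribution std_normal_distribution by (rule real_dist_normal_dist)
  have "distributed std_normal_distribution lborel (\<lambda>x. x) (normal_density 0 1)"
    by (auto simp: distributed_def distr_id2)
  then have "distributed std_normal_distribution lborel (\<lambda>x. 0 + \<sigma> * x) (normal_density (0 + \<sigma> * 0) (\<bar>\<sigma>\<bar> * 1))"
    by (rule std.normal_density_affine) (use \<sigma> in auto)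
  then have "distr std_normal_distribution lborel (\<lambda>x. \<sigma> * x) = density lborel (normal_density 0 \<sigma>)"
    using \<sigma> by (simp add: distributed_def)
  then have "char (density lborel (normal_density 0 \<sigma>)) t = char std_normal_distribution (t * \<sigma>)"
    unfolding char_def by (subst \<open>_ = density lborel (normal_density 0 \<sigma>)\<close>[symmetric]) (simp add: integral_distr mult_ac)
  then show ?thesis by (simp add: char_std_normal_distribution power_mult_distrib)
qed

theorem (in prob_space) central_limit_theorem_array:
  fixes Z :: "nat \<Rightarrow> nat \<Rightarrow> 'a \<Rightarrow> real"
  assumes indep: "\<And>n. indep_vars (\<lambda>_. borel) (Z n) (I n)"
    and mean: "\<And>n i. expectation (Z n i) = 0"
    and int: "\<And>n i k. k \<le> 4 \<Longrightarrow> integrable M (\<lambda>\<omega>. Z n i \<omega> ^ k)"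
    and var: "\<And>n i. expectation (\<lambda>\<omega>. (Z n i \<omega>)\<^sup>2) = v n"
    and fourth: "\<And>n i. expectation (\<lambda>\<omega>. Z n i \<omega> ^ 4) \<le> C / (real n)\<^sup>2"
    and v: "(\<lambda>n. real n * v n) \<longlonglongrightarrow> 1"
    and card: "(\<lambda>n. real (card (I n)) / real n) \<longlonglongrightarrow> s" and s: "0 < s"
  shows "weak_conv_m (\<lambda>n. distr M borel (\<lambda>\<omega>. \<Sum>i\<in>I n. Z n i \<omega>)) (density lborel (normal_density 0 (sqrt s)))"
proof (rule levy_continuity)
  have rv [measurable]: "Z n i \<in> borel_measurable M" for n i
    using int[of 1 n i] by (auto dest: borel_measurable_integrable)
  show "real_distribution (distr M borel (\<lambda>\<omega>. \<Sum>i\<in>I n. Z n i \<omega>))" for n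
    by (intro real_distribution_distr) simp
  show "real_distribution (density lborel (normal_density 0 (sqrt s)))"
    using s by (intro real_distribution_normal) simp
  fix t :: real
  define c where "c n = real (card (I n)) / real n" for n
  define w where "w n = real n * v n" for n
  have vn: "0 \<le> v n" for n unfolding var[of n 0, symmetric] by (rule Bochner_Integration.integral_nonneg) simp
  have root: "(\<lambda>n. 1 / sqrt (real n)) \<longlonglongrightarrow> 0"
    using tendsto_inverse_0_at_top[OF filterlim_compose[OF sqrt_at_top filterlim_real_sequentially]]
    by (simp add: inverse_eq_divide)
  \<comment> \<open>The free weight is \<open>a = 1 / sqrt n\<close>. With \<open>v n\<close> of
    order \<open>1 / n\<close> it makes both \<open>a * v n\<close> and \<open>C / n^2 / a\<close>
    of order \<open>n^(-3/2)\<close>, so that a number of summands proportional to \<open>n\<close>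
    leaves an error of order \<open>1 / sqrt n\<close>.\<close>
  define b where "b n = \<bar>t\<bar> ^ 3 / 12 * ((c n * w n + c n * C) * (1 / sqrt (real n))) + t ^ 4 / 8 * (c n * (w n)\<^sup>2 * (1 / real n))" for n
  have b0: "b \<longlonglongrightarrow> 0"
  proof -
    have "b \<longlonglongrightarrow> \<bar>t\<bar> ^ 3 / 12 * ((s * 1 + s * C) * 0) + t ^ 4 / 8 * (s * 1\<^sup>2 * 0)"
      unfolding b_def[abs_def] using v card lim_1_over_n
      by (intro tendsto_intros root) (auto simp: c_def[abs_def] w_def[abs_def])
    then show ?thesis by simp
  qed
  have bound: "cmod (char (distr M borel (\<lambda>\<omega>. \<Sum>i\<in>I n. Z n i \<omega>)) t - of_real (exp (- (t\<^sup>2 * (c n * w n) / 2)))) \<le> b n"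
    if n: "0 < n" for n
  proof -
    have "cmod (char (distr M borel (\<lambda>\<omega>. \<Sum>i\<in>I n. Z n i \<omega>)) t - of_real (exp (- (t\<^sup>2 * (real (card (I n)) * v n) / 2))))
      \<le> real (card (I n)) * (\<bar>t\<bar> ^ 3 / 12 * (1 / sqrt (real n) * v n + C / (real n)\<^sup>2 / (1 / sqrt (real n))) + t ^ 4 * (v n)\<^sup>2 / 8)"
      using n by (intro char_sum_normal_approx indep mean int var fourth vn) auto
    also have "\<dots> = b n"
    proof -
      define r where "r = sqrt (real n)"
      have r: "r > 0" "real n = r * r" using n by (auto simp: r_def)
      show ?thesis
        unfolding b_def c_def w_def r_def[symmetric] r(2) using r(1)
        by (simp add: field_simps power2_eq_square)
    qed
    also have "real (card (I n)) * v n = c n * w n" using n by (simp add: c_def w_def)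
    finally show ?thesis .
  qed
  have "(\<lambda>n. char (distr M borel (\<lambda>\<omega>. \<Sum>i\<in>I n. Z n i \<omega>)) t - of_real (exp (- (t\<^sup>2 * (c n * w n) / 2)))) \<longlonglongrightarrow> 0"
    by (rule Lim_null_comparison[OF _ b0]) (use bound in \<open>auto simp: eventually_sequentially intro!: exI[of _ 1]\<close>)
  moreover have "(\<lambda>n. complex_of_real (exp (- (t\<^sup>2 * (c n * w n) / 2)))) \<longlonglongrightarrow> of_real (exp (- (t\<^sup>2 * (s * 1) / 2)))"
    using v card by (intro tendsto_intros) (auto simp: c_def[abs_def] w_def[abs_def])
  from tendsto_add[OF calculation this]
  have "(\<lambda>n. char (distr M borel (\<lambda>\<omega>. \<Sum>i\<in>I n. Z n i \<omega>)) t) \<longlonglongrightarrow> of_real (exp (- (t\<^sup>2 * s / 2)))" by simp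
  then show "(\<lambda>n. char (distr M borel (\<lambda>\<omega>. \<Sum>i\<in>I n. Z n i \<omega>)) t) \<longlonglongrightarrow> char (density lborel (normal_density 0 (sqrt s))) t"
    using s by (simp add: char_centered_normal)
qed

section \<open>Weak convergence of product measures\<close>

text \<open>Skorohod's representation in every coordinate turns weak convergence of the marginals into
  pointwise convergence on a product space.\<close>

theorem weak_conv_product:
  fixes \<mu> :: "nat \<Rightarrow> nat \<Rightarrow> real measure" and \<nu> :: "nat \<Rightarrow> real measure"
    and g :: "(nat \<Rightarrow> real) \<Rightarrow> real"
  assumes \<mu>: "\<And>n k. real_distribution (\<mu> n k)" and \<nu>: "\<And>k. real_distribution (\<nu> k)"
    and conv: "\<And>k. weak_conv_m (\<lambda>n. \<mu> n k) (\<nu> k)"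
    and g [measurable]: "g \<in> borel_measurable (PiM {..<K} (\<lambda>_. borel))"
    and B: "\<And>y. \<bar>g y\<bar> \<le> B"
    and cont: "\<And>y z. (\<And>k. k < K \<Longrightarrow> (\<lambda>n. y n k) \<longlonglongrightarrow> z k) \<Longrightarrow> (\<lambda>n. g (y n)) \<longlonglongrightarrow> g z"
  shows "(\<lambda>n. \<integral>y. g y \<partial>PiM {..<K} (\<mu> n)) \<longlonglongrightarrow> (\<integral>y. g y \<partial>PiM {..<K} \<nu>)"
proof -
  \<comment> \<open>For each coordinate \<open>k\<close> one space carries the whole sequence in
    \<open>n\<close> together with its limit. The product over \<open>k\<close> then makes the
    coordinates independent for every \<open>n\<close> simultaneously.\<close>
  have "\<exists>(\<Omega> :: real measure) (Y_seq :: nat \<Rightarrow> real \<Rightarrow> real) (Y :: real \<Rightarrow> real).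
    prob_space \<Omega> \<and> (\<forall>n. Y_seq n \<in> measurable \<Omega> borel) \<and> (\<forall>n. distr \<Omega> borel (Y_seq n) = \<mu> n k) \<and>
    Y \<in> measurable \<Omega> lborel \<and> distr \<Omega> borel Y = \<nu> k \<and> (\<forall>x \<in> space \<Omega>. (\<lambda>n. Y_seq n x) \<longlonglongrightarrow> Y x)" for k
    by (rule Skorohod[OF \<mu> \<nu> conv])
  then obtain \<Omega> :: "nat \<Rightarrow> real measure" and Ys :: "nat \<Rightarrow> nat \<Rightarrow> real \<Rightarrow> real" and Y :: "nat \<Rightarrow> real \<Rightarrow> real"
    where \<Omega>: "\<And>k. prob_space (\<Omega> k)" and Ysm: "\<And>k n. Ys k n \<in> measurable (\<Omega> k) borel"
      and Ysd: "\<And>k n. distr (\<Omega> k) borel (Ys k n) = \<mu> n k" and Ym: "\<And>k. Y k \<in> measurable (\<Omega> k) lborel"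
      and Yd: "\<And>k. distr (\<Omega> k) borel (Y k) = \<nu> k"
      and lim: "\<And>k x. x \<in> space (\<Omega> k) \<Longrightarrow> (\<lambda>n. Ys k n x) \<longlonglongrightarrow> Y k x"
    by metis
  have Ym': "Y k \<in> borel_measurable (\<Omega> k)" for k using Ym[of k] by simp
  let ?P = "PiM {..<K} \<Omega>"
  let ?F = "\<lambda>V x. \<lambda>k\<in>{..<K}. V k (x k) :: real"
  interpret P: prob_space ?P using \<Omega> by (intro prob_space_PiM)
  have Fm: "?F V \<in> measurable ?P (PiM {..<K} (\<lambda>_. borel))" if "\<And>k. V k \<in> borel_measurable (\<Omega> k)" for V
    using that by (intro measurable_restrict measurable_compose[OF measurable_component_singleton]) auto
  have push: "(\<integral>y. g y \<partial>PiM {..<K} (\<lambda>k. distr (\<Omega> k) borel (V k))) = (\<integral>x. g (?F V x) \<partial>?P)"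
    if V: "\<And>k. V k \<in> borel_measurable (\<Omega> k)" for V
  proof -
    \<comment> \<open>The coordinatewise image of a product measure is the product of the images, as
      seen on boxes. Both sides of the claim thus become integrals over the single space
      \<open>?P\<close>.\<close>
    have "distr ?P (PiM {..<K} (\<lambda>k. distr (\<Omega> k) borel (V k))) (?F V) = PiM {..<K} (\<lambda>k. distr (\<Omega> k) borel (V k))"
    proof (rule product_sigma_finite.PiM_eqI)
      show "product_sigma_finite (\<lambda>k. distr (\<Omega> k) borel (V k))"
        using \<Omega> V by (intro product_sigma_finite.intro prob_space_imp_sigma_finite prob_space.prob_space_distr)
      fix A assume A: "\<And>i. i \<in> {..<K} \<Longrightarrow> A i \<in> sets (distr (\<Omega> i) borel (V i))"
      interpret product_prob_space \<Omega> "{..<K}"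
        using \<Omega> by (auto intro!: product_prob_spaceI)
      have sets: "sets (PiM {..<K} (\<lambda>k. distr (\<Omega> k) borel (V k))) = sets (PiM {..<K} (\<lambda>_. borel))"
        by (intro sets_PiM_cong) auto
      have A': "V i -` A i \<inter> space (\<Omega> i) \<in> sets (\<Omega> i)" if "i \<in> {..<K}" for i
        using A[OF that] V[of i] by (auto intro: measurable_sets)
      have "emeasure (distr ?P (PiM {..<K} (\<lambda>k. distr (\<Omega> k) borel (V k))) (?F V)) (Pi\<^sub>E {..<K} A)
          = emeasure ?P (?F V -` Pi\<^sub>E {..<K} A \<inter> space ?P)"
        using Fm[OF V] A by (intro emeasure_distr) (auto simp: measurable_cong_sets[OF refl sets] intro!: sets_PiM_I_finite)
      also have "?F V -` Pi\<^sub>E {..<K} A \<inter> space ?P = Pi\<^sub>E {..<K} (\<lambda>i. V i -` A i \<inter> space (\<Omega> i))"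
        by (auto simp: space_PiM PiE_iff extensional_def)
      also have "emeasure ?P \<dots> = (\<Prod>i<K. emeasure (\<Omega> i) (V i -` A i \<inter> space (\<Omega> i)))"
        using A' by (intro emeasure_PiM) auto
      also have "\<dots> = (\<Prod>i<K. emeasure (distr (\<Omega> i) borel (V i)) (A i))"
        using A V by (intro prod.cong) (auto simp: emeasure_distr)
      finally show "emeasure (distr ?P (PiM {..<K} (\<lambda>k. distr (\<Omega> k) borel (V k))) (?F V)) (Pi\<^sub>E {..<K} A)
          = (\<Prod>i<K. emeasure (distr (\<Omega> i) borel (V i)) (A i))" .
    qed auto
    moreover have "distr ?P (PiM {..<K} (\<lambda>k. distr (\<Omega> k) borel (V k))) (?F V) = distr ?P (PiM {..<K} (\<lambda>_. borel)) (?F V)"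
      by (intro distr_cong sets_PiM_cong) auto
    ultimately have "(\<integral>y. g y \<partial>PiM {..<K} (\<lambda>k. distr (\<Omega> k) borel (V k))) = (\<integral>y. g y \<partial>distr ?P (PiM {..<K} (\<lambda>_. borel)) (?F V))"
      by simp
    then show ?thesis by (simp add: integral_distr[OF Fm[OF V] g])
  qed
  have "(\<lambda>n. \<integral>x. g (?F (\<lambda>k. Ys k n) x) \<partial>?P) \<longlonglongrightarrow> (\<integral>x. g (?F Y x) \<partial>?P)"
  proof (rule integral_dominated_convergence[where w="\<lambda>_. B"])
    show "(\<lambda>x. g (?F Y x)) \<in> borel_measurable ?P" by (rule measurable_compose[OF Fm[OF Ym'] g])
    show "(\<lambda>x. g (?F (\<lambda>k. Ys k n) x)) \<in> borel_measurable ?P" for n by (rule measurable_compose[OF Fm[OF Ysm] g])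
    show "AE x in ?P. (\<lambda>n. g (?F (\<lambda>k. Ys k n) x)) \<longlonglongrightarrow> g (?F Y x)"
      by (intro AE_I2 cont) (auto simp: space_PiM PiE_iff intro: lim)
    show "AE x in ?P. norm (g (?F (\<lambda>k. Ys k n) x)) \<le> B" for n using B by simp
  qed simp
  then show ?thesis by (simp add: push[OF Ym', unfolded Yd, symmetric] push[OF Ysm, unfolded Ysd, symmetric])
qed

section \<open>Donsker's theorem for triangular arrays\<close>

text \<open>The bound on the difference holds at all times, so the tail term of
  \<open>skorokhod_dist_le\<close> can be made arbitrarily small.\<close>

lemma skorokhod_dist_step_path_le:
  assumes "\<And>k. \<bar>y k - z k\<bar> \<le> e"
  shows "skorokhod_dist (step_path m y) (step_path m z) \<le> e"
proof (rule field_le_epsilon)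
  fix r :: real assume r: "0 < r"
  obtain T where T: "(1/2::real) ^ T < r" using real_arch_pow_inv[of r "1/2"] r by auto
  have "0 \<le> e" using assms[of 0] abs_ge_zero order_trans by blast
  then have "skorokhod_dist (step_path m y) (step_path m z) \<le> e + (1/2) ^ T"
    using assms by (intro skorokhod_dist_le) (auto simp: step_path_eq)
  then show "skorokhod_dist (step_path m y) (step_path m z) \<le> e + r" using T by simp
qed

text \<open>The inverse view of \<open>sample_path\<close>: the sampled path of a process started at
  0, rebuilt from its first \<open>m * m\<close> grid increments. These increments are independent
  for the walk and for Brownian motion alike.\<close>

definition increments_path :: "nat \<Rightarrow> (nat \<Rightarrow> real) \<Rightarrow> real \<Rightarrow> real" where
  "increments_path m y = step_path m (\<lambda>k. \<Sum>i<min k (m * m). y i)"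

lemma measurable_increments_path:
  assumes "0 < m"
  shows "increments_path m \<in> measurable (PiM {..<m * m} (\<lambda>_. borel)) (borel_of skorokhod_topology)"
proof -
  have "(\<lambda>y. step_path m (\<lambda>k. \<Sum>i<min k (m * m). y i))
      \<in> measurable (PiM {..<m * m} (\<lambda>_. borel)) (borel_of skorokhod_topology)"
    by (intro measurable_step_path assms borel_measurable_sum measurable_component_singleton) auto
  then show ?thesis by (simp add: increments_path_def[abs_def])
qed

lemma increments_path_tendsto:
  assumes "\<And>k. k < m * m \<Longrightarrow> (\<lambda>n. y n k) \<longlonglongrightarrow> z k"
  shows "(\<lambda>n. skorokhod_dist (increments_path m (y n)) (increments_path m z)) \<longlonglongrightarrow> 0"
proof (rule tendsto_sandwich[OF _ _ tendsto_const])
  have "(\<lambda>n. \<Sum>i<m * m. \<bar>y n i - z i\<bar>) \<longlonglongrightarrow> (\<Sum>i<m * m. \<bar>z i - z i\<bar>)"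
    using assms by (intro tendsto_intros) auto
  then show "(\<lambda>n. \<Sum>i<m * m. \<bar>y n i - z i\<bar>) \<longlonglongrightarrow> 0" by simp
  have "skorokhod_dist (increments_path m (y n)) (increments_path m z) \<le> (\<Sum>i<m * m. \<bar>y n i - z i\<bar>)" for n
    unfolding increments_path_def
  proof (rule skorokhod_dist_step_path_le)
    fix k
    have "\<bar>(\<Sum>i<min k (m * m). y n i) - (\<Sum>i<min k (m * m). z i)\<bar> \<le> (\<Sum>i<min k (m * m). \<bar>y n i - z i\<bar>)"
      unfolding sum_subtractf[symmetric] by (rule sum_abs)
    also have "\<dots> \<le> (\<Sum>i<m * m. \<bar>y n i - z i\<bar>)" by (intro sum_mono2) auto
    finally show "\<bar>(\<Sum>i<min k (m * m). y n i) - (\<Sum>i<min k (m * m). z i)\<bar> \<le> (\<Sum>i<m * m. \<bar>y n i - z i\<bar>)" .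
  qed
  then show "\<forall>\<^sub>F n in sequentially. skorokhod_dist (increments_path m (y n)) (increments_path m z) \<le> (\<Sum>i<m * m. \<bar>y n i - z i\<bar>)"
    by (rule always_eventually[OF allI])
qed (simp add: skorokhod.nonneg)

lemma sample_path_eq_increments_path:
  assumes "\<And>k. k \<le> m * m \<Longrightarrow> x (real k / real m) = (\<Sum>i<k. y i)"
  shows "sample_path m x = increments_path m y"
  unfolding sample_path_def increments_path_def by (rule arg_cong[where f = "step_path m"]) (auto simp: assms)

lemma (in prob_space) expectation_indep_vector:
  fixes D :: "'i \<Rightarrow> 'a \<Rightarrow> real" and h :: "('i \<Rightarrow> real) \<Rightarrow> real"
  assumes "I \<noteq> {}" "indep_vars (\<lambda>_. borel) D I" and h: "h \<in> borel_measurable (PiM I (\<lambda>_. borel))"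
  shows "expectation (\<lambda>\<omega>. h (\<lambda>k\<in>I. D k \<omega>)) = (\<integral>y. h y \<partial>PiM I (\<lambda>k. distr M borel (D k)))"
proof -
  have rv: "D k \<in> borel_measurable M" if "k \<in> I" for k using assms(2) that by (auto simp: indep_vars_def)
  then have "distr M (PiM I (\<lambda>_. borel)) (\<lambda>\<omega>. \<lambda>k\<in>I. D k \<omega>) = PiM I (\<lambda>k. distr M borel (D k))"
    using assms(1,2) indep_vars_iff_distr_eq_PiM'[where I = I and X = D and M' = "\<lambda>_. borel"] by simp
  moreover have m: "(\<lambda>\<omega>. \<lambda>k\<in>I. D k \<omega>) \<in> measurable M (PiM I (\<lambda>_. borel))"
    using rv by (intro measurable_restrict) auto
  ultimately show ?thesis using integral_distr[OF m h] by simp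
qed

text \<open>Independence is required within a row only, because the eigenvalue walks for different
  \<open>n\<close> are built from the same variables. Each row is infinite since time is unbounded.
  The fourth moment bound is the one natural for steps of size \<open>1 / sqrt n\<close>; at
  \<open>n = 0\<close> its right side is 0.\<close>

locale walk_array = prob_space M for M :: "'a measure" +
  fixes Z :: "nat \<Rightarrow> nat \<Rightarrow> 'a \<Rightarrow> real" and v :: "nat \<Rightarrow> real" and C :: real
  assumes indep: "\<And>n. indep_vars (\<lambda>_. borel) (Z n) UNIV"
    and mean: "\<And>n i. expectation (Z n i) = 0"
    and int4: "\<And>n i. integrable M (\<lambda>\<omega>. Z n i \<omega> ^ 4)"
    and var: "\<And>n i. expectation (\<lambda>\<omega>. (Z n i \<omega>)\<^sup>2) = v n"
    and fourth: "\<And>n i. expectation (\<lambda>\<omega>. Z n i \<omega> ^ 4) \<le> C / (real n)\<^sup>2"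
    and v_lim: "(\<lambda>n. real n * v n) \<longlonglongrightarrow> 1"
begin

lemma rv [measurable]: "Z n i \<in> borel_measurable M"
  using indep[of n] by (auto simp: indep_vars_def)

lemma v_nonneg: "0 \<le> v n"
  unfolding var[of n 0, symmetric] by (rule Bochner_Integration.integral_nonneg) simp

definition path :: "nat \<Rightarrow> 'a \<Rightarrow> real \<Rightarrow> real" where
  "path n \<omega> = step_path n (\<lambda>j. \<Sum>i<j. Z n i \<omega>)"

lemma path_at_grid:
  assumes "0 < m"
  shows "path n \<omega> (real k / real m) = (\<Sum>i<n * k div m. Z n i \<omega>)"
proof -
  have "nat \<lfloor>real n * (real k / real m)\<rfloor> = n * k div m"
    using floor_divide_of_nat_eq[of "n * k" m, where ?'a = real] by simp
  then show ?thesis by (simp add: path_def step_path_eq)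
qed

lemma measurable_path: "0 < n \<Longrightarrow> path n \<in> measurable M (borel_of skorokhod_topology)"
  unfolding path_def[abs_def] by (intro measurable_step_path) auto

text \<open>The steps taken between the grid times \<open>k / m\<close> and
  \<open>(k + 1) / m\<close>. As \<open>m\<close> need not divide \<open>n\<close>, the lengths of
  the blocks agree with \<open>n / m\<close> only up to 1.\<close>

definition block :: "nat \<Rightarrow> nat \<Rightarrow> nat \<Rightarrow> nat set" where
  "block m n k = {n * k div m ..< n * (k + 1) div m}"

lemma block_mono: "n * k div m \<le> n * (k + 1) div (m::nat)"
  by (rule div_le_mono) simp

lemma card_block_bounds:
  assumes "0 < m"
  shows "\<bar>real (card (block m n k)) - real n / real m\<bar> \<le> 1"
proof -
  have floor: "real (a div m) \<le> real a / real m" "real a / real m < real (a div m) + 1" for a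
    using assms floor_divide_of_nat_eq[of a m, where ?'a = real] by linarith+
  have c: "real (card (block m n k)) = real (n * (k + 1) div m) - real (n * k div m)"
    using block_mono[of n k m] by (simp add: block_def of_nat_diff)
  have "real (n * (k + 1)) / real m = real (n * k) / real m + real n / real m"
    by (simp add: add_divide_distrib distrib_left)
  then show ?thesis unfolding c abs_le_iff
    using floor[of "n * (k + 1)"] floor[of "n * k"] by linarith
qed

lemma card_block_tendsto:
  assumes "0 < m"
  shows "(\<lambda>n. real (card (block m n k)) / real n) \<longlonglongrightarrow> 1 / real m"
proof (rule LIM_zero_cancel, rule Lim_null_comparison[OF _ lim_1_over_n])
  show "\<forall>\<^sub>F n in sequentially. norm (real (card (block m n k)) / real n - 1 / real m) \<le> 1 / real n"
    unfolding eventually_sequentially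
  proof (intro exI[of _ 1] allI impI)
    fix n :: nat assume n: "1 \<le> n"
    have "real (card (block m n k)) / real n - 1 / real m = (real (card (block m n k)) - real n / real m) / real n"
      using n by (simp add: diff_divide_distrib)
    then show "norm (real (card (block m n k)) / real n - 1 / real m) \<le> 1 / real n"
      using card_block_bounds[OF assms, of n k] n by (simp add: abs_divide divide_right_mono)
  qed
qed

lemma sum_blocks: "(\<Sum>i<k. \<Sum>j\<in>block m n i. f j) = (\<Sum>j<n * k div m. f j :: real)"
proof (induction k)
  case (Suc k)
  have "(\<Sum>j<n * Suc k div m. f j) = (\<Sum>j<n * k div m. f j) + (\<Sum>j\<in>block m n k. f j)"
    unfolding block_def atLeast0LessThan[symmetric]
    using block_mono[of n k m] by (subst sum.atLeastLessThan_concat) auto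
  then show ?case using Suc by simp
qed simp

lemma indep_blocks: "indep_vars (\<lambda>_. borel) (\<lambda>k \<omega>. \<Sum>i\<in>block m n k. Z n i \<omega>) A"
proof -
  have "disjoint_family_on (block m n) A"
    unfolding disjoint_family_on_def
  proof (intro ballI impI)
    have "block m n k \<inter> block m n l = {}" if "k < l" for k l
    proof -
      have "n * (k + 1) div m \<le> n * l div m" using that by (intro div_le_mono mult_le_mono) auto
      then show ?thesis by (auto simp: block_def)
    qed
    then show "block m n k \<inter> block m n l = {}" if "k \<noteq> l" for k l
      using that by (metis Int_commute linorder_neqE_nat)
  qed
  from indep_vars_restrict[OF indep _ this]
  have "indep_vars (\<lambda>k. PiM (block m n k) (\<lambda>_. borel)) (\<lambda>k \<omega>. \<lambda>i\<in>block m n k. Z n i \<omega>) A" by simp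
  from indep_vars_compose2[OF this, of "\<lambda>k f. \<Sum>i\<in>block m n k. f i" "\<lambda>_. borel"]
  show ?thesis by simp
qed

text \<open>The range of \<open>j\<close> includes the full block: when
  \<open>n * (k + 1) / m\<close> is not an integer, the walk takes its last step of the block
  strictly before the time \<open>(k + 1) / m\<close>.\<close>

definition oscillation :: "nat \<Rightarrow> nat \<Rightarrow> real \<Rightarrow> nat \<Rightarrow> 'a set" where
  "oscillation n m e k = {\<omega> \<in> space M. \<exists>j\<le>card (block m n k). e \<le> \<bar>\<Sum>i<j. Z n (n * k div m + i) \<omega>\<bar>}"

lemma sets_oscillation [measurable]: "oscillation n m e k \<in> sets M"
  unfolding oscillation_def by measurable

text \<open>Since \<open>m \<le> n\<close>, a block has at most \<open>2 * n / m\<close> steps and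
  hence variance at most \<open>4 / m\<close>. In the fourth moment of the block sum the variances
  contribute \<open>3 * (4 / m)^2 = 48 / m^2\<close>, and the fourth moments contribute
  \<open>2 * C / (m * n) \<le> 2 * C / m^2\<close>.\<close>

lemma prob_oscillation:
  assumes m: "0 < m" and n: "m \<le> n" and vn: "real n * v n \<le> 2" and e: "0 < e"
  shows "prob (oscillation n m e k) \<le> (48 + 2 * C) / ((real m)\<^sup>2 * e ^ 4)"
proof -
  let ?N = "card (block m n k)" and ?Z = "\<lambda>i. Z n (n * k div m + i)"
  have n0: "0 < real n" using m n by simp
  have C: "0 \<le> C"
  proof -
    have "0 \<le> expectation (\<lambda>\<omega>. Z n 0 \<omega> ^ 4)" by (rule Bochner_Integration.integral_nonneg) simp
    then have "0 \<le> C / (real n)\<^sup>2" using fourth order_trans by blast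
    then show ?thesis using n0 by (simp add: zero_le_divide_iff)
  qed
  have ind: "indep_vars (\<lambda>_. borel) ?Z {..<?N}"
  proof -
    have "disjoint_family_on (\<lambda>i. {n * k div m + i}) {..<?N}" by (auto simp: disjoint_family_on_def)
    from indep_vars_restrict[OF indep[of n] _ this]
    have "indep_vars (\<lambda>i. PiM {n * k div m + i} (\<lambda>_. borel)) (\<lambda>i \<omega>. \<lambda>j\<in>{n * k div m + i}. Z n j \<omega>) {..<?N}"
      by simp
    from indep_vars_compose2[OF this, of "\<lambda>i f. f (n * k div m + i)" "\<lambda>_. borel"]
    show ?thesis by (simp add: measurable_component_singleton)
  qed
  have N: "real ?N \<le> 2 * real n / real m"
  proof -
    have "1 \<le> real n / real m" using m n by simp
    then show ?thesis using card_block_bounds[OF m, of n k] by linarith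
  qed
  have "e ^ 4 * prob (oscillation n m e k) \<le> expectation (\<lambda>\<omega>. (\<Sum>i<?N. ?Z i \<omega>) ^ 4)"
    unfolding oscillation_def by (rule fourth_moment_maximal_inequality[OF ind mean int4 e])
  also have "\<dots> \<le> 3 * (\<Sum>i<?N. expectation (\<lambda>\<omega>. (?Z i \<omega>)\<^sup>2))\<^sup>2 + (\<Sum>i<?N. expectation (\<lambda>\<omega>. ?Z i \<omega> ^ 4))"
    by (rule indep_sum_moments(4)[OF _ ind]) (simp_all add: mean int4)
  also have "\<dots> \<le> 3 * (real ?N * v n)\<^sup>2 + real ?N * (C / (real n)\<^sup>2)"
    using sum_bounded_above[of "{..<?N}" "\<lambda>i. expectation (\<lambda>\<omega>. ?Z i \<omega> ^ 4)" "C / (real n)\<^sup>2"] fourth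
    by (simp add: var)
  also have "\<dots> \<le> 3 * (4 / real m)\<^sup>2 + 2 * C / (real m)\<^sup>2"
  proof (rule add_mono)
    have "real ?N * v n \<le> 2 * real n / real m * v n" using N v_nonneg by (rule mult_right_mono)
    also have "\<dots> = 2 * (real n * v n) / real m" by simp
    also have "\<dots> \<le> 4 / real m" using vn m by (intro divide_right_mono) auto
    finally show "3 * (real ?N * v n)\<^sup>2 \<le> 3 * (4 / real m)\<^sup>2"
      using v_nonneg by (intro mult_left_mono power_mono) auto
    have "real ?N * (C / (real n)\<^sup>2) \<le> 2 * real n / real m * (C / (real n)\<^sup>2)"
      using N C by (intro mult_right_mono) auto
    also have "\<dots> = 2 * C / (real m * real n)" using n0 by (simp add: power2_eq_square)
    also have "\<dots> \<le> 2 * C / (real m)\<^sup>2"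
      unfolding power2_eq_square using C m n by (intro divide_left_mono mult_left_mono) auto
    finally show "real ?N * (C / (real n)\<^sup>2) \<le> 2 * C / (real m)\<^sup>2" .
  qed
  also have "\<dots> = (48 + 2 * C) / (real m)\<^sup>2" by (simp add: power_divide add_divide_distrib)
  finally show ?thesis
    unfolding divide_divide_eq_left[symmetric] using e by (simp only: pos_le_divide_eq zero_less_power mult.commute)
qed

text \<open>A time \<open>t\<close> in \<open>[0, T]\<close> lies in the cell
  \<open>k = [m * t]\<close>, and \<open>k = T * m\<close> occurs for \<open>t = T\<close>. The step
  index \<open>[n * t]\<close> stays within the closed range of that cell's block, so the difference
  from the grid value is a partial sum over the block.\<close>

lemma dist_sample_path_off_oscillation:
  assumes m: "0 < m" and n: "0 < n" and T: "T \<le> m" and e: "0 < e" and \<omega>: "\<omega> \<in> space M"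
    and off: "\<omega> \<notin> (\<Union>k\<in>{..T * m}. oscillation n m e k)"
  shows "skorokhod_dist (sample_path m (path n \<omega>)) (path n \<omega>) \<le> e + (1/2) ^ T"
proof (rule skorokhod_dist_sample_path[OF _ T])
  fix t assume t: "t \<in> {0..real T}"
  define k where "k = nat \<lfloor>real m * t\<rfloor>"
  define j where "j = nat \<lfloor>real n * t\<rfloor>"
  have "real m * t \<le> real m * real T" using t by (intro mult_left_mono) auto
  then have "real m * t \<le> real (T * m)" by (simp add: mult.commute)
  then have k: "k \<le> T * m" unfolding k_def by linarith
  have k1: "real k \<le> real m * t" "real m * t < real (k + 1)"
    using t mult_nonneg_nonneg[of "real m" t] unfolding k_def by (auto, linarith+)
  have "real n * real k \<le> real m * (real n * t)"
    using mult_left_mono[OF k1(1), of "real n"] by (simp add: mult_ac)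
  then have kt: "real n * real k / real m \<le> real n * t" using m by (simp add: divide_le_eq mult.commute)
  have "n * k div m \<le> j"
  proof -
    have "n * k div m = nat \<lfloor>real n * real k / real m\<rfloor>"
      using floor_divide_of_nat_eq[of "n * k" m, where ?'a = real] by simp
    then show ?thesis unfolding j_def using kt by (simp add: nat_mono floor_mono)
  qed
  moreover have "j \<le> n * (k + 1) div m"
  proof -
    have "real m * (real n * t) \<le> real n * real (k + 1)"
      using mult_left_mono[OF less_imp_le[OF k1(2)], of "real n"] by (simp only: mult_ac)
    then have "real n * t \<le> real n * real (k + 1) / real m" using m by (simp add: le_divide_eq mult.commute)
    moreover have "n * (k + 1) div m = nat \<lfloor>real n * real (k + 1) / real m\<rfloor>"
      using floor_divide_of_nat_eq[of "n * (k + 1)" m, where ?'a = real] by (simp only: of_nat_mult)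
    ultimately show ?thesis unfolding j_def by (simp only: nat_mono floor_mono)
  qed
  ultimately have j: "n * k div m \<le> j" "j - n * k div m \<le> card (block m n k)" by (auto simp: block_def)
  have "\<omega> \<notin> oscillation n m e k" using off k by blast
  then have "\<not> e \<le> \<bar>\<Sum>i<j - n * k div m. Z n (n * k div m + i) \<omega>\<bar>"
    using \<omega> j(2) unfolding oscillation_def by blast
  moreover have "(\<Sum>i<j. Z n i \<omega>) = (\<Sum>i<n * k div m. Z n i \<omega>) + (\<Sum>i<j - n * k div m. Z n (n * k div m + i) \<omega>)"
    using j(1) sum.atLeastLessThan_concat[of 0 "n * k div m" j "\<lambda>i. Z n i \<omega>"]
      sum.shift_bounds_nat_ivl[of "\<lambda>i. Z n i \<omega>" 0 "n * k div m" "j - n * k div m"]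
    by (simp add: atLeast0LessThan add.commute)
  moreover have "path n \<omega> t = (\<Sum>i<j. Z n i \<omega>)" using t by (simp add: path_def step_path_eq j_def)
  ultimately show "\<bar>path n \<omega> (real (nat \<lfloor>real m * t\<rfloor>) / real m) - path n \<omega> t\<bar> \<le> e"
    unfolding k_def[symmetric] path_at_grid[OF m] by simp
qed (use e in simp)

text \<open>Where no cell oscillates, the Lipschitz bound applies; elsewhere \<open>g\<close>
  changes by at most \<open>2 * B\<close>, and a union bound over the \<open>T * m + 1\<close> cells
  estimates the probability.\<close>

lemma expectation_sample_path_close:
  assumes g: "\<And>x. x \<in> cadlag_space \<Longrightarrow> \<bar>g x\<bar> \<le> B" and L: "0 \<le> L"
    and lip: "\<And>x y. x \<in> cadlag_space \<Longrightarrow> y \<in> cadlag_space \<Longrightarrow> \<bar>g x - g y\<bar> \<le> L * skorokhod_dist x y"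
    and m: "0 < m" and n: "m \<le> n" and vn: "real n * v n \<le> 2" and e: "0 < e" and T: "T \<le> m"
  shows "\<bar>expectation (\<lambda>\<omega>. g (sample_path m (path n \<omega>))) - expectation (\<lambda>\<omega>. g (path n \<omega>))\<bar>
    \<le> L * (e + (1/2) ^ T) + 2 * B * (real (T * m + 1) * ((48 + 2 * C) / ((real m)\<^sup>2 * e ^ 4)))"
proof -
  have n0: "0 < n" using m n by simp
  define A where "A = (\<Union>k\<in>{..T * m}. oscillation n m e k)"
  have A [measurable]: "A \<in> sets M" unfolding A_def by measurable
  have gm: "g \<in> borel_measurable (borel_of skorokhod_topology)"
    using skorokhod.lipschitz_imp_continuous_map[OF lip] by (rule continuous_map_measurable_borel_of)
  have p: "path n \<omega> \<in> cadlag_space" for \<omega> using n0 by (simp add: path_def step_path_cadlag)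
  have s: "sample_path m (path n \<omega>) \<in> cadlag_space" for \<omega> using m by (simp add: sample_path_def step_path_cadlag)
  have sm: "(\<lambda>\<omega>. sample_path m (path n \<omega>)) \<in> measurable M (borel_of skorokhod_topology)"
    unfolding sample_path_def path_at_grid[OF m] by (intro measurable_step_path m) auto
  have i: "integrable M (\<lambda>\<omega>. g (sample_path m (path n \<omega>)))" "integrable M (\<lambda>\<omega>. g (path n \<omega>))"
    using g s p measurable_compose[OF sm gm] measurable_compose[OF measurable_path[OF n0] gm]
    by (auto intro!: integrable_const_bound[of _ B])
  have "B \<ge> 0" using g[OF p] abs_ge_zero order_trans by blast
  have pw: "\<bar>g (sample_path m (path n \<omega>)) - g (path n \<omega>)\<bar> \<le> L * (e + (1/2) ^ T) + 2 * B * indicator A \<omega>"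
    if \<omega>: "\<omega> \<in> space M" for \<omega>
  proof (cases "\<omega> \<in> A")
    case True
    have "\<bar>g (sample_path m (path n \<omega>)) - g (path n \<omega>)\<bar> \<le> 2 * B" using g[OF s[of \<omega>]] g[OF p[of \<omega>]] by linarith
    then show ?thesis using True L e by (simp add: add_increasing)
  next
    case False
    have "\<bar>g (sample_path m (path n \<omega>)) - g (path n \<omega>)\<bar> \<le> L * skorokhod_dist (sample_path m (path n \<omega>)) (path n \<omega>)"
      by (rule lip[OF s p])
    also have "\<dots> \<le> L * (e + (1/2) ^ T)"
      using False by (intro mult_left_mono dist_sample_path_off_oscillation m n0 T e \<omega> L) (simp add: A_def)
    finally show ?thesis using False by simp
  qed
  have "\<bar>expectation (\<lambda>\<omega>. g (sample_path m (path n \<omega>))) - expectation (\<lambda>\<omega>. g (path n \<omega>))\<bar>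
      = \<bar>expectation (\<lambda>\<omega>. g (sample_path m (path n \<omega>)) - g (path n \<omega>))\<bar>"
    using i by simp
  also have "\<dots> \<le> expectation (\<lambda>\<omega>. \<bar>g (sample_path m (path n \<omega>)) - g (path n \<omega>)\<bar>)" by (rule integral_abs_bound)
  also have "\<dots> \<le> expectation (\<lambda>\<omega>. L * (e + (1/2) ^ T) + 2 * B * indicator A \<omega>)"
    using i A by (intro integral_mono pw) (auto simp: less_top[symmetric])
  also have "\<dots> = L * (e + (1/2) ^ T) + 2 * B * prob A"
    using A by (simp add: less_top[symmetric] prob_space)
  also have "prob A \<le> (\<Sum>k\<le>T * m. prob (oscillation n m e k))"
    unfolding A_def by (intro finite_measure_subadditive_finite) auto
  also have "\<dots> \<le> real (T * m + 1) * ((48 + 2 * C) / ((real m)\<^sup>2 * e ^ 4))"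
    using sum_bounded_above[of "{..T * m}" "\<lambda>k. prob (oscillation n m e k)", OF prob_oscillation[OF m n vn e]]
    by simp
  finally show ?thesis using \<open>B \<ge> 0\<close> by (simp add: mult_left_mono)
qed

lemma sample_path_path:
  assumes "0 < m"
  shows "sample_path m (path n \<omega>) = increments_path m (\<lambda>k\<in>{..<m * m}. \<Sum>i\<in>block m n k. Z n i \<omega>)"
proof (rule sample_path_eq_increments_path)
  fix k assume "k \<le> m * m"
  then have "(\<Sum>i<k. (\<lambda>k\<in>{..<m * m}. \<Sum>i\<in>block m n k. Z n i \<omega>) i) = (\<Sum>i<k. \<Sum>j\<in>block m n i. Z n j \<omega>)"
    by (intro sum.cong) auto
  then show "path n \<omega> (real k / real m) = (\<Sum>i<k. (\<lambda>k\<in>{..<m * m}. \<Sum>i\<in>block m n k. Z n i \<omega>) i)"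
    using assms by (simp add: path_at_grid sum_blocks)
qed

end

section \<open>Brownian motion on the grid and the passage to the limit\<close>

lemma sample_path_brownian:
  assumes W: "standard_brownian_motion N W" and m: "0 < m" and \<omega>: "\<omega> \<in> space N"
  shows "sample_path m (\<lambda>t\<in>{0..}. W t \<omega>)
    = increments_path m (\<lambda>k\<in>{..<m * m}. W (real (Suc k) / real m) \<omega> - W (real k / real m) \<omega>)"
proof (rule sample_path_eq_increments_path)
  fix k assume "k \<le> m * m"
  then have "(\<Sum>i<k. (\<lambda>k\<in>{..<m * m}. W (real (Suc k) / real m) \<omega> - W (real k / real m) \<omega>) i)
      = (\<Sum>i<k. W (real (Suc i) / real m) \<omega> - W (real i / real m) \<omega>)"
    by (intro sum.cong) auto
  also have "\<dots> = W (real k / real m) \<omega>"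
    using W \<omega> by (subst sum_lessThan_telescope) (simp add: standard_brownian_motion_def)
  finally show "(\<lambda>t\<in>{0..}. W t \<omega>) (real k / real m)
      = (\<Sum>i<k. (\<lambda>k\<in>{..<m * m}. W (real (Suc k) / real m) \<omega> - W (real k / real m) \<omega>) i)"
    by simp
qed

text \<open>Measurability is known only for each \<open>W t\<close>. The sampled paths depend on
  countably many of these and converge to the full path for every sample point, by
  continuity.\<close>

lemma measurable_brownian_path:
  assumes W: "standard_brownian_motion N W"
  shows "(\<lambda>\<omega>. \<lambda>t\<in>{0..}. W t \<omega>) \<in> measurable N (borel_of skorokhod_topology)"
proof (rule skorokhod.measurable_borel_of_limit)
  have Wm: "W t \<in> borel_measurable N" if "0 \<le> t" for t
    using W that by (simp add: standard_brownian_motion_def)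
  show "(\<lambda>\<omega>. sample_path (Suc n) (\<lambda>t\<in>{0..}. W t \<omega>)) \<in> measurable N (borel_of skorokhod_topology)" for n
    unfolding sample_path_def using Wm by (intro measurable_step_path) auto
  fix \<omega> assume "\<omega> \<in> space N"
  then have c: "continuous_on {0..} (\<lambda>t. W t \<omega>)" using W by (simp add: standard_brownian_motion_def)
  then show "(\<lambda>t\<in>{0..}. W t \<omega>) \<in> cadlag_space" by (rule continuous_path_cadlag)
  show "(\<lambda>n. skorokhod_dist (sample_path (Suc n) (\<lambda>t\<in>{0..}. W t \<omega>)) (\<lambda>t\<in>{0..}. W t \<omega>)) \<longlonglongrightarrow> 0"
    using LIMSEQ_Suc[OF sample_path_tendsto[OF c]] .
qed

context walk_array
begin

text \<open>For fixed \<open>m\<close> both expectations integrate the same function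
  \<open>h\<close> of \<open>m * m\<close> independent increments. The blocks contain a fraction of
  about \<open>1 / m\<close> of the \<open>n\<close> steps per unit of time, so their sums tend to a
  normal law of variance \<open>1 / m\<close>, the law of the Brownian increments.\<close>

lemma expectation_sample_path_tendsto:
  assumes W: "standard_brownian_motion N W"
    and g: "\<And>x. x \<in> cadlag_space \<Longrightarrow> \<bar>g x\<bar> \<le> B"
    and lip: "\<And>x y. x \<in> cadlag_space \<Longrightarrow> y \<in> cadlag_space \<Longrightarrow> \<bar>g x - g y\<bar> \<le> L * skorokhod_dist x y"
    and m: "0 < m"
  shows "(\<lambda>n. expectation (\<lambda>\<omega>. g (sample_path m (path n \<omega>)))) \<longlonglongrightarrow> (\<integral>\<omega>. g (sample_path m (\<lambda>t\<in>{0..}. W t \<omega>)) \<partial>N)"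
proof -
  interpret N: prob_space N using W by (simp add: standard_brownian_motion_def)
  define K where "K = m * m"
  have K: "{..<K} \<noteq> {}" using m by (simp add: K_def lessThan_empty_iff)
  define h where "h y = g (increments_path m y)" for y
  have gm: "g \<in> borel_measurable (borel_of skorokhod_topology)"
    using skorokhod.lipschitz_imp_continuous_map[OF lip] by (rule continuous_map_measurable_borel_of)
  have hm: "h \<in> borel_measurable (PiM {..<K} (\<lambda>_. borel))"
    unfolding h_def[abs_def] K_def by (rule measurable_compose[OF measurable_increments_path[OF m] gm])
  have ip: "increments_path m y \<in> cadlag_space" for y using m by (simp add: increments_path_def step_path_cadlag)
  have hc: "(\<lambda>n. h (y n)) \<longlonglongrightarrow> h z" if "\<And>k. k < K \<Longrightarrow> (\<lambda>n. y n k) \<longlonglongrightarrow> z k" for y z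
  proof (rule LIM_zero_cancel, rule Lim_null_comparison)
    show "(\<lambda>n. L * skorokhod_dist (increments_path m (y n)) (increments_path m z)) \<longlonglongrightarrow> 0"
      using that by (intro tendsto_mult_right_zero increments_path_tendsto) (simp add: K_def)
    show "\<forall>\<^sub>F n in sequentially. norm (h (y n) - h z) \<le> L * skorokhod_dist (increments_path m (y n)) (increments_path m z)"
      using lip[OF ip ip] by (simp add: h_def)
  qed
  define \<mu> where "\<mu> n k = distr M borel (\<lambda>\<omega>. \<Sum>i\<in>block m n k. Z n i \<omega>)" for n k
  define \<nu> where "\<nu> = density lborel (normal_density 0 (sqrt (1 / real m)))"
  have \<mu>: "real_distribution (\<mu> n k)" for n k unfolding \<mu>_def by (intro real_distribution_distr) simp
  have \<nu>: "real_distribution \<nu>" unfolding \<nu>_def using m by (intro real_distribution_normal) simp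
  have clt: "weak_conv_m (\<lambda>n. \<mu> n k) \<nu>" for k
    unfolding \<mu>_def[abs_def] \<nu>_def
    using m indep by (intro central_limit_theorem_array[where v = v and C = C] card_block_tendsto mean var fourth v_lim
        integrable_power_of_fourth[OF rv int4]) (auto intro: indep_vars_subset)
  have "(\<lambda>n. \<integral>y. h y \<partial>PiM {..<K} (\<mu> n)) \<longlonglongrightarrow> (\<integral>y. h y \<partial>PiM {..<K} (\<lambda>_. \<nu>))"
    using g[OF ip] by (intro weak_conv_product[where B = B] \<mu> \<nu> clt hm hc) (simp_all add: h_def)
  moreover have "expectation (\<lambda>\<omega>. g (sample_path m (path n \<omega>))) = (\<integral>y. h y \<partial>PiM {..<K} (\<mu> n))" for n
    using expectation_indep_vector[OF K indep_blocks hm]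
    by (simp add: sample_path_path[OF m] h_def K_def \<mu>_def[abs_def])
  moreover have "(\<integral>\<omega>. g (sample_path m (\<lambda>t\<in>{0..}. W t \<omega>)) \<partial>N) = (\<integral>y. h y \<partial>PiM {..<K} (\<lambda>_. \<nu>))"
  proof -
    have "mono_on {..K} (\<lambda>i. real i / real m)" by (intro mono_onI divide_right_mono) auto
    moreover have "\<forall>(K::nat) t. 0 \<le> t 0 \<and> mono_on {..K} t \<longrightarrow>
        N.indep_vars (\<lambda>_. borel) (\<lambda>i \<omega>. W (t (Suc i)) \<omega> - W (t i) \<omega>) {..<K}"
      using W unfolding standard_brownian_motion_def by blast
    ultimately have ind: "N.indep_vars (\<lambda>_. borel) (\<lambda>i \<omega>. W (real (Suc i) / real m) \<omega> - W (real i / real m) \<omega>) {..<K}"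
      by (elim allE[of _ K] allE[of _ "\<lambda>i. real i / real m"]) simp
    have law: "distr N borel (\<lambda>\<omega>. W (real (Suc i) / real m) \<omega> - W (real i / real m) \<omega>) = \<nu>" for i
    proof -
      have "distributed N lborel (\<lambda>\<omega>. W (real (Suc i) / real m) \<omega> - W (real i / real m) \<omega>)
          (normal_density 0 (sqrt (real (Suc i) / real m - real i / real m)))"
        using W m unfolding standard_brownian_motion_def by (simp add: divide_strict_right_mono)
      moreover have "real (Suc i) / real m - real i / real m = 1 / real m" by (simp flip: diff_divide_distrib)
      ultimately have "distr N lborel (\<lambda>\<omega>. W (real (Suc i) / real m) \<omega> - W (real i / real m) \<omega>) = \<nu>"
        by (simp add: distributed_def \<nu>_def)
      \<comment> \<open>\<open>borel\<close> and \<open>lborel\<close> have the same sets, so the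
        two image measures coincide.\<close>
      then show ?thesis by (simp cong: distr_cong)
    qed
    have "(\<integral>\<omega>. g (sample_path m (\<lambda>t\<in>{0..}. W t \<omega>)) \<partial>N)
        = (\<integral>\<omega>. h (\<lambda>k\<in>{..<K}. W (real (Suc k) / real m) \<omega> - W (real k / real m) \<omega>) \<partial>N)"
      by (intro Bochner_Integration.integral_cong) (auto simp: sample_path_brownian[OF W m] h_def K_def)
    also have "\<dots> = (\<integral>y. h y \<partial>PiM {..<K} (\<lambda>_. \<nu>))"
      using N.expectation_indep_vector[OF K ind hm] by (simp only: law)
    finally show ?thesis .
  qed
  ultimately show ?thesis by simp
qed

text \<open>The parameters are fixed in the order \<open>e\<close>, \<open>T\<close>,
  \<open>m\<close>, and \<open>n\<close> comes last. Of the five parts of \<open>r\<close>, one pays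
  for sampling the Brownian path, two for the Lipschitz term with \<open>e\<close> and
  \<open>(1/2) ^ T\<close>, one for the oscillating cells, and one for the limit in \<open>n\<close>
  at fixed \<open>m\<close>.\<close>

theorem donsker:
  assumes W: "standard_brownian_motion N W"
    and g: "\<And>x. x \<in> cadlag_space \<Longrightarrow> \<bar>g x\<bar> \<le> B" and L: "0 \<le> L"
    and lip: "\<And>x y. x \<in> cadlag_space \<Longrightarrow> y \<in> cadlag_space \<Longrightarrow> \<bar>g x - g y\<bar> \<le> L * skorokhod_dist x y"
  shows "(\<lambda>n. expectation (\<lambda>\<omega>. g (path n \<omega>))) \<longlonglongrightarrow> (\<integral>\<omega>. g (\<lambda>t\<in>{0..}. W t \<omega>) \<partial>N)"
proof (rule LIMSEQ_I)
  fix r :: real assume r: "0 < r"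
  interpret N: prob_space N using W by (simp add: standard_brownian_motion_def)
  let ?w = "\<lambda>\<omega>. \<lambda>t\<in>{0..}. W t \<omega>"
  have gm: "g \<in> borel_measurable (borel_of skorokhod_topology)"
    using skorokhod.lipschitz_imp_continuous_map[OF lip] by (rule continuous_map_measurable_borel_of)
  have wm: "(\<lambda>\<omega>. g (?w \<omega>)) \<in> borel_measurable N"
    by (rule measurable_compose[OF measurable_brownian_path[OF W] gm])
  have Wm: "W t \<in> borel_measurable N" if "0 \<le> t" for t
    using W that by (simp add: standard_brownian_motion_def)
  have wc: "?w \<omega> \<in> cadlag_space" "(\<lambda>m. skorokhod_dist (sample_path m (?w \<omega>)) (?w \<omega>)) \<longlonglongrightarrow> 0"
    if "\<omega> \<in> space N" for \<omega>
    using W that continuous_path_cadlag sample_path_tendsto by (auto simp: standard_brownian_motion_def)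
  have sc: "sample_path (Suc m) x \<in> cadlag_space" for m x by (simp add: sample_path_def step_path_cadlag)
  have "(\<lambda>m. \<integral>\<omega>. g (sample_path (Suc m) (?w \<omega>)) \<partial>N) \<longlonglongrightarrow> (\<integral>\<omega>. g (?w \<omega>) \<partial>N)"
  proof (rule integral_dominated_convergence[where w = "\<lambda>_. B"])
    show "(\<lambda>\<omega>. g (?w \<omega>)) \<in> borel_measurable N" by (rule wm)
    show "(\<lambda>\<omega>. g (sample_path (Suc m) (?w \<omega>))) \<in> borel_measurable N" for m
      unfolding sample_path_def using Wm by (intro measurable_compose[OF measurable_step_path gm]) auto
    show "AE \<omega> in N. (\<lambda>m. g (sample_path (Suc m) (?w \<omega>))) \<longlonglongrightarrow> g (?w \<omega>)"
    proof (rule AE_I2, rule LIM_zero_cancel, rule Lim_null_comparison)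
      fix \<omega> assume \<omega>: "\<omega> \<in> space N"
      show "\<forall>\<^sub>F m in sequentially. norm (g (sample_path (Suc m) (?w \<omega>)) - g (?w \<omega>))
          \<le> L * skorokhod_dist (sample_path (Suc m) (?w \<omega>)) (?w \<omega>)"
        using lip[OF sc wc(1)[OF \<omega>]] by simp
      show "(\<lambda>m. L * skorokhod_dist (sample_path (Suc m) (?w \<omega>)) (?w \<omega>)) \<longlonglongrightarrow> 0"
        by (intro tendsto_mult_right_zero LIMSEQ_Suc[OF wc(2)[OF \<omega>]])
    qed
    show "AE \<omega> in N. norm (g (sample_path (Suc m) (?w \<omega>))) \<le> B" for m using g[OF sc] by simp
  qed simp
  then have E1: "\<forall>\<^sub>F m in sequentially. dist (\<integral>\<omega>. g (sample_path (Suc m) (?w \<omega>)) \<partial>N) (\<integral>\<omega>. g (?w \<omega>) \<partial>N) < r / 5"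
    using r by (intro tendstoD) auto
  \<comment> \<open>\<open>L + 1\<close> in place of \<open>L\<close> covers the case
    \<open>L = 0\<close>.\<close>
  define e where "e = r / (5 * (L + 1))"
  have e: "0 < e" using r L by (simp add: e_def)
  have Le: "L * e < r / 5" using r L by (simp add: e_def field_simps)
  obtain T where T: "(1/2::real) ^ T < e" using real_arch_pow_inv[of e "1/2"] e by auto
  have LT: "L * (e + (1/2) ^ T) \<le> r / 5 + r / 5"
    using mult_left_mono[OF less_imp_le[OF T] L] Le by (simp add: distrib_left)
  \<comment> \<open>Since \<open>(T * m + 1) / m^2 = T / m + 1 / m^2\<close>, the term for the
    oscillating cells is \<open>?c\<close> times a null sequence in \<open>m\<close>, once
    \<open>T\<close> and \<open>e\<close> are fixed.\<close>
  let ?c = "2 * B * (48 + 2 * C) / e ^ 4"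
  have "(\<lambda>m. ?c * (real T * (1 / real (Suc m)) + 1 / real (Suc m) * (1 / real (Suc m)))) \<longlonglongrightarrow> ?c * (real T * 0 + 0 * 0)"
    by (intro tendsto_intros LIMSEQ_Suc[OF lim_1_over_n])
  then have E2: "\<forall>\<^sub>F m in sequentially. ?c * (real T * (1 / real (Suc m)) + 1 / real (Suc m) * (1 / real (Suc m))) < r / 5"
    using r by (intro order_tendstoD(2)) auto
  from eventually_conj[OF eventually_conj[OF E1 E2] eventually_ge_at_top[of T]]
  obtain m' where m': "dist (\<integral>\<omega>. g (sample_path (Suc m') (?w \<omega>)) \<partial>N) (\<integral>\<omega>. g (?w \<omega>) \<partial>N) < r / 5"
    "?c * (real T * (1 / real (Suc m')) + 1 / real (Suc m') * (1 / real (Suc m'))) < r / 5" "T \<le> m'"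
    by (auto simp: eventually_sequentially)
  define m where "m = Suc m'"
  have m: "0 < m" "T \<le> m" using m' by (auto simp: m_def)
  have c: "2 * B * (real (T * m + 1) * ((48 + 2 * C) / ((real m)\<^sup>2 * e ^ 4))) < r / 5"
  proof -
    have "2 * B * (real (T * m + 1) * ((48 + 2 * C) / ((real m)\<^sup>2 * e ^ 4)))
        = ?c * (real T * (1 / real m) + 1 / real m * (1 / real m))"
      using m(1) by (simp add: field_simps power2_eq_square)
    then show ?thesis using m'(2) by (simp only: m_def)
  qed
  have "\<forall>\<^sub>F n in sequentially. dist (expectation (\<lambda>\<omega>. g (sample_path m (path n \<omega>)))) (\<integral>\<omega>. g (sample_path m (?w \<omega>)) \<partial>N) < r / 5"
    using expectation_sample_path_tendsto[OF W g lip m(1)] r by (intro tendstoD) auto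
  moreover have "\<forall>\<^sub>F n in sequentially. real n * v n < 2"
    using v_lim by (rule order_tendstoD(2)) simp
  ultimately have "\<forall>\<^sub>F n in sequentially. norm (expectation (\<lambda>\<omega>. g (path n \<omega>)) - (\<integral>\<omega>. g (?w \<omega>) \<partial>N)) < r"
    using eventually_ge_at_top[of m]
  proof eventually_elim
    case (elim n)
    have "\<bar>expectation (\<lambda>\<omega>. g (sample_path m (path n \<omega>))) - expectation (\<lambda>\<omega>. g (path n \<omega>))\<bar>
        \<le> L * (e + (1/2) ^ T) + 2 * B * (real (T * m + 1) * ((48 + 2 * C) / ((real m)\<^sup>2 * e ^ 4)))"
      using elim by (intro expectation_sample_path_close g L lip m e) auto
    then show ?case using elim(1) m'(1) LT c unfolding m_def[symmetric] dist_real_def real_norm_def by linarith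
  qed
  then show "\<exists>no. \<forall>n\<ge>no. norm (expectation (\<lambda>\<omega>. g (path n \<omega>)) - (\<integral>\<omega>. g (?w \<omega>) \<partial>N)) < r"
    by (simp add: eventually_sequentially)
qed

end

section \<open>The eigenvalues as random walks\<close>

text \<open>The indices \<open>j\<close> and \<open>n - j\<close> pick the same \<open>S i\<close>,
  so their cosines are collected. For \<open>i > n / 2\<close> no index contributes and the
  coefficient is 0, which permits sums over all \<open>i \<le> n\<close>.\<close>

definition circulant_coeff :: "nat \<Rightarrow> nat \<Rightarrow> nat \<Rightarrow> real" where
  "circulant_coeff n r i =
     (1 / real n) * (\<Sum>j | j < n \<and> min j (n - j) = i. cos (2 * pi * real r * real j / real n))"

lemma fourier_eigenvalue_coeff:
  "fourier_eigenvalue n s r = (\<Sum>i\<le>n. circulant_coeff n r i * s i)"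
proof -
  let ?c = "\<lambda>j. cos (2 * pi * real r * real j / real n)"
  have "(\<Sum>j<n. s (min j (n - j)) * ?c j)
      = (\<Sum>i\<le>n. \<Sum>j\<in>{j \<in> {..<n}. min j (n - j) = i}. s (min j (n - j)) * ?c j)"
    by (rule sum.group[symmetric]) auto
  also have "\<dots> = (\<Sum>i\<le>n. (\<Sum>j | j < n \<and> min j (n - j) = i. ?c j) * s i)"
    unfolding sum_distrib_right by (intro sum.cong) auto
  finally show ?thesis
    unfolding fourier_eigenvalue_def circulant_coeff_def
    by (simp only:) (subst sum_distrib_left, simp only: mult.assoc)
qed

lemma circulant_fibre_subset: "{j. j < n \<and> min j (n - j) = i} \<subseteq> {i, n - i :: nat}"
  by (auto simp: min_def split: if_splits)

lemma card_circulant_fibre_le: "card {j. j < n \<and> min j (n - j) = (i::nat)} \<le> 2"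
proof -
  have "card {j. j < n \<and> min j (n - j) = i} \<le> card {i, n - i}"
    by (rule card_mono[OF _ circulant_fibre_subset]) simp
  also have "\<dots> \<le> 2" by (simp add: card_insert_if)
  finally show ?thesis .
qed

lemma abs_circulant_coeff_le: "\<bar>circulant_coeff n r i\<bar> \<le> 2 / real n"
proof -
  let ?F = "{j. j < n \<and> min j (n - j) = i}"
  have "\<bar>\<Sum>j\<in>?F. cos (2 * pi * real r * real j / real n)\<bar> \<le> (\<Sum>j\<in>?F. 1)"
    by (intro order_trans[OF sum_abs] sum_mono) simp
  also have "\<dots> \<le> 2" using card_circulant_fibre_le[of n i] by simp
  finally show ?thesis
    by (cases "n = 0") (simp_all add: circulant_coeff_def abs_mult divide_right_mono)
qed

text \<open>The real part of a geometric sum over the powers of an \<open>n\<close>-th root of unity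
  \<open>z\<close>; \<open>z \<noteq> 1\<close> is what the condition on \<open>r\<close>
  says.\<close>

lemma sum_cos_double:
  assumes n: "0 < n" and r: "\<not> n dvd 2 * r"
  shows "(\<Sum>j<n. cos (2 * (2 * pi * real r * real j / real n))) = 0"
proof -
  define z where "z = cis (2 * pi * real (2 * r) / real n)"
  have z: "z = exp (2 * of_real pi * \<i> * of_nat (2 * r) / of_nat n)"
    by (simp add: z_def cis_conv_exp mult_ac)
  have "z \<noteq> 1"
    using complex_root_unity_eq[of n "2 * r" 0] n r unfolding z by (simp add: dvd_eq_mod_eq_0)
  moreover have "z ^ n = 1"
  proof -
    have "real n * (2 * pi * real (2 * r) / real n) = 2 * pi * real (2 * r)" using n by simp
    then show ?thesis unfolding z_def Complex.DeMoivre
      using cos_int_2pin[of "int (2 * r)"] sin_int_2pin[of "int (2 * r)"] by (simp add: complex_eq_iff)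
  qed
  ultimately have "(\<Sum>j<n. z ^ j) = 0" by (simp add: geometric_sum)
  then have "(\<Sum>j<n. Re (z ^ j)) = 0" by (metis Re_sum zero_complex.sel(1))
  moreover have "Re (z ^ j) = cos (2 * (2 * pi * real r * real j / real n))" for j
  proof -
    have "real j * (2 * pi * real (2 * r) / real n) = 2 * (2 * pi * real r * real j / real n)" by simp
    then show ?thesis unfolding z_def Complex.DeMoivre by (simp only: cis.sel)
  qed
  ultimately show ?thesis by simp
qed

text \<open>Since \<open>cos (2 \<pi> r j / n)\<close> takes the same value at \<open>j\<close> and \<open>n - j\<close>, the squared coefficients
  sum to \<open>n\<^sup>-\<^sup>2\<close> times \<open>2 \<Sum>\<^sub>j cos\<^sup>2 (2 \<pi> r j / n)\<close>, up to the terms \<open>j = 0\<close> and \<open>j = n/2\<close>, whose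
  fibres have one element instead of two.\<close>

lemma sum_circulant_coeff_squares:
  assumes n: "0 < n" and r: "\<not> n dvd 2 * r"
  shows "\<bar>real n * (\<Sum>i\<le>n. (circulant_coeff n r i)\<^sup>2) - 1\<bar> \<le> 2 / real n"
proof -
  define c where "c j = cos (2 * pi * real r * real j / real n)" for j
  define F where "F i = {j. j < n \<and> min j (n - j) = i}" for i
  have finF: "finite (F i)" for i by (simp add: F_def)
  have c_sym: "c (n - j) = c j" if "j \<le> n" for j
  proof -
    have "2 * pi * real r * real (n - j) / real n = 2 * pi * real r - 2 * pi * real r * real j / real n"
      using that n by (simp add: of_nat_diff field_simps)
    then show ?thesis
      using cos_int_2pin[of "int r"] sin_int_2pin[of "int r"] by (simp add: c_def cos_diff)
  qed
  have cF: "c j = c i" if "j \<in> F i" for i j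
    using that c_sym[of j] by (auto simp: F_def min_def split: if_splits)
  have cardF: "real (card (F (min j (n - j)))) = 2 - of_bool (j = 0 \<or> 2 * j = n)" if "j < n" for j
  proof (cases "j = 0 \<or> 2 * j = n")
    case True
    then have "F (min j (n - j)) = {j}" using that by (auto simp: F_def min_def split: if_splits)
    then show ?thesis using True by simp
  next
    case False
    then have "F (min j (n - j)) = {j, n - j}" using that by (auto simp: F_def min_def split: if_splits)
    moreover have "j \<noteq> n - j" using False that by auto
    ultimately show ?thesis using False by simp
  qed
  \<comment> \<open>The cosine is constant on a fibre, so the square of the fibre sum equals the sum
    over the fibre of the squared cosine weighted by the size of the fibre. This turns the double
    sum into a single sum over \<open>j\<close>.\<close>
  have "(\<Sum>i\<le>n. (\<Sum>j\<in>F i. c j)\<^sup>2) = (\<Sum>i\<le>n. \<Sum>j\<in>F i. real (card (F (min j (n - j)))) * (c j)\<^sup>2)"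
  proof (rule sum.cong[OF refl])
    fix i
    have "(\<Sum>j\<in>F i. c j) = real (card (F i)) * c i" using cF by simp
    moreover have "(\<Sum>j\<in>F i. real (card (F (min j (n - j)))) * (c j)\<^sup>2) = (\<Sum>j\<in>F i. real (card (F i)) * (c i)\<^sup>2)"
      using cF by (intro sum.cong) (auto simp: F_def)
    ultimately show "(\<Sum>j\<in>F i. c j)\<^sup>2 = (\<Sum>j\<in>F i. real (card (F (min j (n - j)))) * (c j)\<^sup>2)"
      by (simp add: power_mult_distrib power2_eq_square)
  qed
  also have "\<dots> = (\<Sum>j<n. real (card (F (min j (n - j)))) * (c j)\<^sup>2)"
  proof -
    have "F i = {j \<in> {..<n}. min j (n - j) = i}" for i by (auto simp: F_def)
    then show ?thesis by (simp only:) (rule sum.group, auto)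
  qed
  also have "\<dots> = (\<Sum>j<n. 2 * (c j)\<^sup>2 - of_bool (j = 0 \<or> 2 * j = n) * (c j)\<^sup>2)"
    using cardF by (intro sum.cong) (auto simp: left_diff_distrib)
  also have "\<dots> = (\<Sum>j<n. 1 + cos (2 * (2 * pi * real r * real j / real n)))
      - (\<Sum>j<n. of_bool (j = 0 \<or> 2 * j = n) * (c j)\<^sup>2)"
    unfolding sum_subtractf c_def cos_double_cos by (simp add: algebra_simps)
  also have "\<dots> = real n - (\<Sum>j<n. of_bool (j = 0 \<or> 2 * j = n) * (c j)\<^sup>2)"
    using sum_cos_double[OF n r] by (simp add: sum.distrib)
  finally have sq: "(\<Sum>i\<le>n. (\<Sum>j\<in>F i. c j)\<^sup>2) = real n - (\<Sum>j<n. of_bool (j = 0 \<or> 2 * j = n) * (c j)\<^sup>2)" (is "_ = _ - ?E") .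
  have E: "0 \<le> ?E" "?E \<le> 2"
  proof -
    show "0 \<le> ?E" by (intro sum_nonneg) auto
    have "?E \<le> (\<Sum>j<n. of_bool (j = 0 \<or> 2 * j = n))"
      by (intro sum_mono) (auto simp: c_def abs_square_le_1)
    also have "\<dots> = real (card {j \<in> {..<n}. j = 0 \<or> 2 * j = n})"
      by (simp add: of_bool_def sum.If_cases Int_def flip: sum.inter_filter)
    also have "\<dots> \<le> real (card {0, n div 2})"
      by (intro of_nat_mono card_mono) auto
    also have "\<dots> \<le> 2" by (simp add: card_insert_if)
    finally show "?E \<le> 2" .
  qed
  have "real n * (\<Sum>i\<le>n. (circulant_coeff n r i)\<^sup>2) = (\<Sum>i\<le>n. (\<Sum>j\<in>F i. c j)\<^sup>2) / real n"
    using n by (simp add: circulant_coeff_def c_def[symmetric] F_def[symmetric] power_divide power2_eq_square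
        flip: sum_divide_distrib)
  also have "\<dots> = 1 - ?E / real n" unfolding sq using n by (simp add: diff_divide_distrib)
  finally show ?thesis using E n by (simp add: divide_right_mono)
qed

text \<open>For \<open>1 \<le> r \<le> n\<close> a multiple of \<open>n\<close> of the form
  \<open>2 * r\<close> can only be \<open>n\<close> or \<open>2 * n\<close>.\<close>

lemma card_bad_frequencies: "card {r \<in> {1..n::nat}. n dvd 2 * r} \<le> 2"
proof -
  have "{r \<in> {1..n}. n dvd 2 * r} \<subseteq> {n div 2, n}"
  proof
    fix r assume "r \<in> {r \<in> {1..n}. n dvd 2 * r}"
    then obtain q where q: "2 * r = n * q" "1 \<le> r" "r \<le> n" by (auto elim: dvdE)
    have "n * q \<le> n * 2" "0 < n" using q by linarith+
    then have "q \<le> 2" by simp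
    moreover have "q \<noteq> 0" by (rule notI) (use q in simp)
    ultimately have "q = 1 \<or> q = 2" by linarith
    then show "r \<in> {n div 2, n}" using q by auto
  qed
  then have "card {r \<in> {1..n}. n dvd 2 * r} \<le> card {n div 2, n}" by (intro card_mono) auto
  also have "\<dots> \<le> 2" by (simp add: card_insert_if)
  finally show ?thesis .
qed

lemma (in prob_space) abs_expectation_le:
  fixes f :: "'a \<Rightarrow> real"
  assumes f: "\<And>\<omega>. \<omega> \<in> space M \<Longrightarrow> \<bar>f \<omega>\<bar> \<le> B"
  shows "\<bar>expectation f\<bar> \<le> B"
proof (cases "integrable M f")
  case True
  have "\<bar>expectation f\<bar> \<le> expectation (\<lambda>\<omega>. \<bar>f \<omega>\<bar>)" by (rule integral_abs_bound)
  also have "\<dots> \<le> expectation (\<lambda>\<omega>. B)" using True f by (intro integral_mono) auto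
  finally show ?thesis by (simp add: prob_space)
next
  \<comment> \<open>The integral of a nonintegrable function is 0 by convention, and
    \<open>B \<ge> 0\<close> because a probability space has a point.\<close>
  case False
  obtain \<omega> where "\<omega> \<in> space M" using not_empty by blast
  then have "0 \<le> B" using f abs_ge_zero order_trans by blast
  then show ?thesis using False by (simp add: not_integrable_integral_eq)
qed

section \<open>The input variables and the steps of the eigenvalue walks\<close>

locale circulant_input = prob_space M for M :: "'a measure" +
  fixes X :: "nat \<Rightarrow> nat \<Rightarrow> 'a \<Rightarrow> real" and C :: real
  assumes indep: "indep_vars (\<lambda>_. borel) (\<lambda>(i, k). X i k) {(i, k). k \<ge> 1}"
    and mean: "\<And>i k. k \<ge> 1 \<Longrightarrow> expectation (X i k) = 0"
    and var: "\<And>i k. k \<ge> 1 \<Longrightarrow> expectation (\<lambda>\<omega>. (X i k \<omega>)\<^sup>2) = 1"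
    and int4: "\<And>i k. k \<ge> 1 \<Longrightarrow> integrable M (\<lambda>\<omega>. X i k \<omega> ^ 4)"
    and fourth: "\<And>i k. k \<ge> 1 \<Longrightarrow> expectation (\<lambda>\<omega>. X i k \<omega> ^ 4) \<le> C"
begin

lemma rv [measurable]: "X i (Suc k) \<in> borel_measurable M"
  using bspec[OF conjunct1[OF indep[unfolded indep_vars_def2]], of "(i, Suc k)"] by simp

lemma C_nonneg: "0 \<le> C"
proof -
  have "0 \<le> expectation (\<lambda>\<omega>. X 0 1 \<omega> ^ 4)" by (rule Bochner_Integration.integral_nonneg) simp
  then show ?thesis using order_trans fourth[of 1 0] by blast
qed

text \<open>Walk steps are numbered from 0 and the variables \<open>X i k\<close> from
  \<open>k = 1\<close>, hence the \<open>Suc k\<close>.\<close>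

definition walk_step :: "nat \<Rightarrow> nat \<Rightarrow> nat \<Rightarrow> 'a \<Rightarrow> real" where
  "walk_step n r k \<omega> = (\<Sum>i\<le>n. circulant_coeff n r i * X i (Suc k) \<omega>)"

lemma measurable_walk_step [measurable]: "walk_step n r k \<in> borel_measurable M"
  unfolding walk_step_def[abs_def] by measurable

lemma indep_walk_steps: "indep_vars (\<lambda>_. borel) (walk_step n r) UNIV"
proof -
  have "disjoint_family_on (\<lambda>k. {..n} \<times> {Suc k}) UNIV" by (auto simp: disjoint_family_on_def)
  from indep_vars_restrict[OF indep _ this]
  have "indep_vars (\<lambda>k. PiM ({..n} \<times> {Suc k}) (\<lambda>_. borel))
      (\<lambda>k \<omega>. \<lambda>p\<in>{..n} \<times> {Suc k}. (case p of (i, k) \<Rightarrow> X i k) \<omega>) UNIV" by auto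
  from indep_vars_compose2[OF this, of "\<lambda>k f. \<Sum>i\<le>n. circulant_coeff n r i * f (i, Suc k)" "\<lambda>_. borel"]
  have "indep_vars (\<lambda>_. borel) (\<lambda>k \<omega>. \<Sum>i\<le>n. circulant_coeff n r i *
      (\<lambda>p\<in>{..n} \<times> {Suc k}. (case p of (i, k) \<Rightarrow> X i k) \<omega>) (i, Suc k)) UNIV"
    by (auto intro!: borel_measurable_sum borel_measurable_times measurable_component_singleton)
  moreover have "(\<lambda>k \<omega>. \<Sum>i\<le>n. circulant_coeff n r i *
      (\<lambda>p\<in>{..n} \<times> {Suc k}. (case p of (i, k) \<Rightarrow> X i k) \<omega>) (i, Suc k)) = walk_step n r"
    by (intro ext) (auto simp: walk_step_def intro!: sum.cong)
  ultimately show ?thesis by simp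
qed

text \<open>Coefficients are at most \<open>2 / n\<close> in absolute value and there are
  \<open>n + 1 \<le> 2 * n\<close> of them, so their squares sum to at most \<open>8 / n\<close>,
  and \<open>3 * (8 / n)^2 = 192 / n^2\<close>. The fourth moments add at most
  \<open>16 * C / n^4\<close> per term; counting the terms generously as \<open>2 * n^2\<close>
  brings this to the same order \<open>1 / n^2\<close>.\<close>

lemma walk_step_moments:
  shows "expectation (walk_step n r k) = 0"
    and "integrable M (\<lambda>\<omega>. walk_step n r k \<omega> ^ 4)"
    and "expectation (\<lambda>\<omega>. (walk_step n r k \<omega>)\<^sup>2) = (\<Sum>i\<le>n. (circulant_coeff n r i)\<^sup>2)"
    and "expectation (\<lambda>\<omega>. walk_step n r k \<omega> ^ 4) \<le> (192 + 32 * C) / (real n)\<^sup>2"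
proof -
  let ?a = "circulant_coeff n r"
  have "disjoint_family_on (\<lambda>i. {(i, Suc k)}) {..n}" by (auto simp: disjoint_family_on_def)
  from indep_vars_restrict[OF indep _ this]
  have "indep_vars (\<lambda>i. PiM {(i, Suc k)} (\<lambda>_. borel))
      (\<lambda>i \<omega>. \<lambda>p\<in>{(i, Suc k)}. (case p of (i, k) \<Rightarrow> X i k) \<omega>) {..n}" by auto
  from indep_vars_compose2[OF this, of "\<lambda>i f. ?a i * f (i, Suc k)" "\<lambda>_. borel"]
  have ind: "indep_vars (\<lambda>_. borel) (\<lambda>i \<omega>. ?a i * X i (Suc k) \<omega>) {..n}"
    by (simp add: borel_measurable_times measurable_component_singleton)
  have iX: "integrable M (X i (Suc k))" for i
    using integrable_power_of_fourth[OF rv int4[of "Suc k" i], of 1] by simp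
  have m: "expectation (\<lambda>\<omega>. ?a i * X i (Suc k) \<omega>) = 0" for i using mean[of "Suc k" i] by simp
  have i4: "integrable M (\<lambda>\<omega>. (?a i * X i (Suc k) \<omega>) ^ 4)" for i
    using int4[of "Suc k" i] by (simp add: power_mult_distrib)
  have v: "expectation (\<lambda>\<omega>. (?a i * X i (Suc k) \<omega>)\<^sup>2) = (?a i)\<^sup>2" for i
    using var[of "Suc k" i] by (simp add: power_mult_distrib)
  note sums = indep_sum_moments[OF _ ind m i4, folded walk_step_def, simplified]
  show "expectation (walk_step n r k) = 0" using sums(2) by (simp add: walk_step_def[abs_def])
  show "integrable M (\<lambda>\<omega>. walk_step n r k \<omega> ^ 4)" using sums(1) .
  show "expectation (\<lambda>\<omega>. (walk_step n r k \<omega>)\<^sup>2) = (\<Sum>i\<le>n. (?a i)\<^sup>2)"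
    using sums(3) unfolding v .
  show "expectation (\<lambda>\<omega>. walk_step n r k \<omega> ^ 4) \<le> (192 + 32 * C) / (real n)\<^sup>2"
  proof (cases "n = 0")
    \<comment> \<open>Division by zero makes all coefficients vanish at \<open>n = 0\<close>, and
      the bound is 0 as well.\<close>
    case True
    then show ?thesis by (simp add: walk_step_def circulant_coeff_def)
  next
    case False
    then have n: "0 < real n" "1 \<le> real n" by auto
    have a2: "(?a i)\<^sup>2 \<le> 4 / (real n)\<^sup>2" for i
      using power_mono[OF abs_circulant_coeff_le[of n r i] abs_ge_zero, of 2] by (simp add: power_divide)
    have a4: "?a i ^ 4 \<le> 16 / real n ^ 4" for i
      using power_mono[OF abs_circulant_coeff_le[of n r i] abs_ge_zero, of 4] by (simp add: power_divide)
    have S2: "(\<Sum>i\<le>n. (?a i)\<^sup>2) \<le> 8 / real n"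
    proof -
      have "(\<Sum>i\<le>n. (?a i)\<^sup>2) \<le> real (n + 1) * (4 / (real n)\<^sup>2)"
        using sum_bounded_above[of "{..n}" "\<lambda>i. (?a i)\<^sup>2", OF a2] by simp
      also have "\<dots> \<le> (2 * real n) * (4 / (real n)\<^sup>2)" using n by (intro mult_right_mono) auto
      also have "\<dots> = 8 / real n" using n by (simp add: power2_eq_square)
      finally show ?thesis .
    qed
    have e4: "expectation (\<lambda>\<omega>. (?a i * X i (Suc k) \<omega>) ^ 4) \<le> 16 * C / real n ^ 4" for i
    proof -
      have "expectation (\<lambda>\<omega>. (?a i * X i (Suc k) \<omega>) ^ 4) = ?a i ^ 4 * expectation (\<lambda>\<omega>. X i (Suc k) \<omega> ^ 4)"
        by (simp add: power_mult_distrib)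
      also have "\<dots> \<le> 16 / real n ^ 4 * C"
        using fourth[of "Suc k" i] a4[of i] by (intro mult_mono Bochner_Integration.integral_nonneg) auto
      finally show ?thesis by simp
    qed
    have S4: "(\<Sum>i\<le>n. expectation (\<lambda>\<omega>. (?a i * X i (Suc k) \<omega>) ^ 4)) \<le> 32 * C / (real n)\<^sup>2"
    proof -
      have "(\<Sum>i\<le>n. expectation (\<lambda>\<omega>. (?a i * X i (Suc k) \<omega>) ^ 4)) \<le> real (n + 1) * (16 * C / real n ^ 4)"
        using sum_bounded_above[of "{..n}" "\<lambda>i. expectation (\<lambda>\<omega>. (?a i * X i (Suc k) \<omega>) ^ 4)", OF e4] by simp
      also have "\<dots> \<le> (2 * (real n)\<^sup>2) * (16 * C / real n ^ 4)"
      proof (intro mult_right_mono)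
        have "real n * 1 \<le> real n * real n" using n by (intro mult_left_mono) auto
        then show "real (n + 1) \<le> 2 * (real n)\<^sup>2" using n unfolding power2_eq_square by linarith
        show "0 \<le> 16 * C / real n ^ 4" using C_nonneg by simp
      qed
      also have "\<dots> = 32 * C / (real n)\<^sup>2" using n by (simp add: power2_eq_square power4_eq_xxxx)
      finally show ?thesis .
    qed
    have "expectation (\<lambda>\<omega>. walk_step n r k \<omega> ^ 4)
        \<le> 3 * (\<Sum>i\<le>n. (?a i)\<^sup>2)\<^sup>2 + (\<Sum>i\<le>n. expectation (\<lambda>\<omega>. (?a i * X i (Suc k) \<omega>) ^ 4))"
      using sums(4) unfolding v .
    also have "\<dots> \<le> 3 * (8 / real n)\<^sup>2 + 32 * C / (real n)\<^sup>2"
      using S2 S4 by (intro add_mono mult_left_mono power_mono sum_nonneg) auto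
    also have "\<dots> = (192 + 32 * C) / (real n)\<^sup>2" by (simp add: power_divide add_divide_distrib)
    finally show ?thesis .
  qed
qed

text \<open>For \<open>n = 1\<close> and \<open>n = 2\<close> every frequency is exceptional, so the
  condition starts at 3. It serves only the limit of the variances; the moment bounds hold for every
  frequency.\<close>

lemma walk_array_eigenvalues:
  assumes "\<And>n. n \<ge> 3 \<Longrightarrow> \<not> n dvd 2 * \<rho> n"
  shows "walk_array M (\<lambda>n. walk_step n (\<rho> n)) (\<lambda>n. \<Sum>i\<le>n. (circulant_coeff n (\<rho> n) i)\<^sup>2) (192 + 32 * C)"
proof unfold_locales
  show "(\<lambda>n. real n * (\<Sum>i\<le>n. (circulant_coeff n (\<rho> n) i)\<^sup>2)) \<longlonglongrightarrow> 1"
  proof (rule LIM_zero_cancel, rule Lim_null_comparison)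
    show "\<forall>\<^sub>F n in sequentially. norm (real n * (\<Sum>i\<le>n. (circulant_coeff n (\<rho> n) i)\<^sup>2) - 1) \<le> 2 * (1 / real n)"
      using eventually_ge_at_top[of 3]
    proof eventually_elim
      case (elim n)
      then show ?case using sum_circulant_coeff_squares[of n "\<rho> n"] assms[of n] by simp
    qed
    show "(\<lambda>n. 2 * (1 / real n)) \<longlonglongrightarrow> 0" by (intro tendsto_mult_right_zero lim_1_over_n)
  qed
qed (simp_all add: indep_walk_steps walk_step_moments)

definition eigenvalue_path :: "nat \<Rightarrow> nat \<Rightarrow> 'a \<Rightarrow> real \<Rightarrow> real" where
  "eigenvalue_path n r \<omega> = step_path n (\<lambda>j. \<Sum>k<j. walk_step n r k \<omega>)"

lemma eigenvalue_path_eq: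
  "eigenvalue_path n r \<omega> = (\<lambda>t\<in>{0..}. fourier_eigenvalue n (\<lambda>i. partial_sum X n i t \<omega>) r)"
proof -
  have "fourier_eigenvalue n (\<lambda>i. partial_sum X n i t \<omega>) r = (\<Sum>k<nat \<lfloor>real n * t\<rfloor>. walk_step n r k \<omega>)" for t
  proof -
    have ps: "partial_sum X n i t \<omega> = (\<Sum>k<nat \<lfloor>real n * t\<rfloor>. X i (Suc k) \<omega>)" for i
      unfolding partial_sum_def by (simp add: sum.atLeast1_atMost_eq)
    show ?thesis
      unfolding fourier_eigenvalue_coeff walk_step_def ps sum_distrib_left by (rule sum.swap)
  qed
  then show ?thesis by (auto simp: eigenvalue_path_def step_path_def)
qed

lemma measurable_eigenvalue_path:
  "0 < n \<Longrightarrow> eigenvalue_path n r \<in> measurable M (borel_of skorokhod_topology)"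
  unfolding eigenvalue_path_def[abs_def] by (intro measurable_step_path) auto

lemma eigenvalue_path_cadlag: "0 < n \<Longrightarrow> eigenvalue_path n r \<omega> \<in> cadlag_space"
  unfolding eigenvalue_path_def by (rule step_path_cadlag)

context
  fixes N :: "'b measure" and W :: "real \<Rightarrow> 'b \<Rightarrow> real" and g :: "(real \<Rightarrow> real) \<Rightarrow> real" and B L :: real
  assumes W: "standard_brownian_motion N W"
    and g: "\<And>x. x \<in> cadlag_space \<Longrightarrow> \<bar>g x\<bar> \<le> B" and L: "0 \<le> L"
    and lip: "\<And>x y. x \<in> cadlag_space \<Longrightarrow> y \<in> cadlag_space \<Longrightarrow> \<bar>g x - g y\<bar> \<le> L * skorokhod_dist x y"
begin

text \<open>Donsker's theorem applies to any choice of frequencies, in particular to the worst one.\<close>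

lemma eigenvalue_paths_uniformly_close:
  assumes e: "0 < e"
  shows "\<forall>\<^sub>F n in sequentially. \<forall>r. \<not> n dvd 2 * r \<longrightarrow>
    \<bar>expectation (\<lambda>\<omega>. g (eigenvalue_path n r \<omega>)) - (\<integral>\<omega>. g (\<lambda>t\<in>{0..}. W t \<omega>) \<partial>N)\<bar> < e"
proof -
  let ?far = "\<lambda>n r. \<not> n dvd 2 * r \<and>
    \<not> \<bar>expectation (\<lambda>\<omega>. g (eigenvalue_path n r \<omega>)) - (\<integral>\<omega>. g (\<lambda>t\<in>{0..}. W t \<omega>) \<partial>N)\<bar> < e"
  \<comment> \<open>If no frequency is far, the default 1 takes over; it is not exceptional for
    \<open>n \<ge> 3\<close>, since such an \<open>n\<close> does not divide 2.\<close>
  define \<rho> where "\<rho> n = (if \<exists>r. ?far n r then SOME r. ?far n r else 1)" for n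
  have far: "?far n (\<rho> n)" if "?far n r" for n r
    unfolding \<rho>_def using that someI[of "?far n" r] by auto
  have "\<not> n dvd 2 * \<rho> n" if "n \<ge> 3" for n
  proof (cases "\<exists>r. ?far n r")
    case True
    then show ?thesis using far by blast
  next
    case False
    then have "\<rho> n = 1" unfolding \<rho>_def by (rule if_not_P)
    then show ?thesis using that by (auto dest: dvd_imp_le)
  qed
  then interpret A: walk_array M "\<lambda>n. walk_step n (\<rho> n)" "\<lambda>n. \<Sum>i\<le>n. (circulant_coeff n (\<rho> n) i)\<^sup>2" "192 + 32 * C"
    by (rule walk_array_eigenvalues)
  have "(\<lambda>n. expectation (\<lambda>\<omega>. g (A.path n \<omega>))) \<longlonglongrightarrow> (\<integral>\<omega>. g (\<lambda>t\<in>{0..}. W t \<omega>) \<partial>N)"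
    by (rule A.donsker[OF W g L lip])
  then have "\<forall>\<^sub>F n in sequentially. dist (expectation (\<lambda>\<omega>. g (A.path n \<omega>))) (\<integral>\<omega>. g (\<lambda>t\<in>{0..}. W t \<omega>) \<partial>N) < e"
    using e by (rule tendstoD)
  then show ?thesis
  proof eventually_elim
    case (elim n)
    then have "\<bar>expectation (\<lambda>\<omega>. g (eigenvalue_path n (\<rho> n) \<omega>)) - (\<integral>\<omega>. g (\<lambda>t\<in>{0..}. W t \<omega>) \<partial>N)\<bar> < e"
      by (simp add: A.path_def eigenvalue_path_def dist_real_def)
    then show ?case using far by blast
  qed
qed

lemma average_eigenvalue_expectation_tendsto:
  "(\<lambda>n. (\<Sum>r = 1..n. expectation (\<lambda>\<omega>. g (eigenvalue_path n r \<omega>))) / real n)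
    \<longlonglongrightarrow> (\<integral>\<omega>. g (\<lambda>t\<in>{0..}. W t \<omega>) \<partial>N)" (is "?avg \<longlonglongrightarrow> ?w")
proof (rule LIMSEQ_I)
  fix e :: real assume e: "0 < e"
  interpret N: prob_space N using W by (simp add: standard_brownian_motion_def)
  have w: "\<bar>?w\<bar> \<le> B"
    using W by (intro N.abs_expectation_le g continuous_path_cadlag) (simp add: standard_brownian_motion_def)
  \<comment> \<open>At most two exceptional frequencies, each off by at most \<open>2 * B\<close>,
    give the \<open>4 * B\<close>.\<close>
  have "(\<lambda>n. 4 * B * (1 / real n)) \<longlonglongrightarrow> 0" by (intro tendsto_mult_right_zero lim_1_over_n)
  then have "\<forall>\<^sub>F n in sequentially. 4 * B * (1 / real n) < e / 2"
    using e by (intro order_tendstoD(2)) auto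
  then have "\<forall>\<^sub>F n in sequentially. norm (?avg n - ?w) < e"
    using eigenvalue_paths_uniformly_close[OF half_gt_zero[OF e]] eventually_gt_at_top[of 0]
  proof eventually_elim
    case (elim n)
    let ?E = "\<lambda>r. expectation (\<lambda>\<omega>. g (eigenvalue_path n r \<omega>))"
    have E: "\<bar>?E r\<bar> \<le> B" for r
      by (intro abs_expectation_le g eigenvalue_path_cadlag) (use elim in simp)
    have "B \<ge> 0" using w by simp
    have "\<bar>\<Sum>r = 1..n. ?E r - ?w\<bar> \<le> (\<Sum>r = 1..n. e / 2 + of_bool (n dvd 2 * r) * (2 * B))"
    proof (intro order_trans[OF sum_abs] sum_mono)
      fix r
      show "\<bar>?E r - ?w\<bar> \<le> e / 2 + of_bool (n dvd 2 * r) * (2 * B)"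
      proof (cases "n dvd 2 * r")
        case True
        have "\<bar>?E r - ?w\<bar> \<le> 2 * B" using E[of r] w by linarith
        then show ?thesis using True e by simp
      next
        case False
        then show ?thesis using elim by (simp add: less_imp_le)
      qed
    qed
    also have "\<dots> = real n * (e / 2) + real (card {r \<in> {1..n}. n dvd 2 * r}) * (2 * B)"
    proof -
      have "(\<Sum>r = 1..n. of_bool (n dvd 2 * r) :: real) = real (card {r \<in> {1..n}. n dvd 2 * r})"
        by (simp add: of_bool_def flip: sum.inter_filter)
      then show ?thesis by (simp add: sum.distrib flip: sum_distrib_right)
    qed
    also have "\<dots> \<le> real n * (e / 2) + 2 * (2 * B)"
      using card_bad_frequencies[of n] \<open>B \<ge> 0\<close> by (intro add_left_mono mult_right_mono) auto
    finally have S: "\<bar>\<Sum>r = 1..n. ?E r - ?w\<bar> \<le> real n * (e / 2) + 4 * B" by simp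
    have "?avg n - ?w = (\<Sum>r = 1..n. ?E r - ?w) / real n"
      using elim by (simp add: sum_subtractf diff_divide_distrib)
    then have "\<bar>?avg n - ?w\<bar> \<le> (real n * (e / 2) + 4 * B) / real n"
      using S elim by (simp add: abs_divide divide_right_mono)
    also have "\<dots> = e / 2 + 4 * B * (1 / real n)" using elim by (simp add: add_divide_distrib)
    also have "\<dots> < e" using elim by simp
    finally show ?case by simp
  qed
  then show "\<exists>no. \<forall>n\<ge>no. norm (?avg n - ?w) < e" by (simp add: eventually_sequentially)
qed

end

end

section \<open>Choosing an eigenvalue at random\<close>

context prob_space
begin

text \<open>Preimages of Borel sets under \<open>f (U \<omega>)\<close> and under \<open>G\<close>
  belong to the two given independent families. Being closed under intersection, they pass
  independence on to the sigma-algebras they generate, which is the form that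
  \<open>indep_var\<close> demands.\<close>

lemma indep_set_preimages_imp_indep_var:
  assumes indep: "indep_set {U -` A \<inter> space M | A. A \<in> sets (count_space UNIV)} (sigma_sets (space M) \<G>)"
    and G: "G \<in> borel_measurable (sigma (space M) \<G>)" and \<G>: "\<G> \<subseteq> Pow (space M)"
  shows "indep_var borel (\<lambda>\<omega>. f (U \<omega>) :: real) borel G"
proof -
  have sets: "sets (sigma (space M) \<G>) = sigma_sets (space M) \<G>" and space: "space (sigma (space M) \<G>) = space M"
    using \<G> by simp_all
  have GB: "G -` A \<inter> space M \<in> sigma_sets (space M) \<G>" if "A \<in> sets borel" for A
    using measurable_sets[OF G that] by (simp only: sets space)
  have UB: "(\<lambda>\<omega>. f (U \<omega>)) -` A \<inter> space M \<in> {U -` A \<inter> space M | A. A \<in> sets (count_space UNIV)}" for A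
    by (auto intro!: exI[of _ "f -` A"])
  have U: "(\<lambda>\<omega>. f (U \<omega>)) \<in> borel_measurable M"
    using indep_setD_ev1[OF indep] UB by (auto simp: measurable_def)
  have G': "G \<in> borel_measurable M"
    using indep_setD_ev2[OF indep] GB by (auto simp: measurable_def)
  have ind: "indep_set {(\<lambda>\<omega>. f (U \<omega>)) -` A \<inter> space M | A. A \<in> sets borel} {G -` A \<inter> space M | A. A \<in> sets borel}"
    using indep unfolding indep_set_def
    by (rule indep_sets_mono_sets) (use GB UB in \<open>auto split: bool.split\<close>)
  have stable: "Int_stable {V -` A \<inter> space M | A. A \<in> sets borel}" for V :: "'a \<Rightarrow> real"
  proof (rule Int_stableI)
    fix a b assume "a \<in> {V -` A \<inter> space M | A. A \<in> sets borel}" "b \<in> {V -` A \<inter> space M | A. A \<in> sets borel}"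
    then obtain A B where "a = V -` A \<inter> space M" "b = V -` B \<inter> space M" "A \<inter> B \<in> sets borel" by auto
    then show "a \<inter> b \<in> {V -` A \<inter> space M | A. A \<in> sets borel}" by (auto intro!: exI[of _ "A \<inter> B"])
  qed
  show ?thesis
    unfolding indep_var_eq using U G' indep_set_sigma_sets[OF ind stable stable] by blast
qed

text \<open>Almost surely \<open>U\<close> takes a value in \<open>{1..n}\<close>, and there
  \<open>H\<close> is the sum of the \<open>G r\<close> cut by the events \<open>U = r\<close>.
  Independence factors each expectation, and each event has probability \<open>1 / n\<close>.
  Outside \<open>{1..n}\<close> the values of \<open>H\<close> are left open, as they occur on a
  null set only.\<close>

lemma expectation_at_uniform_index:
  fixes U :: "'a \<Rightarrow> nat" and G :: "nat \<Rightarrow> 'a \<Rightarrow> real"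
  assumes n: "1 \<le> n" and uniform: "distr M (count_space UNIV) U = measure_pmf (pmf_of_set {1..n})"
    and U [measurable]: "U \<in> measurable M (count_space UNIV)"
    and indep: "\<And>r. r \<in> {1..n} \<Longrightarrow> indep_var borel (\<lambda>\<omega>. indicator {r} (U \<omega>) :: real) borel (G r)"
    and G: "\<And>r. r \<in> {1..n} \<Longrightarrow> integrable M (G r)"
    and H: "H \<in> borel_measurable M" "\<And>\<omega>. \<omega> \<in> space M \<Longrightarrow> U \<omega> \<in> {1..n} \<Longrightarrow> H \<omega> = G (U \<omega>) \<omega>"
  shows "expectation H = (\<Sum>r = 1..n. expectation (G r)) / real n"
proof -
  have [measurable]: "G r \<in> borel_measurable M" if "r \<in> {1..n}" for r using G[OF that] by simp
  have "AE r in measure_pmf (pmf_of_set {1..n}). r \<in> {1..n}"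
    using n by (simp add: AE_measure_pmf_iff)
  then have AE: "AE \<omega> in M. U \<omega> \<in> {1..n}"
    unfolding uniform[symmetric] by (subst (asm) AE_distr_iff) auto
  have int: "integrable M (\<lambda>\<omega>. indicator {r} (U \<omega>) :: real)" for r
    by (rule integrable_const_bound[of _ 1]) (auto simp: indicator_def)
  have E1: "expectation (\<lambda>\<omega>. indicator {r} (U \<omega>)) = 1 / real n" if "r \<in> {1..n}" for r
  proof -
    have "expectation (\<lambda>\<omega>. indicator {r} (U \<omega>) :: real) = (\<integral>x. indicator {r} x \<partial>measure_pmf (pmf_of_set {1..n}))"
      unfolding uniform[symmetric] by (subst integral_distr) auto
    also have "\<dots> = 1 / real n"
      using that n by (simp add: measure_pmf_single)
    finally show ?thesis .
  qed
  have "expectation H = expectation (\<lambda>\<omega>. \<Sum>r = 1..n. indicator {r} (U \<omega>) * G r \<omega>)"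
  proof (rule integral_cong_AE)
    show "AE \<omega> in M. H \<omega> = (\<Sum>r = 1..n. indicator {r} (U \<omega>) * G r \<omega>)"
      using AE
    proof (rule AE_mp, intro AE_I2 impI)
      fix \<omega> assume \<omega>: "\<omega> \<in> space M" "U \<omega> \<in> {1..n}"
      have "(\<Sum>r = 1..n. indicator {r} (U \<omega>) * G r \<omega>) = (\<Sum>r = 1..n. if r = U \<omega> then G r \<omega> else 0)"
        by (intro sum.cong) (auto simp: indicator_def)
      also have "\<dots> = G (U \<omega>) \<omega>" using \<omega>(2) by simp
      finally show "H \<omega> = (\<Sum>r = 1..n. indicator {r} (U \<omega>) * G r \<omega>)" using H(2)[OF \<omega>] by simp
    qed
    show "(\<lambda>\<omega>. \<Sum>r = 1..n. indicator {r} (U \<omega>) * G r \<omega>) \<in> borel_measurable M"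
    proof (rule borel_measurable_sum)
      fix r assume "r \<in> {1..n}"
      then show "(\<lambda>\<omega>. indicator {r} (U \<omega>) * G r \<omega>) \<in> borel_measurable M"
        by (intro borel_measurable_times borel_measurable_integrable[OF int] borel_measurable_integrable[OF G])
    qed
  qed (rule H(1))
  also have "\<dots> = (\<Sum>r = 1..n. expectation (\<lambda>\<omega>. indicator {r} (U \<omega>) * G r \<omega>))"
    by (rule Bochner_Integration.integral_sum) (rule indep_var_integrable[OF indep int G])
  also have "\<dots> = (\<Sum>r = 1..n. expectation (G r) / real n)"
    by (intro sum.cong refl) (simp only: indep_var_lebesgue_integral[OF indep int G] E1, simp)
  finally show ?thesis by (simp add: sum_divide_distrib)
qed

end

theorem theorem3p4:
  fixes M :: "'a measure" and N :: "'b measure"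
    and X :: "nat \<Rightarrow> nat \<Rightarrow> 'a \<Rightarrow> real"
    and lam :: "nat \<Rightarrow> nat \<Rightarrow> real \<Rightarrow> 'a \<Rightarrow> real"
    and U :: "nat \<Rightarrow> 'a \<Rightarrow> nat"
    and W :: "real \<Rightarrow> 'b \<Rightarrow> real"
  assumes M: "prob_space M"
    and indep: "prob_space.indep_vars M (\<lambda>_. borel) (\<lambda>(i, k). X i k) {(i, k). k \<ge> 1}"
    and mean: "\<And>i k. k \<ge> 1 \<Longrightarrow> integrable M (X i k) \<and> prob_space.expectation M (X i k) = 0"
    and variance: "\<And>i k. k \<ge> 1 \<Longrightarrow> prob_space.variance M (X i k) = 1"
    and moments: "\<And>l::nat. l \<ge> 3 \<Longrightarrow>
      (SUP (i, k)\<in>{(i, k). k \<ge> 1}. \<integral>\<^sup>+\<omega>. ennreal (\<bar>X i k \<omega>\<bar> ^ l) \<partial>M) < \<infinity>"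
    and eigenvalues: "\<And>n t \<omega>. n \<ge> 1 \<Longrightarrow> t \<ge> 0 \<Longrightarrow> \<omega> \<in> space M \<Longrightarrow>
      char_poly ((1 / real n) \<cdot>\<^sub>m sym_circulant n (\<lambda>i. partial_sum X n i t \<omega>))
        = (\<Prod>r = 1..n. [:- lam n r t \<omega>, 1:])"
    and labelling: "\<And>n r t \<omega>. r \<in> {1..n} \<Longrightarrow> t \<ge> 0 \<Longrightarrow> \<omega> \<in> space M \<Longrightarrow>
      lam n r t \<omega> = fourier_eigenvalue n (\<lambda>i. partial_sum X n i t \<omega>) r"
    and uniform: "\<And>n. n \<ge> 1 \<Longrightarrow>
      distr M (count_space UNIV) (U n) = measure_pmf (pmf_of_set {1..n})"
    and indep_U: "\<And>n. n \<ge> 1 \<Longrightarrow> prob_space.indep_set M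
      {U n -` A \<inter> space M | A. A \<in> sets (count_space UNIV)}
      (sigma_sets (space M)
        {lam n r t -` B \<inter> space M | r t B. r \<in> {1..n} \<and> t \<ge> 0 \<and> B \<in> sets borel})"
    and W: "standard_brownian_motion N W"
  shows "converges_weakly skorokhod_topology M
      (\<lambda>n \<omega>. \<lambda>t\<in>{0..}. \<Sum>r = 1..n. lam n r t \<omega> * of_bool (U n \<omega> = r))
      N (\<lambda>\<omega>. \<lambda>t\<in>{0..}. W t \<omega>)"
proof -
  interpret M: prob_space M by (rule M)
  have N: "prob_space N" using W by (simp add: standard_brownian_motion_def)
  have rv: "X i k \<in> borel_measurable M" if "k \<ge> 1" for i k
    using bspec[OF conjunct1[OF indep[unfolded M.indep_vars_def2]], of "(i, k)"] that by simp
  \<comment> \<open>The moment hypothesis at \<open>l = 4\<close>; this supremum becomes the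
    constant of \<open>circulant_input\<close>, uniform in both indices.\<close>
  define S where "S = (SUP (i, k)\<in>{(i, k). k \<ge> 1}. \<integral>\<^sup>+\<omega>. ennreal (\<bar>X i k \<omega>\<bar> ^ 4) \<partial>M)"
  have S: "S < \<infinity>" unfolding S_def by (rule moments) simp
  have X4: "(\<integral>\<^sup>+\<omega>. ennreal (X i k \<omega> ^ 4) \<partial>M) \<le> S" if k: "k \<ge> 1" for i k
  proof -
    have "(case (i, k) of (i, k) \<Rightarrow> \<integral>\<^sup>+\<omega>. ennreal (\<bar>X i k \<omega>\<bar> ^ 4) \<partial>M) \<le> S"
      unfolding S_def by (rule SUP_upper) (use k in simp)
    then show ?thesis by simp
  qed
  have int4: "integrable M (\<lambda>\<omega>. X i k \<omega> ^ 4)" if k: "k \<ge> 1" for i k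
  proof (rule integrableI_bounded)
    show "(\<lambda>\<omega>. X i k \<omega> ^ 4) \<in> borel_measurable M" using rv[OF k] by simp
    show "(\<integral>\<^sup>+\<omega>. ennreal (norm (X i k \<omega> ^ 4)) \<partial>M) < \<infinity>" using X4[OF k, of i] S by simp
  qed
  interpret I: circulant_input M X "enn2real S"
  proof unfold_locales
    fix i k :: nat assume k: "k \<ge> 1"
    show "M.expectation (X i k) = 0" using mean[OF k] by simp
    show "M.expectation (\<lambda>\<omega>. (X i k \<omega>)\<^sup>2) = 1" using variance[OF k, of i] mean[OF k, of i] by simp
    show "integrable M (\<lambda>\<omega>. X i k \<omega> ^ 4)" by (rule int4[OF k])
    have "M.expectation (\<lambda>\<omega>. X i k \<omega> ^ 4) = enn2real (\<integral>\<^sup>+\<omega>. ennreal (X i k \<omega> ^ 4) \<partial>M)"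
      using int4[OF k] by (intro integral_eq_nn_integral) auto
    also have "\<dots> \<le> enn2real S" using X4[OF k] S by (intro enn2real_mono) simp_all
    finally show "M.expectation (\<lambda>\<omega>. X i k \<omega> ^ 4) \<le> enn2real S" .
  qed (rule indep)
  define Y where "Y n \<omega> = (\<lambda>t\<in>{0..}. \<Sum>r = 1..n. lam n r t \<omega> * of_bool (U n \<omega> = r))" for n \<omega>
  have lam_path: "lam n r t \<omega> = I.eigenvalue_path n r \<omega> t" if "r \<in> {1..n}" "0 \<le> t" "\<omega> \<in> space M" for n r t \<omega>
    using labelling[OF that] that(2) by (simp add: I.eigenvalue_path_eq)
  \<comment> \<open>The path is rebuilt from the eigenvalue at the times \<open>j / n\<close>. Each
    of these values is measurable for the sigma-algebra of which \<open>U n\<close> is independent,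
    hence so is the whole path.\<close>
  have lam_step: "I.eigenvalue_path n r \<omega> = step_path n (\<lambda>j. lam n r (real j / real n) \<omega>)"
    if r: "r \<in> {1..n}" and \<omega>: "\<omega> \<in> space M" for n r \<omega>
  proof -
    have "lam n r (real j / real n) \<omega> = (\<Sum>k<j. I.walk_step n r k \<omega>)" for j
      using lam_path[OF r _ \<omega>] r by (simp add: I.eigenvalue_path_def step_path_eq)
    then show ?thesis by (simp add: I.eigenvalue_path_def)
  qed
  have Y_in: "Y n \<omega> = I.eigenvalue_path n (U n \<omega>) \<omega>" if \<omega>: "\<omega> \<in> space M" and U: "U n \<omega> \<in> {1..n}" for n \<omega>
  proof -
    have "(\<Sum>r = 1..n. lam n r t \<omega> * of_bool (U n \<omega> = r)) = lam n (U n \<omega>) t \<omega>" for t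
    proof -
      have "(\<Sum>r = 1..n. lam n r t \<omega> * of_bool (U n \<omega> = r)) = (\<Sum>r = 1..n. if r = U n \<omega> then lam n r t \<omega> else 0)"
        by (intro sum.cong) auto
      then show ?thesis using U by simp
    qed
    then show ?thesis using labelling[OF U _ \<omega>] by (auto simp: Y_def I.eigenvalue_path_eq)
  qed
  \<comment> \<open>\<open>U n\<close> may leave \<open>{1..n}\<close> on a null set, and for
    \<open>n = 0\<close> it always does; the sum is then empty or zero, and the zero path keeps
    \<open>Y n\<close> inside the Skorokhod space.\<close>
  have Y_out: "Y n \<omega> = step_path 1 (\<lambda>_. 0)" if "U n \<omega> \<notin> {1..n}" for n \<omega>
  proof -
    have "(\<Sum>r = 1..n. lam n r t \<omega> * of_bool (U n \<omega> = r)) = 0" for t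
      using that by (intro sum.neutral) auto
    then show ?thesis by (simp add: Y_def step_path_def)
  qed
  have Um: "U n \<in> measurable M (count_space UNIV)" if "n \<ge> 1" for n
    using M.indep_setD_ev1[OF indep_U[OF that]] by (auto simp: measurable_def)
  have Ym: "Y n \<in> measurable M (borel_of skorokhod_topology)" for n
  proof (cases "n = 0")
    case True
    then have "Y n = (\<lambda>\<omega>. step_path 1 (\<lambda>_. 0))" using Y_out[of n] by auto
    then show ?thesis using measurable_step_path[of 1 "\<lambda>_ _. 0" M] by simp
  next
    case False
    then have U: "U n \<in> measurable M (count_space UNIV)" by (intro Um) simp
    \<comment> \<open>The index takes countably many values, so it is enough to have measurability
      for each fixed \<open>r\<close>.\<close>
    have "(\<lambda>\<omega>. if r \<in> {1..n} then I.eigenvalue_path n r \<omega> else step_path 1 (\<lambda>_. 0))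
        \<in> measurable M (borel_of skorokhod_topology)" for r
      using I.measurable_eigenvalue_path[of n r] measurable_step_path[of 1 "\<lambda>_ _. 0" M] False
      by (cases "r \<in> {1..n}") (simp_all del: One_nat_def)
    from measurable_compose_countable[OF this U]
    have "(\<lambda>\<omega>. if U n \<omega> \<in> {1..n} then I.eigenvalue_path n (U n \<omega>) \<omega> else step_path 1 (\<lambda>_. 0))
        \<in> measurable M (borel_of skorokhod_topology)" .
    then show ?thesis
      by (rule measurable_cong[THEN iffD2, rotated]) (use Y_in Y_out in auto)
  qed
  have "converges_weakly skorokhod_topology M Y N (\<lambda>\<omega>. \<lambda>t\<in>{0..}. W t \<omega>)"
  proof (rule skorokhod.converges_weakly_lipschitzI[OF M N Ym measurable_brownian_path[OF W]])
    fix g :: "(real \<Rightarrow> real) \<Rightarrow> real" and B L :: real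
    assume g: "\<And>x. x \<in> cadlag_space \<Longrightarrow> \<bar>g x\<bar> \<le> B" and L: "0 \<le> L"
      and lip: "\<And>x y. x \<in> cadlag_space \<Longrightarrow> y \<in> cadlag_space \<Longrightarrow> \<bar>g x - g y\<bar> \<le> L * skorokhod_dist x y"
    have gm: "g \<in> borel_measurable (borel_of skorokhod_topology)"
      using skorokhod.lipschitz_imp_continuous_map[OF lip] by (rule continuous_map_measurable_borel_of)
    have avg: "(\<integral>\<omega>. g (Y n \<omega>) \<partial>M) = (\<Sum>r = 1..n. M.expectation (\<lambda>\<omega>. g (I.eigenvalue_path n r \<omega>))) / real n"
      if n: "n \<ge> 1" for n
    proof (rule M.expectation_at_uniform_index[OF n uniform[OF n] Um[OF n]])
      let ?\<G> = "{lam n r t -` B \<inter> space M | r t B. r \<in> {1..n} \<and> t \<ge> 0 \<and> B \<in> sets borel}"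
      have \<G>: "?\<G> \<subseteq> Pow (space M)" by auto
      fix r assume r: "r \<in> {1..n}"
      \<comment> \<open>Measurability with respect to \<open>M\<close> would not do here:
        independence of \<open>U n\<close> is available only on the sigma-algebra generated by the
        eigenvalues.\<close>
      have lamG: "lam n r t \<in> borel_measurable (sigma (space M) ?\<G>)" if "0 \<le> t" for t
      proof (rule measurableI)
        fix A :: "real set" assume "A \<in> sets borel"
        then have "lam n r t -` A \<inter> space M \<in> ?\<G>" using r that by blast
        then show "lam n r t -` A \<inter> space (sigma (space M) ?\<G>) \<in> sets (sigma (space M) ?\<G>)"
          using \<G> by (simp only: space_measure_of sets_measure_of sigma_sets.Basic)
      qed simp
      have "(\<lambda>\<omega>. g (step_path n (\<lambda>j. lam n r (real j / real n) \<omega>))) \<in> borel_measurable (sigma (space M) ?\<G>)"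
        using n lamG by (intro measurable_compose[OF measurable_step_path gm]) auto
      then have "(\<lambda>\<omega>. g (I.eigenvalue_path n r \<omega>)) \<in> borel_measurable (sigma (space M) ?\<G>)"
        by (rule measurable_cong[THEN iffD2, rotated]) (use r lam_step \<G> in simp)
      then show "M.indep_var borel (\<lambda>\<omega>. indicator {r} (U n \<omega>) :: real) borel (\<lambda>\<omega>. g (I.eigenvalue_path n r \<omega>))"
        by (rule M.indep_set_preimages_imp_indep_var[OF indep_U[OF n] _ \<G>])
      show "integrable M (\<lambda>\<omega>. g (I.eigenvalue_path n r \<omega>))"
        using n g[OF I.eigenvalue_path_cadlag]
        by (intro M.integrable_const_bound[of _ B] AE_I2
            measurable_compose[OF I.measurable_eigenvalue_path gm]) auto
    next
      show "(\<lambda>\<omega>. g (Y n \<omega>)) \<in> borel_measurable M" by (rule measurable_compose[OF Ym gm])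
      show "g (Y n \<omega>) = g (I.eigenvalue_path n (U n \<omega>) \<omega>)" if "\<omega> \<in> space M" "U n \<omega> \<in> {1..n}" for \<omega>
        using Y_in[OF that] by simp
    qed
    show "(\<lambda>n. \<integral>\<omega>. g (Y n \<omega>) \<partial>M) \<longlonglongrightarrow> (\<integral>\<omega>. g (\<lambda>t\<in>{0..}. W t \<omega>) \<partial>N)"
      using I.average_eigenvalue_expectation_tendsto[OF W g L lip]
      by (rule Lim_transform_eventually) (auto simp: avg eventually_sequentially intro!: exI[of _ 1])
  qed
  then show ?thesis by (simp only: Y_def[abs_def])
qed

end
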